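(* For each integer $n\geq 1$, there exist an $n$-dimensional cubing $X_n$, a Morse function $h:X_n\rightarrow \mathbb{R}_{\geq 0}$, and an action of Houghton's group $\mathcal{H}_n$ on $X_n$ such that $\mathcal{H}_n$ acts on $X_n$ properly (but not cocompactly) by height-preserving (i.e. $h$-preserving) semi-simple isometries. Furthermore, for each $r \in \mathbb{R}_{\geq 0}$ the action of $\mathcal{H}_n$ restricted to the level set $h^{-1}(r)$ is cocompact.
   Context: $\mathbb{N}$ denotes the positive integers. For $n\ge 1$ let $Y_n=\{1,\dots,n\}\times\mathbb{N}$ ($n$ disjoint rays $R_k=\{k\}\times\mathbb{N}$). A bijection $g:Y_n\to Y_n$ (written on the right) is an eventual translation if there are $(m_1,\dots,m_n)\in\mathbb{Z}^n$ and a finite set $K_g\subset Y_n$ such that $(k,p)\cdot g=(k,p+m_k)$ for all $(k,p)\in Y_n-K_g$. Houghton's group $\mathcal{H}_n$ is the group of all eventual translations of $Y_n$, acting on $Y_n$ on the right ($gh$ means $g$ followed by $h$). A cubical complex is a regular CW-complex built from Euclidean unit cubes $I^k=[0,1]^k$: for each $k$-cell the attaching map $\partial I^k\to X^{(k-1)}$ is a homeomorphism onto its image and restricts on each face of $I^k$ to a linear homeomorphism onto a cube of one lower dimension. The link $Lk(v,X)$ of a vertex $v$ is the complex formed by the links of $v$ in the cubes containing it (the link of a vertex in a $k$-cube being a $(k-1)$-simplex). A simplicial complex is flag if every collection of pairwise adjacent vertices spans a simplex. A cubical complex is non-positively curved if the link of every vertex is a flag complex. A cubing is a 1-connected (connected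 and simply connected) non-positively curved cubical complex, equipped with the piecewise Euclidean length metric in which each cube is a unit Euclidean cube. A map $f:X\to\mathbb{R}$ on a cubical complex is a Morse function if for every $k$-cube with characteristic map $\varphi_j:I^k\to X$ the map $f\varphi_j$ extends to an affine map $\mathbb{R}^k\to\mathbb{R}$ and is constant only when $k=0$, and the image of the $0$-skeleton is discrete in $\mathbb{R}$. An isometry $g$ of a metric space $X$ is semi-simple if the displacement function $x\mapsto d(x,x\cdot g)$ attains its infimum on $X$; an action by isometries is semi-simple if every element acts as a semi-simple isometry. $\mathcal{H}_n$ is regarded as a discrete group. *)

theory Defs
  imports "HOL-Analysis.Analysis" "HOL-Algebra.Group" "HOL-Combinatorics.Permutations"
begin

section \<open>Houghton's groups\<close>

definition rays :: "nat \<Rightarrow> (nat \<times> nat) set" where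
  "rays n = {1..n} \<times> {1..}"

text \<open>As usual for \<^const>\<open>permutes\<close>, a bijection of \<^term>\<open>rays n\<close> is extended by the
  identity to the whole type.\<close>

definition eventual_translation :: "nat \<Rightarrow> (nat \<times> nat \<Rightarrow> nat \<times> nat) \<Rightarrow> bool" where
  "eventual_translation n g \<longleftrightarrow>
     g permutes rays n \<and>
     (\<exists>(m :: nat \<Rightarrow> int) K. finite K \<and> K \<subseteq> rays n \<and>
        (\<forall>(k, p) \<in> rays n - K. fst (g (k, p)) = k \<and> int (snd (g (k, p))) = int p + m k))"

text \<open>Permutations act on the right, so the product of \<open>g\<close> and \<open>h\<close> is \<open>g\<close> followed by \<open>h\<close>.\<close>

definition houghton :: "nat \<Rightarrow> (nat \<times> nat \<Rightarrow> nat \<times> nat) monoid" where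
  "houghton n = \<lparr>carrier = {g. eventual_translation n g}, mult = (\<lambda>g h. h \<circ> g), one = id\<rparr>"

lemma eventual_translation_id: "eventual_translation n id"
  unfolding eventual_translation_def
  by (intro conjI permutes_id exI[of _ "\<lambda>_. 0"] exI[of _ "{}"]) auto

lemma eventual_translation_comp:
  assumes "eventual_translation n g" "eventual_translation n h"
  shows "eventual_translation n (h \<circ> g)"
proof -
  from assms(1) obtain a K where g: "g permutes rays n" "finite K" "K \<subseteq> rays n"
    and ga: "\<And>k p. (k, p) \<in> rays n - K \<Longrightarrow>
               fst (g (k, p)) = k \<and> int (snd (g (k, p))) = int p + (a k :: int)"
    unfolding eventual_translation_def by blast
  from assms(2) obtain b L where h: "h permutes rays n" "finite L" "L \<subseteq> rays n"
    and hb: "\<And>k p. (k, p) \<in> rays n - L \<Longrightarrow>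
               fst (h (k, p)) = k \<and> int (snd (h (k, p))) = int p + (b k :: int)"
    unfolding eventual_translation_def by blast
  let ?N = "K \<union> inv_into UNIV g ` L"
  have sub: "?N \<subseteq> rays n"
    using g(1,3) h(3) permutes_in_image[OF permutes_inv[OF g(1)]] by auto
  have "fst ((h \<circ> g) (k, p)) = k \<and> int (snd ((h \<circ> g) (k, p))) = int p + (a k + b k)"
    if kp: "(k, p) \<in> rays n - ?N" for k p
  proof -
    have 1: "fst (g (k, p)) = k" "int (snd (g (k, p))) = int p + a k"
      using ga[of k p] kp by auto
    have "g (k, p) \<notin> L"
      using kp permutes_inverses(2)[OF g(1), of "(k, p)"] by (metis DiffE UnI2 imageI)
    moreover have "g (k, p) \<in> rays n"
      using kp permutes_in_image[OF g(1)] by auto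
    ultimately have "(k, snd (g (k, p))) \<in> rays n - L" and eq: "g (k, p) = (k, snd (g (k, p)))"
      using 1(1) by (metis DiffI prod.collapse)+
    from hb[OF this(1)] show ?thesis
      using 1 eq by (metis add.assoc comp_apply)
  qed
  then show ?thesis
    unfolding eventual_translation_def
    using g(2) h(2) sub permutes_compose[OF g(1) h(1)]
    by (intro conjI exI[of _ "\<lambda>k. a k + b k"] exI[of _ ?N]) auto
qed

lemma eventual_translation_inv:
  assumes "eventual_translation n g"
  shows "eventual_translation n (inv_into UNIV g)"
proof -
  from assms obtain a K where g: "g permutes rays n" "finite K" "K \<subseteq> rays n"
    and ga: "\<And>k p. (k, p) \<in> rays n - K \<Longrightarrow>
               fst (g (k, p)) = k \<and> int (snd (g (k, p))) = int p + (a k :: int)"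
    unfolding eventual_translation_def by blast
  have sub: "g ` K \<subseteq> rays n"
    using g(3) permutes_in_image[OF g(1)] by auto
  have "fst (inv_into UNIV g (k, p)) = k \<and> int (snd (inv_into UNIV g (k, p))) = int p + - a k"
    if kp: "(k, p) \<in> rays n - g ` K" for k p
  proof -
    obtain k' p' where q: "inv_into UNIV g (k, p) = (k', p')" by (cases "inv_into UNIV g (k, p)")
    have gq: "g (k', p') = (k, p)"
      using q permutes_inverses(1)[OF g(1), of "(k, p)"] by simp
    have "(k', p') \<in> rays n - K"
      using gq kp permutes_in_image[OF g(1), of "(k', p')"] by force
    from ga[OF this] show ?thesis using q gq by auto
  qed
  then show ?thesis
    unfolding eventual_translation_def
    using g(2) sub permutes_inv[OF g(1)]
    by (intro conjI exI[of _ "\<lambda>k. - a k"] exI[of _ "g ` K"]) auto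
qed

lemma group_houghton: "group (houghton n)"
proof (rule groupI)
  fix g assume "g \<in> carrier (houghton n)"
  then have g: "eventual_translation n g" by (simp add: houghton_def)
  then have "g \<circ> inv_into UNIV g = id"
    unfolding eventual_translation_def by (metis permutes_inv_o(1))
  then show "\<exists>h \<in> carrier (houghton n). h \<otimes>\<^bsub>houghton n\<^esub> g = \<one>\<^bsub>houghton n\<^esub>"
    using eventual_translation_inv[OF g]
    by (intro bexI[of _ "inv_into UNIV g"]) (simp_all add: houghton_def)
qed (simp_all add: houghton_def eventual_translation_id eventual_translation_comp comp_assoc)


section \<open>Cubical complexes\<close>

text \<open>The cube \<open>[0,1]^k\<close>, its interior, and its faces of codimension one, inside the
  library's \<^term>\<open>Euclidean_space k\<close> (sequences vanishing from index \<open>k\<close> on).\<close>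

definition ucube :: "nat \<Rightarrow> (nat \<Rightarrow> real) set" where
  "ucube k = {u. (\<forall>i<k. 0 \<le> u i \<and> u i \<le> 1) \<and> (\<forall>i\<ge>k. u i = 0)}"

definition ucube_interior :: "nat \<Rightarrow> (nat \<Rightarrow> real) set" where
  "ucube_interior k = {u. (\<forall>i<k. 0 < u i \<and> u i < 1) \<and> (\<forall>i\<ge>k. u i = 0)}"

definition ucube_facet :: "nat \<Rightarrow> nat \<Rightarrow> real \<Rightarrow> (nat \<Rightarrow> real) set" where
  "ucube_facet k i e = {u \<in> ucube k. u i = e}"

text \<open>\<open>f\<close> agrees on \<open>S\<close> with an affine map from \<open>\<real>^k\<close> to \<open>\<real>\<close>.\<close>

definition affine_map_on :: "nat \<Rightarrow> (nat \<Rightarrow> real) set \<Rightarrow> ((nat \<Rightarrow> real) \<Rightarrow> real) \<Rightarrow> bool" where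
  "affine_map_on k S f \<longleftrightarrow> (\<exists>a b. \<forall>u\<in>S. f u = b + (\<Sum>i<k. a i * u i))"

text \<open>Cells are indexed by \<open>'c\<close>, points have type \<open>'p\<close>. Only the values of a characteristic
  map on \<^term>\<open>ucube k\<close>, where \<open>k\<close> is the dimension of the cell, matter.\<close>

record ('c, 'p) cell_structure =
  cells :: "'c set"
  cell_dim :: "'c \<Rightarrow> nat"
  char_map :: "'c \<Rightarrow> (nat \<Rightarrow> real) \<Rightarrow> 'p"

definition closed_cell :: "('c, 'p) cell_structure \<Rightarrow> 'c \<Rightarrow> 'p set" where
  "closed_cell X j = char_map X j ` ucube (cell_dim X j)"

definition open_cell :: "('c, 'p) cell_structure \<Rightarrow> 'c \<Rightarrow> 'p set" where
  "open_cell X j = char_map X j ` ucube_interior (cell_dim X j)"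

definition points :: "('c, 'p) cell_structure \<Rightarrow> 'p set" where
  "points X = (\<Union>j \<in> cells X. closed_cell X j)"

definition vertices :: "('c, 'p) cell_structure \<Rightarrow> 'p set" where
  "vertices X = (\<Union>j \<in> {j \<in> cells X. cell_dim X j = 0}. closed_cell X j)"

text \<open>The open cells partition the space, each characteristic map is injective, and it carries
  every codimension-one face onto a closed cell through an affine bijection \<open>L\<close> of cubes.
  The space carries the weak topology defined below; for it, the characteristic maps of such a
  structure are embeddings, because closed cubes are compact and the space is Hausdorff, and
  the attaching maps are their restrictions to the boundaries of the cubes.\<close>

definition cubical_complex :: "('c, 'p) cell_structure \<Rightarrow> bool" where
  "cubical_complex X \<longleftrightarrow>
     (\<forall>j \<in> cells X. inj_on (char_map X j) (ucube (cell_dim X j))) \<and>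
     (\<forall>j \<in> cells X. \<forall>j' \<in> cells X. j \<noteq> j' \<longrightarrow> open_cell X j \<inter> open_cell X j' = {}) \<and>
     (\<forall>j \<in> cells X. \<forall>i < cell_dim X j. \<forall>e \<in> {0, 1}.
        \<exists>j' \<in> cells X. \<exists>L.
          Suc (cell_dim X j') = cell_dim X j \<and>
          bij_betw L (ucube_facet (cell_dim X j) i e) (ucube (cell_dim X j')) \<and>
          (\<forall>l < cell_dim X j'.
             affine_map_on (cell_dim X j) (ucube_facet (cell_dim X j) i e) (\<lambda>u. L u l)) \<and>
          (\<forall>u \<in> ucube_facet (cell_dim X j) i e. char_map X j u = char_map X j' (L u)))"

definition has_dimension :: "('c, 'p) cell_structure \<Rightarrow> nat \<Rightarrow> bool" where
  "has_dimension X n \<longleftrightarrow>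
     (\<forall>j \<in> cells X. cell_dim X j \<le> n) \<and> (\<exists>j \<in> cells X. cell_dim X j = n)"

definition weak_topology :: "('c, 'p) cell_structure \<Rightarrow> 'p topology" where
  "weak_topology X = topology (\<lambda>U. U \<subseteq> points X \<and>
     (\<forall>j \<in> cells X. openin (subtopology (Euclidean_space (cell_dim X j)) (ucube (cell_dim X j)))
        {u \<in> ucube (cell_dim X j). char_map X j u \<in> U}))"

lemma openin_weak_topology:
  "openin (weak_topology X) U \<longleftrightarrow> U \<subseteq> points X \<and>
     (\<forall>j \<in> cells X. openin (subtopology (Euclidean_space (cell_dim X j)) (ucube (cell_dim X j)))
        {u \<in> ucube (cell_dim X j). char_map X j u \<in> U})"
proof -
  let ?T = "\<lambda>j. subtopology (Euclidean_space (cell_dim X j)) (ucube (cell_dim X j))"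
  let ?P = "\<lambda>j U. {u \<in> ucube (cell_dim X j). char_map X j u \<in> U}"
  have int: "?P j (U \<inter> V) = ?P j U \<inter> ?P j V" for j U V by auto
  have un: "?P j (\<Union>\<K>) = \<Union>(?P j ` \<K>)" for j \<K> by auto
  have "istopology (\<lambda>U. U \<subseteq> points X \<and> (\<forall>j \<in> cells X. openin (?T j) (?P j U)))"
    unfolding istopology_def int un by (intro conjI allI impI ballI openin_Int openin_Union) auto
  then show ?thesis
    unfolding weak_topology_def by (simp add: topology_inverse')
qed


section \<open>Links and nonpositive curvature\<close>

text \<open>A cube of dimension \<open>k \<ge> 1\<close> at a vertex \<open>v\<close> contributes a simplex of dimension \<open>k - 1\<close> to
  the link, whose vertices are the links of \<open>v\<close> in the edges at \<open>v\<close> of that cube. Since cells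
  are embedded, an edge contributes exactly one vertex to the link of each of its endpoints,
  so the edges at \<open>v\<close> serve as the vertices of the link.\<close>

definition cubes_at :: "('c, 'p) cell_structure \<Rightarrow> 'p \<Rightarrow> 'c set" where
  "cubes_at X v = {j \<in> cells X. cell_dim X j \<ge> 1 \<and> v \<in> closed_cell X j}"

definition link_simplex :: "('c, 'p) cell_structure \<Rightarrow> 'p \<Rightarrow> 'c \<Rightarrow> 'c set" where
  "link_simplex X v j =
     {e \<in> cubes_at X v. cell_dim X e = 1 \<and> closed_cell X e \<subseteq> closed_cell X j}"

definition link :: "('c, 'p) cell_structure \<Rightarrow> 'p \<Rightarrow> 'c set set" where
  "link X v = link_simplex X v ` cubes_at X v"

text \<open>A simplicial complex is given by the vertex sets of its (nonempty) simplices.\<close>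

definition flag_complex :: "'a set set \<Rightarrow> bool" where
  "flag_complex K \<longleftrightarrow>
     (\<forall>S. finite S \<and> S \<noteq> {} \<and> S \<subseteq> \<Union>K \<and> (\<forall>a\<in>S. \<forall>b\<in>S. a \<noteq> b \<longrightarrow> {a, b} \<in> K) \<longrightarrow> S \<in> K)"

text \<open>In general distinct simplices of a link may have the same vertices; injectivity says that
  the link is a simplicial complex, as being a flag complex presupposes.\<close>

definition nonpositively_curved :: "('c, 'p) cell_structure \<Rightarrow> bool" where
  "nonpositively_curved X \<longleftrightarrow>
     (\<forall>v \<in> vertices X. inj_on (link_simplex X v) (cubes_at X v) \<and> flag_complex (link X v))"


section \<open>The piecewise Euclidean metric\<close>

text \<open>\<open>string_length X x y l\<close>: there is a string of points from \<open>x\<close> to \<open>y\<close>, consecutive ones in a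
  common cube, for which the Euclidean distances in these cubes add up to \<open>l\<close>.\<close>

inductive string_length :: "('c, 'p) cell_structure \<Rightarrow> 'p \<Rightarrow> 'p \<Rightarrow> real \<Rightarrow> bool" for X where
  refl: "x \<in> points X \<Longrightarrow> string_length X x x 0"
| step: "\<lbrakk>string_length X x (char_map X j u) l; j \<in> cells X;
          u \<in> ucube (cell_dim X j); w \<in> ucube (cell_dim X j)\<rbrakk>
         \<Longrightarrow> string_length X x (char_map X j w) (l + L2_set (\<lambda>i. u i - w i) {..<cell_dim X j})"

text \<open>Off the space the value is set to 0, since \<^locale>\<open>Metric_space\<close> demands nonnegativity and
  symmetry on the whole type.\<close>

definition length_dist :: "('c, 'p) cell_structure \<Rightarrow> 'p \<Rightarrow> 'p \<Rightarrow> real" where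
  "length_dist X x y =
     (if x \<in> points X \<and> y \<in> points X then Inf {l. string_length X x y l} else 0)"

abbreviation metric_topology :: "('c, 'p) cell_structure \<Rightarrow> 'p topology" where
  "metric_topology X \<equiv> Metric_space.mtopology (points X) (length_dist X)"


section \<open>Cubings and Morse functions\<close>

text \<open>The analogue for abstract topologies of the library's \<^const>\<open>simply_connected\<close>.\<close>

definition simply_connected_space :: "'p topology \<Rightarrow> bool" where
  "simply_connected_space T \<longleftrightarrow>
     (\<forall>p q. pathin T p \<and> p 1 = p 0 \<and> pathin T q \<and> q 1 = q 0 \<longrightarrow>
        homotopic_with (\<lambda>r. r 1 = r 0) (top_of_set {0..1}) T p q)"

text \<open>The last condition holds for every connected cubical complex; it records that the space
  is regarded as a metric space.\<close>

definition cubing :: "('c, 'p) cell_structure \<Rightarrow> bool" where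
  "cubing X \<longleftrightarrow>
     cubical_complex X \<and> nonpositively_curved X \<and>
     connected_space (weak_topology X) \<and> simply_connected_space (weak_topology X) \<and>
     Metric_space (points X) (length_dist X)"

definition morse_function :: "('c, 'p) cell_structure \<Rightarrow> ('p \<Rightarrow> real) \<Rightarrow> bool" where
  "morse_function X f \<longleftrightarrow>
     (\<forall>j \<in> cells X.
        affine_map_on (cell_dim X j) (ucube (cell_dim X j)) (f \<circ> char_map X j) \<and>
        ((f \<circ> char_map X j) constant_on ucube (cell_dim X j) \<longrightarrow> cell_dim X j = 0)) \<and>
     discrete (f ` vertices X)"


section \<open>Actions on metric spaces\<close>

definition right_action :: "('g, 'b) monoid_scheme \<Rightarrow> 'p set \<Rightarrow> ('p \<Rightarrow> 'g \<Rightarrow> 'p) \<Rightarrow> bool" where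
  "right_action G M act \<longleftrightarrow>
     (\<forall>x\<in>M. \<forall>g\<in>carrier G. act x g \<in> M) \<and>
     (\<forall>x\<in>M. act x \<one>\<^bsub>G\<^esub> = x) \<and>
     (\<forall>x\<in>M. \<forall>g\<in>carrier G. \<forall>h\<in>carrier G. act x (g \<otimes>\<^bsub>G\<^esub> h) = act (act x g) h)"

definition isometry_of :: "'p set \<Rightarrow> ('p \<Rightarrow> 'p \<Rightarrow> real) \<Rightarrow> ('p \<Rightarrow> 'p) \<Rightarrow> bool" where
  "isometry_of M d f \<longleftrightarrow> bij_betw f M M \<and> (\<forall>x\<in>M. \<forall>y\<in>M. d (f x) (f y) = d x y)"

definition semi_simple :: "'p set \<Rightarrow> ('p \<Rightarrow> 'p \<Rightarrow> real) \<Rightarrow> ('p \<Rightarrow> 'p) \<Rightarrow> bool" where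
  "semi_simple M d f \<longleftrightarrow> (\<exists>x\<in>M. \<forall>y\<in>M. d x (f x) \<le> d y (f y))"

text \<open>Properness for an isometric action of a discrete group: every point is the centre of a
  ball that meets only finitely many of its translates.\<close>

definition proper_action ::
  "('g, 'b) monoid_scheme \<Rightarrow> 'p set \<Rightarrow> ('p \<Rightarrow> 'p \<Rightarrow> real) \<Rightarrow> ('p \<Rightarrow> 'g \<Rightarrow> 'p) \<Rightarrow> bool" where
  "proper_action G M d act \<longleftrightarrow>
     (\<forall>x\<in>M. \<exists>r>0. finite {g \<in> carrier G.
        (\<lambda>y. act y g) ` Metric_space.mball M d x r \<inter> Metric_space.mball M d x r \<noteq> {}})"

text \<open>\<open>S\<close> is an invariant subspace of \<open>T\<close>, for instance a level set of an invariant function.\<close>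

definition cocompact_action ::
  "('g, 'b) monoid_scheme \<Rightarrow> 'p topology \<Rightarrow> 'p set \<Rightarrow> ('p \<Rightarrow> 'g \<Rightarrow> 'p) \<Rightarrow> bool" where
  "cocompact_action G T S act \<longleftrightarrow>
     (\<exists>K. compactin T K \<and> K \<subseteq> S \<and> S = (\<Union>g \<in> carrier G. (\<lambda>x. act x g) ` K))"


text \<open>Carrier types for the complex whose existence is claimed. They only have to be large
  enough (countably many cells, a continuum of points); their shape imposes no condition.\<close>

type_synonym cell_index = "(nat \<times> nat \<Rightarrow> nat \<times> nat) \<times> nat set"
type_synonym cell_point = "(nat \<times> nat \<Rightarrow> nat \<times> nat) \<times> (nat \<Rightarrow> real)"

end

theory Submission
  imports Defs
begin

text \<open>
  The complex is that of K. S. Brown. Its vertices are the injective maps from \<open>n\<close> rays to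
  themselves that are eventually translations; the monoid generated by the unit shifts
  \<open>t\<^sub>1, \<dots>, t\<^sub>n\<close> of the rays acts on them by precomposition, a vertex \<open>\<alpha>\<close> and a set \<open>S\<close> of rays
  span the cube of all \<open>t\<^sub>T \<alpha>\<close> with \<open>T \<subseteq> S\<close>, and Houghton's group acts by postcomposition. The
  height of \<open>\<alpha>\<close> is the number of points that \<open>\<alpha>\<close> misses.

  Read a vertex as \<open>n\<close> sequences: renumber the values of \<open>\<alpha>\<close> on the \<open>i\<close>-th ray by integers
  \<open>j > a\<^sub>i\<close> in such a way that the \<open>j\<close>-th value is \<open>(i, j)\<close> for large \<open>j\<close>. Then \<open>t\<^sub>i\<close> merely deletes
  the first term of the \<open>i\<close>-th sequence and raises \<open>a\<^sub>i\<close> by 1. A point of the complex is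
  therefore a pair \<open>(\<sigma>, x)\<close> of a real vector \<open>x\<close> and of sequences \<open>\<sigma>\<^sub>i\<close> defined exactly for the
  integers \<open>j > x\<^sub>i\<close>, with all values distinct (\<open>config\<close>), and a cube with bottom corner \<open>\<sigma>\<close>
  consists of truncations of \<open>\<sigma>\<close>. The complex becomes a subcomplex of a product of \<open>n\<close> trees.

  The coordinate map \<open>(\<sigma>, x) \<mapsto> x\<close> is isometric on every cube, hence does not increase
  distances (\<open>rdist_le_string_length\<close>), and all points above a fixed one form an isometric copy
  of a Euclidean orthant (\<open>length_dist_orthant\<close>). These two facts give the metric statements
  without any CAT(0) geometry. An element \<open>g\<close> with translation lengths \<open>m\<close> moves the coordinates
  by \<open>m\<close>, so it moves every point by at least \<open>|m|\<close>; far up in the orthant of the identity map it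
  acts as the translation by \<open>m\<close>, so \<open>|m|\<close> is attained. Moreover a short path cannot change the
  remaining part of a sequence (\<open>string_less_gap\<close>), which separates points and identifies the
  elements that move a point only a little with permutations of its finite set of missed values.

  Any two vertices have a common upper bound, and pushing all points upward at unit speed brings
  each point into the orthant of the identity, after a time of at most twice its distance from the
  origin. Followed by a contraction of the orthant this contracts the complex for the metric
  topology, which agrees with the weak topology because the complex is locally finite.

  In the link of a vertex an edge is an upward unit step or a downward one, which prepends a
  missed value to one of the sequences. Edges span a cube exactly when they use different
  directions and prepend different values. Both are conditions on pairs, so the link is flag.

  The height is the sum of the coordinates. It is invariant because translation lengths of a group
  element add up to 0, and the group is transitive on the vertices of a given height, as two sets
  of missed values of the same finite size can be matched by a bijection. A level set meets the
  cubes based at finitely many heights only, hence is covered by the translates of finitely many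
  cubes. The height is unbounded on the complex, so the whole action is not cocompact.
\<close>

section \<open>Configurations and the complex\<close>

text \<open>Sequences indexed by \<open>int\<close>, one for each ray, are coded by functions on \<open>nat \<times> nat\<close>, so that
they fit into \<^typ>\<open>cell_index\<close> and \<^typ>\<open>cell_point\<close>.\<close>

definition entry :: "(nat \<times> nat \<Rightarrow> nat \<times> nat) \<Rightarrow> nat \<Rightarrow> int \<Rightarrow> nat \<times> nat" where
  "entry \<sigma> i j = \<sigma> (i, int_encode j)"

definition of_entries :: "(nat \<Rightarrow> int \<Rightarrow> nat \<times> nat) \<Rightarrow> nat \<times> nat \<Rightarrow> nat \<times> nat" where
  "of_entries f = (\<lambda>(i, m). f i (int_decode m))"

lemma entry_of_entries [simp]: "entry (of_entries f) i j = f i j"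
  by (simp add: entry_def of_entries_def)

lemma entry_eqI:
  assumes "\<And>i j. entry \<sigma> i j = entry \<tau> i j"
  shows "\<sigma> = \<tau>"
proof
  fix q :: "nat \<times> nat"
  have "entry \<sigma> (fst q) (int_decode (snd q)) = entry \<tau> (fst q) (int_decode (snd q))"
    by (rule assms)
  then show "\<sigma> q = \<tau> q" by (simp add: entry_def)
qed

text \<open>The pair \<open>(0, 0)\<close>, which lies on no ray, marks the places where a sequence is undefined. As
the coordinates of \<open>x\<close> may be negative, the indices are integers.\<close>

definition config :: "nat \<Rightarrow> (nat \<times> nat \<Rightarrow> nat \<times> nat) \<Rightarrow> (nat \<Rightarrow> real) \<Rightarrow> bool" where
  "config n \<sigma> x \<longleftrightarrow>
     (\<forall>i. i \<notin> {1..n} \<longrightarrow> x i = 0) \<and>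
     (\<forall>i j. entry \<sigma> i j \<in> rays n \<longleftrightarrow> i \<in> {1..n} \<and> x i < of_int j) \<and>
     (\<forall>i j. entry \<sigma> i j \<notin> rays n \<longrightarrow> entry \<sigma> i j = (0, 0)) \<and>
     (\<forall>i j i' j'. entry \<sigma> i j = entry \<sigma> i' j' \<and> entry \<sigma> i j \<in> rays n \<longrightarrow> i = i' \<and> j = j') \<and>
     (\<exists>N::nat. \<forall>i\<in>{1..n}. \<forall>j>int N. entry \<sigma> i j = (i, nat j))"

text \<open>The vertices of the complex, which are also the bottom corners of its cubes.\<close>

definition corner :: "nat \<Rightarrow> (nat \<times> nat \<Rightarrow> nat \<times> nat) \<Rightarrow> (nat \<Rightarrow> real) \<Rightarrow> bool" where
  "corner n \<sigma> a \<longleftrightarrow> config n \<sigma> a \<and> (\<forall>i. a i \<in> \<int>)"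

definition base :: "nat \<Rightarrow> (nat \<times> nat \<Rightarrow> nat \<times> nat) \<Rightarrow> nat \<Rightarrow> real" where
  "base n \<sigma> = (THE a. corner n \<sigma> a)"

definition truncate :: "(nat \<times> nat \<Rightarrow> nat \<times> nat) \<Rightarrow> (nat \<Rightarrow> real) \<Rightarrow> nat \<times> nat \<Rightarrow> nat \<times> nat" where
  "truncate \<sigma> x = of_entries (\<lambda>i j. if x i < of_int j then entry \<sigma> i j else (0, 0))"

text \<open>The point with coordinates \<open>x\<close> in the orthant of all points above \<open>\<sigma>\<close>.\<close>

definition pt :: "(nat \<times> nat \<Rightarrow> nat \<times> nat) \<Rightarrow> (nat \<Rightarrow> real) \<Rightarrow> cell_point" where
  "pt \<sigma> x = (truncate \<sigma> x, x)"

definition floors :: "(nat \<Rightarrow> real) \<Rightarrow> nat \<Rightarrow> real" where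
  "floors x i = of_int \<lfloor>x i\<rfloor>"

definition corner_box :: "(nat \<Rightarrow> real) \<Rightarrow> nat set \<Rightarrow> (nat \<Rightarrow> real) set" where
  "corner_box a S = {x. \<forall>i. if i \<in> S then a i \<le> x i \<and> x i \<le> a i + 1 else x i = a i}"

text \<open>The coordinates of a cube over a set \<open>S\<close> of rays are indexed by \<open>S\<close>, those of
\<^term>\<open>ucube (card S)\<close> by an initial segment; the library's numbering of \<open>S\<close> links them.\<close>

definition spread :: "nat set \<Rightarrow> (nat \<Rightarrow> real) \<Rightarrow> nat \<Rightarrow> real" where
  "spread S u i = (if i \<in> S then u (to_nat_on S i) else 0)"

definition gather :: "nat set \<Rightarrow> (nat \<Rightarrow> real) \<Rightarrow> nat \<Rightarrow> real" where
  "gather S v l = (if l < card S then v (from_nat_into S l) else 0)"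

definition houghton_complex :: "nat \<Rightarrow> (cell_index, cell_point) cell_structure" ("\<X>\<^bsub>_\<^esub>") where
  "houghton_complex n =
     \<lparr>cells = {(\<sigma>, S). S \<subseteq> {1..n} \<and> (\<exists>a. corner n \<sigma> a)},
      cell_dim = (\<lambda>(\<sigma>, S). card S),
      char_map = (\<lambda>(\<sigma>, S) u. pt \<sigma> (\<lambda>i. base n \<sigma> i + spread S u i))\<rparr>"

definition rdist :: "nat \<Rightarrow> (nat \<Rightarrow> real) \<Rightarrow> (nat \<Rightarrow> real) \<Rightarrow> real" where
  "rdist n x y = L2_set (\<lambda>i. x i - y i) {1..n}"

lemma zero_notin_rays [simp]: "(0, 0) \<notin> rays n"
  by (simp add: rays_def)

lemma config_outside: "config n \<sigma> x \<Longrightarrow> i \<notin> {1..n} \<Longrightarrow> x i = 0"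
  by (simp add: config_def)

lemma config_entry_iff: "config n \<sigma> x \<Longrightarrow> entry \<sigma> i j \<in> rays n \<longleftrightarrow> i \<in> {1..n} \<and> x i < of_int j"
  by (simp add: config_def)

lemma config_entry_blank: "config n \<sigma> x \<Longrightarrow> \<not> (i \<in> {1..n} \<and> x i < of_int j) \<Longrightarrow> entry \<sigma> i j = (0, 0)"
  unfolding config_def by metis

lemma config_inj:
  "config n \<sigma> x \<Longrightarrow> entry \<sigma> i j = entry \<sigma> i' j' \<Longrightarrow> entry \<sigma> i j \<in> rays n \<Longrightarrow> i = i' \<and> j = j'"
  unfolding config_def by metis

lemma config_tail:
  assumes "config n \<sigma> x"
  obtains N :: nat where "\<And>i j. i \<in> {1..n} \<Longrightarrow> j > int N \<Longrightarrow> entry \<sigma> i j = (i, nat j)"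
  using assms unfolding config_def by metis

lemma entry_truncate [simp]:
  "entry (truncate \<sigma> x) i j = (if x i < of_int j then entry \<sigma> i j else (0, 0))"
  by (simp add: truncate_def)

lemma truncate_truncate: "(\<And>i. x i \<le> y i) \<Longrightarrow> truncate (truncate \<sigma> x) y = truncate \<sigma> y"
  by (rule entry_eqI) (auto intro: order.strict_trans1)

lemma truncate_self: "config n \<sigma> x \<Longrightarrow> truncate \<sigma> x = \<sigma>"
  by (rule entry_eqI) (auto simp: config_entry_blank)

lemma pt_self: "config n \<sigma> x \<Longrightarrow> pt \<sigma> x = (\<sigma>, x)"
  by (simp add: pt_def truncate_self)

text \<open>Raising the coordinates only deletes initial terms, so every vertex spans an orthant of points.\<close>

lemma config_truncate:
  assumes "config n \<sigma> a" and "\<And>i. a i \<le> x i" and "\<And>i. i \<notin> {1..n} \<Longrightarrow> x i = 0"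
  shows "config n (truncate \<sigma> x) x"
proof -
  obtain N :: nat where N: "\<And>i j. i \<in> {1..n} \<Longrightarrow> j > int N \<Longrightarrow> entry \<sigma> i j = (i, nat j)"
    using config_tail[OF assms(1)] by blast
  obtain M :: nat where M: "\<And>i. i \<in> {1..n} \<Longrightarrow> x i \<le> of_nat M"
  proof -
    have "x i \<le> of_nat (nat \<lceil>\<Sum>i\<in>{1..n}. \<bar>x i\<bar>\<rceil>)" if "i \<in> {1..n}" for i
    proof -
      have "\<bar>x i\<bar> \<le> (\<Sum>i\<in>{1..n}. \<bar>x i\<bar>)" using that by (intro member_le_sum) auto
      then show ?thesis using real_nat_ceiling_ge[of "\<Sum>i\<in>{1..n}. \<bar>x i\<bar>"] by linarith
    qed
    then show ?thesis using that by blast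
  qed
  have "entry (truncate \<sigma> x) i j = (i, nat j)" if "i \<in> {1..n}" "j > int (max N M)" for i j
  proof -
    have "x i < of_int j" using M[OF that(1)] that(2) by linarith
    then show ?thesis using N[OF that(1), of j] that(2) by simp
  qed
  moreover have "entry (truncate \<sigma> x) i j \<in> rays n \<longleftrightarrow> i \<in> {1..n} \<and> x i < of_int j" for i j
    using config_entry_iff[OF assms(1), of i j] assms(2)[of i] by auto
  moreover have "entry (truncate \<sigma> x) i j = (0, 0)" if "entry (truncate \<sigma> x) i j \<notin> rays n" for i j
    using that config_entry_iff[OF assms(1), of i j] config_entry_blank[OF assms(1), of i j] by auto
  moreover have "i = i' \<and> j = j'"
    if "entry (truncate \<sigma> x) i j = entry (truncate \<sigma> x) i' j'" "entry (truncate \<sigma> x) i j \<in> rays n"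
    for i j i' j'
    using that config_inj[OF assms(1), of i j i' j'] zero_notin_rays[of n]
    unfolding entry_truncate by (metis (no_types))
  ultimately show ?thesis
    unfolding config_def using assms(3) by blast
qed

lemma floors_less_iff [simp]: "floors x i < of_int j \<longleftrightarrow> x i < of_int j"
  by (simp add: floors_def floor_less_iff)

lemma floors_le: "floors x i \<le> x i"
  by (simp add: floors_def)

lemma corner_floors:
  assumes "config n \<sigma> x"
  shows "corner n \<sigma> (floors x)"
proof -
  have "floors x i = 0" if "i \<notin> {1..n}" for i
    using config_outside[OF assms that] by (simp add: floors_def)
  then have "config n \<sigma> (floors x)"
    using assms unfolding config_def floors_less_iff by blast
  then show ?thesis by (simp add: corner_def floors_def)
qed

text \<open>The coordinates of a vertex only tell where its sequences begin, so the sequences alone can serve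
to index the cubes.\<close>

lemma corner_unique:
  assumes "corner n \<sigma> a" "corner n \<sigma> b"
  shows "a = b"
proof
  fix i
  show "a i = b i"
  proof (cases "i \<in> {1..n}")
    case True
    from assms obtain k l where kl: "a i = of_int k" "b i = of_int l"
      unfolding corner_def by (metis Ints_cases)
    have "a i < of_int j \<longleftrightarrow> b i < of_int j" for j
      using config_entry_iff[of n \<sigma> a i j] config_entry_iff[of n \<sigma> b i j] assms True
      by (auto simp: corner_def)
    then have "k < j \<longleftrightarrow> l < j" for j by (simp add: kl)
    then have "k = l" by (metis linorder_neqE not_less_iff_gr_or_eq)
    then show ?thesis by (simp add: kl)
  next
    case False
    then show ?thesis using assms config_outside by (metis corner_def)
  qed
qed

lemma base_eq: "corner n \<sigma> a \<Longrightarrow> base n \<sigma> = a"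
  unfolding base_def using corner_unique by blast

lemma floors_Ints: "x i \<in> \<int> \<Longrightarrow> floors x i = x i"
  by (auto simp: floors_def elim: Ints_cases)

lemma floors_box:
  assumes "\<And>i. a i \<in> \<int>" "\<And>i. a i \<le> x i \<and> x i < a i + 1"
  shows "floors x = a"
proof
  fix i
  obtain k where "a i = of_int k" using assms(1)[of i] by (auto elim: Ints_cases)
  then show "floors x i = a i" using assms(2)[of i] by (simp add: floors_def) linarith
qed

section \<open>Cells\<close>

lemma corner_box_in: "x \<in> corner_box a S \<Longrightarrow> i \<in> S \<Longrightarrow> a i \<le> x i \<and> x i \<le> a i + 1"
  by (simp add: corner_box_def)

lemma corner_box_out: "x \<in> corner_box a S \<Longrightarrow> i \<notin> S \<Longrightarrow> x i = a i"
  by (simp add: corner_box_def)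

lemma corner_box_translate:
  "(\<lambda>i. x i + m i) \<in> corner_box (\<lambda>i. a i + m i) S \<longleftrightarrow> x \<in> corner_box a S"
  by (simp add: corner_box_def)

lemma bounded_on_indices: "\<exists>B::nat. \<forall>i\<in>{1..n::nat}. \<bar>m i :: int\<bar> \<le> int B"
proof (intro exI ballI)
  fix i assume "i \<in> {1..n}"
  then have "\<bar>m i\<bar> \<le> (\<Sum>i\<in>{1..n}. \<bar>m i\<bar>)" by (intro member_le_sum) auto
  then show "\<bar>m i\<bar> \<le> int (nat (\<Sum>i\<in>{1..n}. \<bar>m i\<bar>))" by linarith
qed

lemma to_nat_on_less: "finite S \<Longrightarrow> i \<in> S \<Longrightarrow> to_nat_on S i < card S"
  using to_nat_on_finite[of S] by (auto simp: bij_betw_def)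

lemma from_nat_into_in: "finite S \<Longrightarrow> l < card S \<Longrightarrow> from_nat_into S l \<in> S"
  by (metis card.empty from_nat_into not_less_zero)

lemma to_nat_on_from_nat_into_finite:
  "finite S \<Longrightarrow> l < card S \<Longrightarrow> to_nat_on S (from_nat_into S l) = l"
  using to_nat_on_finite[of S] by (intro to_nat_on_from_nat_into) (auto simp: bij_betw_def)

lemma spread_gather: "finite S \<Longrightarrow> spread S (gather S v) = (\<lambda>i. if i \<in> S then v i else 0)"
  by (rule ext) (auto simp: spread_def gather_def to_nat_on_less countable_finite)

lemma gather_spread:
  "finite S \<Longrightarrow> (\<And>l. l \<ge> card S \<Longrightarrow> u l = 0) \<Longrightarrow> gather S (spread S u) = u"
  by (rule ext) (auto simp: spread_def gather_def to_nat_on_from_nat_into_finite from_nat_into_in)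

lemma spread_ucube:
  assumes "finite S"
  shows "(\<lambda>u i. a i + spread S u i) ` ucube (card S) = corner_box a S"
proof
  show "(\<lambda>u i. a i + spread S u i) ` ucube (card S) \<subseteq> corner_box a S"
    using assms by (auto simp: corner_box_def ucube_def spread_def to_nat_on_less)
  show "corner_box a S \<subseteq> (\<lambda>u i. a i + spread S u i) ` ucube (card S)"
  proof
    fix x assume x: "x \<in> corner_box a S"
    let ?v = "\<lambda>i. x i - a i"
    have "0 \<le> ?v i \<and> ?v i \<le> 1" if "i \<in> S" for i
      using that x by (auto simp: corner_box_def algebra_simps dest!: spec[of _ i])
    then have "gather S ?v \<in> ucube (card S)"
      using from_nat_into_in[OF assms] by (simp add: ucube_def gather_def)
    moreover have "?v i = 0" if "i \<notin> S" for i
      using that x spec[of _ i] by (fastforce simp: corner_box_def)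
    then have "x = (\<lambda>i. a i + spread S (gather S ?v) i)"
      using spread_gather[OF assms, of ?v] by (auto simp: fun_eq_iff)
    ultimately show "x \<in> (\<lambda>u i. a i + spread S u i) ` ucube (card S)" by blast
  qed
qed

lemma inj_on_spread: "finite S \<Longrightarrow> inj_on (spread S) (ucube (card S))"
  by (rule inj_on_inverseI[of _ "gather S"]) (simp add: gather_spread ucube_def)

lemma L2_spread:
  assumes "S \<subseteq> {1..n}"
  shows "L2_set (\<lambda>i. u i - w i) {..<card S} =
         rdist n (\<lambda>i. a i + spread S u i) (\<lambda>i. a i + spread S w i)"
proof -
  have fin: "finite S" using assms finite_subset by blast
  have "(\<Sum>l<card S. (u l - w l)\<^sup>2) = (\<Sum>i\<in>S. (spread S u i - spread S w i)\<^sup>2)"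
    by (rule sum.reindex_bij_betw[OF to_nat_on_finite[OF fin], symmetric, THEN trans])
       (simp add: spread_def)
  also have "\<dots> = (\<Sum>i\<in>{1..n}. (spread S u i - spread S w i)\<^sup>2)"
    by (rule sum.mono_neutral_left) (use assms in \<open>auto simp: spread_def\<close>)
  finally show ?thesis by (simp add: rdist_def L2_set_def)
qed

context
  fixes n :: nat
begin

lemma in_cells_iff: "(\<sigma>, S) \<in> cells \<X>\<^bsub>n\<^esub> \<longleftrightarrow> S \<subseteq> {1..n} \<and> (\<exists>a. corner n \<sigma> a)"
  by (simp add: houghton_complex_def)

lemma cell_dim_eq [simp]: "cell_dim \<X>\<^bsub>n\<^esub> (\<sigma>, S) = card S"
  by (simp add: houghton_complex_def)

lemma char_map_eq: "char_map \<X>\<^bsub>n\<^esub> (\<sigma>, S) u = pt \<sigma> (\<lambda>i. base n \<sigma> i + spread S u i)"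
  by (simp add: houghton_complex_def)

lemma cellE:
  assumes "c \<in> cells \<X>\<^bsub>n\<^esub>"
  obtains \<sigma> S a where "c = (\<sigma>, S)" "S \<subseteq> {1..n}" "finite S" "corner n \<sigma> a" "base n \<sigma> = a"
  using assms in_cells_iff base_eq finite_subset[OF _ finite_atLeastAtMost] by (metis surj_pair)

lemma closed_cell_eq:
  assumes "corner n \<sigma> a" "S \<subseteq> {1..n}"
  shows "closed_cell \<X>\<^bsub>n\<^esub> (\<sigma>, S) = pt \<sigma> ` corner_box a S"
proof -
  have "finite S" using assms(2) finite_subset by blast
  then show ?thesis
    by (simp add: closed_cell_def char_map_eq base_eq[OF assms(1)] flip: spread_ucube[of S a] image_comp)
       (simp add: image_image)
qed

lemma config_box:
  assumes "corner n \<sigma> a" "S \<subseteq> {1..n}" "x \<in> corner_box a S"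
  shows "config n (truncate \<sigma> x) x"
proof (rule config_truncate)
  show "config n \<sigma> a" using assms(1) by (simp add: corner_def)
  show "a i \<le> x i" for i using assms(3) spec[of _ i] by (fastforce simp: corner_box_def split: if_splits)
  show "x i = 0" if "i \<notin> {1..n}" for i
  proof -
    have "i \<notin> S" using assms(2) that by blast
    then have "x i = a i" using assms(3) by (simp add: corner_box_def)
    then show ?thesis using assms(1) that config_outside[of n \<sigma> a i] by (simp add: corner_def)
  qed
qed

lemma mem_box_floors:
  assumes "\<And>i. i \<notin> {1..n} \<Longrightarrow> x i = 0"
  shows "x \<in> corner_box (floors x) {1..n}"
  using assms by (auto simp: corner_box_def floors_def intro: order_less_imp_le)

lemma points_eq: "points \<X>\<^bsub>n\<^esub> = {(\<tau>, x). config n \<tau> x}"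
proof -
  have "points \<X>\<^bsub>n\<^esub> \<subseteq> {(\<tau>, x). config n \<tau> x}"
    unfolding points_def
  proof clarify
    fix \<sigma> S \<tau> x assume c: "(\<sigma>, S) \<in> cells \<X>\<^bsub>n\<^esub>" and x: "(\<tau>, x) \<in> closed_cell \<X>\<^bsub>n\<^esub> (\<sigma>, S)"
    then obtain a where "corner n \<sigma> a" "S \<subseteq> {1..n}" by (auto simp: in_cells_iff)
    with x show "config n \<tau> x" using config_box by (auto simp: closed_cell_eq pt_def)
  qed
  moreover have "(\<tau>, x) \<in> points \<X>\<^bsub>n\<^esub>" if "config n \<tau> x" for \<tau> x
  proof -
    have "x \<in> corner_box (floors x) {1..n}" using that config_outside by (intro mem_box_floors) blast
    then have "(\<tau>, x) \<in> closed_cell \<X>\<^bsub>n\<^esub> (\<tau>, {1..n})"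
      using corner_floors[OF that] pt_self[OF that] closed_cell_eq by (metis imageI order_refl)
    then show ?thesis
      using corner_floors[OF that] by (auto simp: points_def in_cells_iff intro!: bexI[of _ "(\<tau>, {1..n})"])
  qed
  ultimately show ?thesis by auto
qed

text \<open>The interior of a cube is recognised by its points: exactly the coordinates in
directions outside \<open>S\<close> are integers, and a point of the interior has the same sequences as the bottom corner.\<close>

lemma cubical_complex_houghton: "cubical_complex \<X>\<^bsub>n\<^esub>"
proof -
  have inj: "inj_on (char_map \<X>\<^bsub>n\<^esub> c) (ucube (cell_dim \<X>\<^bsub>n\<^esub> c))" if mem: "c \<in> cells \<X>\<^bsub>n\<^esub>" for c
  proof -
    obtain \<sigma> S a where c: "c = (\<sigma>, S)" "finite S" using cellE[OF mem] by blast
    show ?thesis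
      using inj_on_spread[OF c(2)] by (auto simp: c inj_on_def char_map_eq pt_def fun_eq_iff)
  qed
  have open_cells: "c = c'"
    if c: "c \<in> cells \<X>\<^bsub>n\<^esub>" "c' \<in> cells \<X>\<^bsub>n\<^esub>" "p \<in> open_cell \<X>\<^bsub>n\<^esub> c" "p \<in> open_cell \<X>\<^bsub>n\<^esub> c'" for c c' p
  proof -
    have *: "fst c = fst p \<and> snd c = {i. snd p i \<notin> \<int>}" if mem: "c \<in> cells \<X>\<^bsub>n\<^esub>" and "p \<in> open_cell \<X>\<^bsub>n\<^esub> c" for c
    proof -
      obtain \<sigma> S a where c: "c = (\<sigma>, S)" "finite S" "corner n \<sigma> a" "base n \<sigma> = a" "S \<subseteq> {1..n}"
        using cellE[OF mem] by blast
      from that(2) obtain u where u: "u \<in> ucube_interior (card S)"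
        and p: "p = pt \<sigma> (\<lambda>i. a i + spread S u i)"
        by (auto simp: open_cell_def c char_map_eq)
      define x where "x = (\<lambda>i. a i + spread S u i)"
      have ai: "a i \<in> \<int>" for i using c(3) by (simp add: corner_def)
      have sp: "i \<in> S \<Longrightarrow> 0 < spread S u i \<and> spread S u i < 1" "i \<notin> S \<Longrightarrow> spread S u i = 0" for i
        using u to_nat_on_less[OF c(2)] by (auto simp: spread_def ucube_interior_def)
      have "floors x = a" 
      proof (intro floors_box conjI)
        show "a i \<le> x i" "x i < a i + 1" for i using sp[of i] by (cases "i \<in> S"; simp add: x_def)+
      qed (rule ai)
      then have "truncate \<sigma> x = truncate \<sigma> a"
        by (intro entry_eqI) (metis entry_truncate floors_less_iff)
      also have "\<dots> = \<sigma>" using c(3) truncate_self[of n \<sigma> a] by (simp add: corner_def)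
      finally have "\<sigma> = fst p" by (simp add: p pt_def x_def)
      moreover have "x i \<in> \<int> \<longleftrightarrow> i \<notin> S" for i
      proof
        assume "x i \<in> \<int>"
        then have "spread S u i \<in> \<int>" using Ints_diff[OF _ ai, of "x i" i] by (simp add: x_def)
        then show "i \<notin> S" using sp[of i] by (auto elim!: Ints_cases)
      qed (use ai sp in \<open>auto simp: x_def\<close>)
      then have "S = {i. snd p i \<notin> \<int>}" by (auto simp: p pt_def x_def)
      ultimately show ?thesis by (simp add: c)
    qed
    show ?thesis using *[OF c(1,3)] *[OF c(2,4)] by (simp add: prod_eq_iff)
  qed
  have facets: "\<exists>c' \<in> cells \<X>\<^bsub>n\<^esub>. \<exists>L.
          Suc (cell_dim \<X>\<^bsub>n\<^esub> c') = cell_dim \<X>\<^bsub>n\<^esub> c \<and>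
          bij_betw L (ucube_facet (cell_dim \<X>\<^bsub>n\<^esub> c) i e) (ucube (cell_dim \<X>\<^bsub>n\<^esub> c')) \<and>
          (\<forall>l < cell_dim \<X>\<^bsub>n\<^esub> c'.
             affine_map_on (cell_dim \<X>\<^bsub>n\<^esub> c) (ucube_facet (cell_dim \<X>\<^bsub>n\<^esub> c) i e) (\<lambda>u. L u l)) \<and>
          (\<forall>u \<in> ucube_facet (cell_dim \<X>\<^bsub>n\<^esub> c) i e. char_map \<X>\<^bsub>n\<^esub> c u = char_map \<X>\<^bsub>n\<^esub> c' (L u))"
    if mem: "c \<in> cells \<X>\<^bsub>n\<^esub>" and "i < cell_dim \<X>\<^bsub>n\<^esub> c" "e \<in> {0, 1}" for c i e
  proof -
    obtain \<sigma> S a where c: "c = (\<sigma>, S)" "finite S" "corner n \<sigma> a" "base n \<sigma> = a" "S \<subseteq> {1..n}"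
      using cellE[OF mem] by blast
    have i: "i < card S" using that(2) c by simp
    define s where "s = from_nat_into S i"
    have s: "s \<in> S" "to_nat_on S s = i"
      using i c(2) by (simp_all add: s_def from_nat_into_in to_nat_on_from_nat_into_finite)
    define T where "T = S - {s}"
    have T: "finite T" "T \<subseteq> {1..n}" "Suc (card T) = card S"
      using c(2,5) card_Suc_Diff1[OF c(2) s(1)] by (auto simp: T_def)
    \<comment> \<open>The bottom corner of the facet: unchanged for e = 0, one step higher in direction s for e = 1.\<close>
    define b where "b = a(s := a s + e)"
    have ab: "a k \<le> b k" for k using that(3) by (auto simp: b_def)
    have cb: "corner n (truncate \<sigma> b) b"
      unfolding corner_def
    proof (intro conjI allI config_truncate)
      show "config n \<sigma> a" using c by (simp add: corner_def)
      show "b k \<in> \<int>" for k using c(3) that(3) by (auto simp: b_def corner_def)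
      show "b k = 0" if "k \<notin> {1..n}" for k
        using c(3,5) s(1) that config_outside[of n \<sigma> a k] by (auto simp: b_def corner_def)
    qed (rule ab)
    let ?c = "(truncate \<sigma> b, T)"
    let ?L = "\<lambda>u. gather T (spread S u)"
    have sT: "spread T (?L u) = (\<lambda>k. if k = s then 0 else spread S u k)"
      for u unfolding spread_gather[OF T(1)] by (auto simp: T_def spread_def)
    have tlt: "to_nat_on S (from_nat_into T l) < card S \<and> from_nat_into T l \<in> S" if "l < card T" for l
      using from_nat_into_in[OF T(1) that] c(2) by (simp add: T_def to_nat_on_less)
    have bij: "bij_betw ?L (ucube_facet (card S) i e) (ucube (card T))"
    proof (rule bij_betw_byWitness[where f' = "\<lambda>w. gather S ((spread T w)(s := e))"])
      show "\<forall>u\<in>ucube_facet (card S) i e. gather S ((spread T (?L u))(s := e)) = u"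
      proof
        fix u assume u: "u \<in> ucube_facet (card S) i e"
        have "(spread T (?L u))(s := e) = spread S u"
          unfolding sT using u s by (auto simp: fun_eq_iff spread_def ucube_facet_def)
        then show "gather S ((spread T (?L u))(s := e)) = u"
          using u gather_spread[OF c(2)] by (auto simp: ucube_facet_def ucube_def)
      qed
      have r: "spread S (gather S ((spread T w)(s := e))) = (spread T w)(s := e)" for w
        unfolding spread_gather[OF c(2)] using s(1) by (auto simp: spread_def T_def)
      show "\<forall>w\<in>ucube (card T). ?L (gather S ((spread T w)(s := e))) = w"
      proof
        fix w assume w: "w \<in> ucube (card T)"
        have "gather T ((spread T w)(s := e)) = gather T (spread T w)"
          using from_nat_into_in[OF T(1)] by (auto simp: gather_def fun_eq_iff T_def)
        then show "?L (gather S ((spread T w)(s := e))) = w"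
          unfolding r using w gather_spread[OF T(1)] by (auto simp: ucube_def)
      qed
      show "?L ` ucube_facet (card S) i e \<subseteq> ucube (card T)"
        using tlt by (auto simp: ucube_facet_def ucube_def gather_def spread_def)
      have mT: "from_nat_into S l \<in> T" if "l < card S" "from_nat_into S l \<noteq> s" for l
        using that from_nat_into_in[OF c(2)] by (simp add: T_def)
      show "(\<lambda>w. gather S ((spread T w)(s := e))) ` ucube (card T) \<subseteq> ucube_facet (card S) i e"
        using that(3) i mT to_nat_on_less[OF T(1)] s
        by (fastforce simp: ucube_facet_def ucube_def gather_def spread_def s_def[symmetric])
    qed
    have aff: "affine_map_on (card S) (ucube_facet (card S) i e) (\<lambda>u. ?L u l)" if "l < card T" for l
      unfolding affine_map_on_def
    proof (intro exI ballI)
      fix u :: "nat \<Rightarrow> real"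
      have "(\<Sum>k<card S. of_bool (k = to_nat_on S (from_nat_into T l)) * u k)
            = u (to_nat_on S (from_nat_into T l))"
      proof -
        have "of_bool (k = q) * u k = (if k = q then u k else 0)" for k q by simp
        then show ?thesis
          using tlt[OF that] sum.delta[of "{..<card S}" "to_nat_on S (from_nat_into T l)" u] by simp
      qed
      then show "?L u l = 0 + (\<Sum>k<card S. of_bool (k = to_nat_on S (from_nat_into T l)) * u k)"
        using tlt[OF that] that by (simp add: gather_def spread_def)
    qed
    have chr: "char_map \<X>\<^bsub>n\<^esub> c u = char_map \<X>\<^bsub>n\<^esub> ?c (?L u)" if u: "u \<in> ucube_facet (card S) i e" for u
    proof -
      have x: "(\<lambda>k. b k + spread T (?L u) k) = (\<lambda>k. a k + spread S u k)"
        unfolding sT using u s by (auto simp: b_def fun_eq_iff spread_def ucube_facet_def)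
      have "b k \<le> a k + spread S u k" for k
        using u s to_nat_on_less[OF c(2)] by (auto simp: b_def spread_def ucube_facet_def ucube_def)
      then show ?thesis
        by (simp add: c char_map_eq base_eq[OF cb] x) (simp add: pt_def truncate_truncate)
    qed
    show ?thesis
      using T bij aff chr cb in_cells_iff c(1) by (intro bexI[of _ ?c] exI[of _ ?L]) auto
  qed
  show ?thesis
    unfolding cubical_complex_def using inj open_cells facets by blast
qed

lemma vertices_eq: "vertices \<X>\<^bsub>n\<^esub> = {(\<tau>, a). corner n \<tau> a}"
proof -
  have box0: "corner_box a {} = {a}" for a by (auto simp: corner_box_def)
  have *: "p \<in> closed_cell \<X>\<^bsub>n\<^esub> (\<sigma>, {}) \<longleftrightarrow> p = (\<sigma>, a)" if "corner n \<sigma> a" for \<sigma> a p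
    using that pt_self[of n \<sigma> a] by (simp add: closed_cell_eq box0 corner_def)
  have card0: "S \<subseteq> {1..n} \<Longrightarrow> card S = 0 \<longleftrightarrow> S = {}" for S
    by (metis card_0_eq finite_atLeastAtMost finite_subset)
  show ?thesis
  proof (intro Set.set_eqI iffI)
    fix p assume "p \<in> vertices \<X>\<^bsub>n\<^esub>"
    then obtain c where c: "c \<in> cells \<X>\<^bsub>n\<^esub>" "cell_dim \<X>\<^bsub>n\<^esub> c = 0" "p \<in> closed_cell \<X>\<^bsub>n\<^esub> c"
      by (auto simp: vertices_def)
    then obtain \<sigma> S a where "c = (\<sigma>, S)" "S \<subseteq> {1..n}" "corner n \<sigma> a" using cellE[OF c(1)] by blast
    with c show "p \<in> {(\<tau>, a). corner n \<tau> a}" using *[of \<sigma> a p] card0[of S] by auto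
  next
    fix p assume "p \<in> {(\<tau>, a). corner n \<tau> a}"
    then obtain \<tau> a where p: "p = (\<tau>, a)" "corner n \<tau> a" by blast
    then have "(\<tau>, {}) \<in> cells \<X>\<^bsub>n\<^esub>" "p \<in> closed_cell \<X>\<^bsub>n\<^esub> (\<tau>, {})" using * by (auto simp: in_cells_iff)
    then show "p \<in> vertices \<X>\<^bsub>n\<^esub>" unfolding vertices_def by force
  qed
qed

definition height :: "cell_point \<Rightarrow> real" where
  "height p = (\<Sum>i\<in>{1..n}. snd p i)"

lemma morse_function_height: "morse_function \<X>\<^bsub>n\<^esub> height"
proof -
  have h: "height (char_map \<X>\<^bsub>n\<^esub> (\<sigma>, S) u) = (\<Sum>i\<in>{1..n}. base n \<sigma> i) + (\<Sum>l<card S. u l)"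
    if "S \<subseteq> {1..n}" for \<sigma> S u
  proof -
    have fin: "finite S" using that finite_subset by blast
    have "(\<Sum>l<card S. u l) = (\<Sum>i\<in>S. spread S u i)"
      by (rule sum.reindex_bij_betw[OF to_nat_on_finite[OF fin], symmetric, THEN trans])
         (simp add: spread_def)
    also have "\<dots> = (\<Sum>i\<in>{1..n}. spread S u i)"
      by (rule sum.mono_neutral_left) (use that in \<open>auto simp: spread_def\<close>)
    finally show ?thesis by (simp add: height_def char_map_eq pt_def sum.distrib)
  qed
  have "affine_map_on (cell_dim \<X>\<^bsub>n\<^esub> c) (ucube (cell_dim \<X>\<^bsub>n\<^esub> c)) (height \<circ> char_map \<X>\<^bsub>n\<^esub> c) \<and>
        ((height \<circ> char_map \<X>\<^bsub>n\<^esub> c) constant_on ucube (cell_dim \<X>\<^bsub>n\<^esub> c) \<longrightarrow> cell_dim \<X>\<^bsub>n\<^esub> c = 0)"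
    if mem: "c \<in> cells \<X>\<^bsub>n\<^esub>" for c
  proof -
    obtain \<sigma> S where c: "c = (\<sigma>, S)" "S \<subseteq> {1..n}" using cellE[OF mem] by blast
    let ?b = "\<Sum>i\<in>{1..n}. base n \<sigma> i"
    have "affine_map_on (card S) (ucube (card S)) (height \<circ> char_map \<X>\<^bsub>n\<^esub> c)"
      unfolding affine_map_on_def by (rule exI[of _ "\<lambda>_. 1"], rule exI[of _ ?b]) (simp add: c h[OF c(2)])
    moreover have "card S = 0" if "(height \<circ> char_map \<X>\<^bsub>n\<^esub> c) constant_on ucube (card S)"
    proof -
      \<comment> \<open>The top vertex of a cube is higher than its bottom vertex by the dimension.\<close>
      let ?one = "\<lambda>l. if l < card S then 1 else 0 :: real"
      have "(\<lambda>_. 0) \<in> ucube (card S)" "?one \<in> ucube (card S)" by (auto simp: ucube_def)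
      then have "height (char_map \<X>\<^bsub>n\<^esub> c (\<lambda>_. 0)) = height (char_map \<X>\<^bsub>n\<^esub> c ?one)"
        using that unfolding constant_on_def comp_def by metis
      then show ?thesis by (simp add: c h[OF c(2)])
    qed
    ultimately show ?thesis by (simp add: c)
  qed
  moreover have "discrete (height ` vertices \<X>\<^bsub>n\<^esub>)"
  proof -
    have "height ` vertices \<X>\<^bsub>n\<^esub> \<subseteq> \<int>"
      by (auto simp: vertices_eq height_def corner_def intro!: Ints_sum)
    moreover have "uniform_discrete (\<int> :: real set)"
      unfolding uniform_discrete_def
      by (rule exI[of _ 1]) (auto simp: dist_real_def elim!: Ints_cases)
    ultimately show ?thesis
      by (meson discrete_subset uniform_discrete_imp_discrete)
  qed
  ultimately show ?thesis unfolding morse_function_def by blast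
qed

end

section \<open>The metric of a cell structure\<close>

lemma string_length_points:
  "string_length X p q l \<Longrightarrow> p \<in> points X \<and> q \<in> points X"
  by (induction rule: string_length.induct) (auto simp: points_def closed_cell_def)

lemma string_length_nonneg: "string_length X p q l \<Longrightarrow> 0 \<le> l"
  by (induction rule: string_length.induct) (auto intro: add_nonneg_nonneg L2_set_nonneg)

lemma string_length_single:
  assumes "j \<in> cells X" "u \<in> ucube (cell_dim X j)" "w \<in> ucube (cell_dim X j)"
  shows "string_length X (char_map X j u) (char_map X j w) (L2_set (\<lambda>i. u i - w i) {..<cell_dim X j})"
proof -
  have "char_map X j u \<in> points X" using assms by (auto simp: points_def closed_cell_def)
  from string_length.step[OF string_length.refl[OF this] assms] show ?thesis by simp
qed

lemma string_length_trans:
  assumes "string_length X q r k" "string_length X p q l"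
  shows "string_length X p r (l + k)"
  using assms
proof (induction arbitrary: rule: string_length.induct)
  case (refl q)
  then show ?case by simp
next
  case (step q j u k w)
  then show ?case using string_length.step[of X p j u "l + k" w] by (simp add: add.assoc)
qed

lemma string_length_sym: "string_length X p q l \<Longrightarrow> string_length X q p l"
proof (induction rule: string_length.induct)
  case (refl p)
  then show ?case by (rule string_length.refl)
next
  case (step p j u l w)
  have "string_length X (char_map X j w) (char_map X j u) (L2_set (\<lambda>i. w i - u i) {..<cell_dim X j})"
    by (rule string_length_single) (use step in auto)
  moreover have "L2_set (\<lambda>i. w i - u i) {..<cell_dim X j} = L2_set (\<lambda>i. u i - w i) {..<cell_dim X j}"
    by (simp add: L2_set_def power2_commute)
  ultimately show ?case using string_length_trans[OF step.IH] by (metis add.commute)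
qed

lemma length_dist_le:
  assumes "string_length X p q l"
  shows "length_dist X p q \<le> l"
proof -
  have "bdd_below {l. string_length X p q l}"
    using string_length_nonneg by (intro bdd_belowI[of _ 0]) auto
  then show ?thesis
    using string_length_points[OF assms] assms by (auto simp: length_dist_def intro: cInf_lower)
qed

text \<open>Then the infimum in \<^const>\<open>length_dist\<close> is over a nonempty set, and distances are approximated
by lengths of strings.\<close>

definition rectifiably_connected :: "('c, 'p) cell_structure \<Rightarrow> bool" where
  "rectifiably_connected X \<longleftrightarrow> (\<forall>p \<in> points X. \<forall>q \<in> points X. \<exists>l. string_length X p q l)"

lemma length_dist_less_imp:
  assumes "rectifiably_connected X" "p \<in> points X" "q \<in> points X" "length_dist X p q < e"
  obtains l where "string_length X p q l" "l < e"
proof -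
  have "{l. string_length X p q l} \<noteq> {}" using assms by (auto simp: rectifiably_connected_def)
  then have "\<exists>l\<in>{l. string_length X p q l}. l < e"
    using assms(2-4) by (intro cInf_lessD) (auto simp: length_dist_def)
  with that show ?thesis by blast
qed

lemma le_length_dist:
  assumes "rectifiably_connected X" "p \<in> points X" "q \<in> points X"
    and "\<And>l. string_length X p q l \<Longrightarrow> b \<le> l"
  shows "b \<le> length_dist X p q"
proof (rule ccontr)
  assume "\<not> b \<le> length_dist X p q"
  then have "length_dist X p q < b" by simp
  from length_dist_less_imp[OF assms(1-3) this] obtain l where "string_length X p q l" "l < b" .
  with assms(4)[of l] show False by simp
qed

lemma length_dist_mono:
  assumes "rectifiably_connected X" "p \<in> points X" "q \<in> points X"
    and "\<And>l. string_length X p q l \<Longrightarrow> string_length X p' q' l"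
  shows "length_dist X p' q' \<le> length_dist X p q"
  using assms by (intro le_length_dist length_dist_le) auto

text \<open>Only separation needs an argument about the particular complex; the other axioms hold because
strings can be concatenated and reversed.\<close>

lemma Metric_space_length_dist:
  assumes conn: "rectifiably_connected X"
    and sep: "\<And>p q. p \<in> points X \<Longrightarrow> q \<in> points X \<Longrightarrow> p \<noteq> q \<Longrightarrow>
                \<exists>b>0. \<forall>l. string_length X p q l \<longrightarrow> b \<le> l"
  shows "Metric_space (points X) (length_dist X)"
proof
  fix p q
  show nonneg: "0 \<le> length_dist X p q"
  proof (cases "p \<in> points X \<and> q \<in> points X")
    case True
    then show ?thesis by (intro le_length_dist[OF conn] string_length_nonneg) auto
  qed (auto simp: length_dist_def)
  have "string_length X p q = string_length X q p"
    using string_length_sym by (intro ext iffI)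
  then show "length_dist X p q = length_dist X q p" by (auto simp: length_dist_def)
  assume pq: "p \<in> points X" "q \<in> points X"
  show "length_dist X p q = 0 \<longleftrightarrow> p = q"
  proof
    assume 0: "length_dist X p q = 0"
    show "p = q"
    proof (rule ccontr)
      assume "p \<noteq> q"
      with sep[OF pq] obtain b where "b > 0" "\<And>l. string_length X p q l \<Longrightarrow> b \<le> l" by blast
      then have "b \<le> length_dist X p q" by (intro le_length_dist[OF conn pq])
      with 0 \<open>b > 0\<close> show False by linarith
    qed
  next
    assume "p = q"
    with length_dist_le[OF string_length.refl[OF pq(1)]] nonneg show "length_dist X p q = 0" by simp
  qed
  fix r assume r: "r \<in> points X"
  show "length_dist X p r \<le> length_dist X p q + length_dist X q r"
  proof (rule field_le_epsilon)
    fix e :: real assume e: "0 < e"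
    obtain k where k: "string_length X p q k" "k < length_dist X p q + e / 2"
      by (rule length_dist_less_imp[OF conn pq, of "length_dist X p q + e / 2"]) (use e in auto)
    obtain l where l: "string_length X q r l" "l < length_dist X q r + e / 2"
      by (rule length_dist_less_imp[OF conn pq(2) r, of "length_dist X q r + e / 2"]) (use e in auto)
    have "length_dist X p r \<le> k + l"
      by (rule length_dist_le) (rule string_length_trans[OF l(1) k(1)])
    with k l show "length_dist X p r \<le> length_dist X p q + length_dist X q r + e" by linarith
  qed
qed

section \<open>Euclidean distance of coordinate vectors\<close>

lemma rdist_nonneg: "0 \<le> rdist n x y"
  by (simp add: rdist_def L2_set_nonneg)

lemma rdist_refl [simp]: "rdist n x x = 0"
  by (simp add: rdist_def L2_set_def)

lemma rdist_triangle: "rdist n x z \<le> rdist n x y + rdist n y z"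
  using L2_set_triangle_ineq[of "\<lambda>i. x i - y i" "\<lambda>i. y i - z i" "{1..n}"] by (simp add: rdist_def)

lemma abs_diff_le_rdist:
  assumes "i \<in> {1..n}"
  shows "\<bar>x i - y i\<bar> \<le> rdist n x y"
  using member_le_L2_set[of "{1..n}" i "\<lambda>i. \<bar>x i - y i\<bar>"] assms by (simp add: rdist_def L2_set_def)

lemma rdist_scale:
  assumes "\<And>i. v i - w i = c * (x i - y i)"
  shows "rdist n v w = \<bar>c\<bar> * rdist n x y"
proof -
  have "(\<Sum>i\<in>{1..n}. (v i - w i)\<^sup>2) = c\<^sup>2 * (\<Sum>i\<in>{1..n}. (x i - y i)\<^sup>2)"
    by (simp add: assms sum_distrib_left power_mult_distrib)
  then show ?thesis by (simp add: rdist_def L2_set_def real_sqrt_mult)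
qed

lemma rdist_translate: "rdist n (\<lambda>i. x i + m i) (\<lambda>i. y i + m i) = rdist n x y"
  by (simp add: rdist_def)

lemma rdist_segment:
  assumes "0 \<le> t" "t \<le> 1"
  shows "rdist n x (\<lambda>i. x i + t * (y i - x i)) + rdist n (\<lambda>i. x i + t * (y i - x i)) y = rdist n x y"
proof -
  have "rdist n x (\<lambda>i. x i + t * (y i - x i)) = \<bar>t\<bar> * rdist n x y"
    by (rule rdist_scale) (simp add: algebra_simps)
  moreover have "rdist n (\<lambda>i. x i + t * (y i - x i)) y = \<bar>1 - t\<bar> * rdist n x y"
    by (rule rdist_scale) (simp add: algebra_simps)
  ultimately show ?thesis using assms by (simp add: algebra_simps)
qed

section \<open>The identity vertex\<close>

definition diag :: "nat \<Rightarrow> real \<Rightarrow> nat \<Rightarrow> real" where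
  "diag n c i = (if i \<in> {1..n} then c else 0)"

definition ident :: "nat \<Rightarrow> nat \<times> nat \<Rightarrow> nat \<times> nat" where
  "ident n = of_entries (\<lambda>i j. if i \<in> {1..n} \<and> 0 < j then (i, nat j) else (0, 0))"

lemma entry_ident: "entry (ident n) i j = (if i \<in> {1..n} \<and> 0 < j then (i, nat j) else (0, 0))"
  by (simp add: ident_def)

lemma corner_ident: "corner n (ident n) (\<lambda>_. 0)"
proof -
  have "config n (ident n) (\<lambda>_. 0)"
    unfolding config_def entry_ident
    by (intro conjI exI[of _ 0]) (auto simp: rays_def split: if_splits)
  then show ?thesis by (simp add: corner_def)
qed

text \<open>Sequences differ from those of the identity in finitely many places, so any two points have a
common upper bound. This is the source of connectedness and of contractibility.\<close>

lemma eventually_ident: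
  assumes "config n \<sigma> x"
  obtains M where "M \<ge> 0"
    "\<And>y. (\<And>i. i \<in> {1..n} \<Longrightarrow> M \<le> y i) \<Longrightarrow> (\<And>i. i \<notin> {1..n} \<Longrightarrow> y i = 0) \<Longrightarrow>
        (\<forall>i. x i \<le> y i) \<and> truncate \<sigma> y = truncate (ident n) y"
proof -
  obtain N :: nat where N: "\<And>i j. i \<in> {1..n} \<Longrightarrow> j > int N \<Longrightarrow> entry \<sigma> i j = (i, nat j)"
    using config_tail[OF assms] by blast
  have "(\<forall>i. x i \<le> y i) \<and> truncate \<sigma> y = truncate (ident n) y"
    if y: "\<And>i. i \<in> {1..n} \<Longrightarrow> real N + 1 \<le> y i" "\<And>i. i \<notin> {1..n} \<Longrightarrow> y i = 0" for y
  proof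
    show "\<forall>i. x i \<le> y i"
    proof
      fix i
      show "x i \<le> y i"
      proof (cases "i \<in> {1..n}")
        case True
        have "entry \<sigma> i (int N + 1) \<in> rays n"
          using N[OF True, of "int N + 1"] True by (simp add: rays_def)
        then have "x i < of_int (int N + 1)" using config_entry_iff[OF assms] by blast
        then show ?thesis using y(1)[OF True] by simp
      next
        case False
        then show ?thesis using y(2) config_outside[OF assms] by simp
      qed
    qed
    show "truncate \<sigma> y = truncate (ident n) y"
    proof (rule entry_eqI)
      fix i j
      show "entry (truncate \<sigma> y) i j = entry (truncate (ident n) y) i j"
      proof (cases "i \<in> {1..n} \<and> y i < of_int j")
        case True
        then have "j > int N" using y(1)[of i] by linarith
        then show ?thesis using True N[of i j] by (simp add: entry_ident)
      next
        case False
        then show ?thesis using config_entry_blank[OF assms, of i j] by (auto simp: entry_ident)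
      qed
    qed
  qed
  with that[of "real N + 1"] show ?thesis by simp
qed

section \<open>The metric of the complex\<close>

context
  fixes n :: nat
begin

lemma string_length_box:
  assumes a: "corner n \<sigma> a" and xy: "x \<in> corner_box a {1..n}" "y \<in> corner_box a {1..n}"
  shows "string_length \<X>\<^bsub>n\<^esub> (pt \<sigma> x) (pt \<sigma> y) (rdist n x y)"
proof -
  obtain u where u: "u \<in> ucube n" "x = (\<lambda>i. a i + spread {1..n} u i)"
    using xy(1) spread_ucube[of "{1..n}" a] by auto
  obtain w where w: "w \<in> ucube n" "y = (\<lambda>i. a i + spread {1..n} w i)"
    using xy(2) spread_ucube[of "{1..n}" a] by auto
  have "(\<sigma>, {1..n}) \<in> cells \<X>\<^bsub>n\<^esub>" using a by (auto simp: in_cells_iff)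
  from string_length_single[OF this, of u w] u w show ?thesis
    using L2_spread[of "{1..n}" n u w a] by (simp add: char_map_eq base_eq[OF a])
qed

text \<open>Every cube lies in an \<open>n\<close>-dimensional one with the same bottom corner, so a step of a string can
be taken to happen in a cube of full dimension, where lengths are distances of coordinates.\<close>

lemma string_length_houghton_induct [consumes 1, case_names refl step]:
  assumes "string_length \<X>\<^bsub>n\<^esub> p q l"
    and "p \<in> points \<X>\<^bsub>n\<^esub> \<Longrightarrow> P p 0"
    and "\<And>\<sigma> a x y l. corner n \<sigma> a \<Longrightarrow> x \<in> corner_box a {1..n} \<Longrightarrow> y \<in> corner_box a {1..n} \<Longrightarrow>
           string_length \<X>\<^bsub>n\<^esub> p (pt \<sigma> x) l \<Longrightarrow> P (pt \<sigma> x) l \<Longrightarrow> P (pt \<sigma> y) (l + rdist n x y)"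
  shows "P q l"
  using assms
proof (induction rule: string_length.induct)
  case (refl p)
  then show ?case by blast
next
  case (step p j u l w)
  obtain \<sigma> S a where c: "j = (\<sigma>, S)" "finite S" "corner n \<sigma> a" "base n \<sigma> = a" "S \<subseteq> {1..n}"
    using cellE[OF step.hyps(2)] by blast
  have box: "(\<lambda>i. a i + spread S v i) \<in> corner_box a {1..n}" if "v \<in> ucube (card S)" for v
    using that c(2,5) to_nat_on_less[OF c(2)] by (auto simp: corner_box_def spread_def ucube_def)
  have L: "L2_set (\<lambda>i. u i - w i) {..<cell_dim \<X>\<^bsub>n\<^esub> j} =
      rdist n (\<lambda>i. a i + spread S u i) (\<lambda>i. a i + spread S w i)"
    using L2_spread[OF c(5)] by (simp add: c(1))
  show ?case
    unfolding L using step.IH step.prems step.hyps box[of u] box[of w] c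
    by (auto simp: char_map_eq)
qed

lemma rdist_le_string_length: "string_length \<X>\<^bsub>n\<^esub> p q l \<Longrightarrow> rdist n (snd p) (snd q) \<le> l"
proof (induction rule: string_length_houghton_induct)
  case (step \<sigma> a x y l)
  then show ?case using rdist_triangle[of n "snd p" y x] by (simp add: pt_def)
qed simp

text \<open>Along a string of length \<open>l\<close> no coordinate rises above its initial value by more than \<open>l\<close>, so a
term of index beyond that bound is present all the time; and a term cannot change while it is
present, since points of one cube are truncations of the same sequences.\<close>

lemma entry_eq_of_string:
  assumes "string_length \<X>\<^bsub>n\<^esub> p q l" "i \<in> {1..n}" "snd p i + l < of_int j"
  shows "entry (fst q) i j = entry (fst p) i j"
  using assms(1,3)
proof (induction rule: string_length_houghton_induct)
  case (step \<sigma> a x y l)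
  have "string_length \<X>\<^bsub>n\<^esub> p (pt \<sigma> y) (l + rdist n x y)"
    using string_length_trans[OF string_length_box[OF step.hyps(1-3)] step.hyps(4)] .
  from rdist_le_string_length[OF this] rdist_le_string_length[OF step.hyps(4)]
  have "\<bar>snd p i - y i\<bar> \<le> l + rdist n x y \<and> \<bar>snd p i - x i\<bar> \<le> l"
    using abs_diff_le_rdist[OF assms(2), of "snd p" y] abs_diff_le_rdist[OF assms(2), of "snd p" x]
    by (simp add: pt_def)
  with step.prems rdist_nonneg[of n x y]
  have "y i < of_int j" "x i < of_int j" "snd p i + l < of_int j" by linarith+
  with step.IH show ?case by (simp add: pt_def)
qed simp

text \<open>The integral hyperplanes orthogonal to direction \<open>i\<close> that strictly separate \<open>x\<close> from \<open>y\<close>.\<close>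

definition crossings :: "(nat \<Rightarrow> real) \<Rightarrow> (nat \<Rightarrow> real) \<Rightarrow> nat \<Rightarrow> int set" where
  "crossings x y i = {c. min (x i) (y i) < of_int c \<and> of_int c < max (x i) (y i)}"

lemma finite_crossings: "finite (crossings x y i)"
  by (rule finite_subset[of _ "{\<lfloor>min (x i) (y i)\<rfloor>..\<lceil>max (x i) (y i)\<rceil>}"])
     (auto simp: crossings_def floor_le_iff le_ceiling_iff)

text \<open>The straight segment in an orthant is cut into pieces inside single cubes, by induction on the
number of integral hyperplanes that it crosses.\<close>

lemma string_length_orthant:
  assumes "config n \<sigma> a" "\<And>i. a i \<le> x i" "\<And>i. a i \<le> y i"
    "\<And>i. i \<notin> {1..n} \<Longrightarrow> x i = 0" "\<And>i. i \<notin> {1..n} \<Longrightarrow> y i = 0"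
  shows "string_length \<X>\<^bsub>n\<^esub> (pt \<sigma> x) (pt \<sigma> y) (rdist n x y)"
  using assms(2-)
proof (induction "\<Sum>i\<in>{1..n}. card (crossings x y i)" arbitrary: x y rule: less_induct)
  case less
  show ?case
  proof (cases "\<exists>i\<in>{1..n}. crossings x y i \<noteq> {}")
    case False
    \<comment> \<open>No hyperplane separates x from y, so the cube above the integral part of their minimum contains both.\<close>
    define m where "m i = min (x i) (y i)" for i
    let ?s = "truncate \<sigma> m"
    have "config n ?s m"
      using less.prems by (intro config_truncate[OF assms(1)]) (auto simp: m_def)
    then have cor: "corner n ?s (floors m)" by (rule corner_floors)
    have box: "z \<in> corner_box (floors m) {1..n}" if "z = x \<or> z = y" for z
    proof -
      have "floors m i \<le> z i" for i
        using floors_le[of m i] that by (auto simp: m_def min_le_iff_disj intro: order_trans)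
      moreover have "z i \<le> floors m i + 1" if "i \<in> {1..n}" for i
      proof (rule ccontr)
        assume "\<not> z i \<le> floors m i + 1"
        then have "of_int (\<lfloor>m i\<rfloor> + 1) < z i" by (simp add: floors_def)
        moreover have "m i < of_int (\<lfloor>m i\<rfloor> + 1)" by linarith
        ultimately have "\<lfloor>m i\<rfloor> + 1 \<in> crossings x y i"
          using \<open>z = x \<or> z = y\<close> by (auto simp: crossings_def m_def)
        with False \<open>i \<in> {1..n}\<close> show False by blast
      qed
      moreover have "z i = floors m i" if "i \<notin> {1..n}" for i
        using \<open>z = x \<or> z = y\<close> less.prems(3,4)[OF that] by (auto simp: m_def floors_def)
      ultimately show ?thesis by (simp add: corner_box_def)
    qed
    have "pt ?s x = pt \<sigma> x" "pt ?s y = pt \<sigma> y"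
      by (simp_all add: pt_def truncate_truncate m_def)
    with string_length_box[OF cor box box] show ?thesis by metis
  next
    case True
    then obtain k c where k: "k \<in> {1..n}" "c \<in> crossings x y k" by blast
    \<comment> \<open>The parameter at which the segment meets the hyperplane.\<close>
    define t where "t = (of_int c - x k) / (y k - x k)"
    define z where "z = (\<lambda>i. x i + t * (y i - x i))"
    have ne: "y k \<noteq> x k" using k(2) by (auto simp: crossings_def)
    have t: "0 \<le> t" "t \<le> 1"
      using k(2) by (auto simp: t_def crossings_def field_simps zero_le_divide_iff divide_le_eq min_def max_def split: if_splits)
    have zk: "z k = of_int c" using ne by (simp add: z_def t_def)
    have between: "min (x i) (y i) \<le> z i \<and> z i \<le> max (x i) (y i)" for i
    proof -
      have "z i = (1 - t) * x i + t * y i" by (simp add: z_def algebra_simps)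
      moreover have "(1 - t) * min (x i) (y i) + t * min (x i) (y i) \<le> (1 - t) * x i + t * y i"
        using t by (intro add_mono mult_left_mono) auto
      moreover have "(1 - t) * x i + t * y i \<le> (1 - t) * max (x i) (y i) + t * max (x i) (y i)"
        using t by (intro add_mono mult_left_mono) auto
      ultimately show ?thesis by (simp add: algebra_simps)
    qed
    have za: "a i \<le> z i" for i using between[of i] less.prems(1,2)[of i] by linarith
    have z0: "z i = 0" if "i \<notin> {1..n}" for i
      using less.prems(3,4)[OF that] by (simp add: z_def)
    have sub: "crossings x z i \<subseteq> crossings x y i" "crossings z y i \<subseteq> crossings x y i" for i
      using between[of i] by (auto simp: crossings_def)
    have "c \<notin> crossings x z k" "c \<notin> crossings z y k" using zk by (auto simp: crossings_def)
    then have psub: "crossings x z k \<subset> crossings x y k" "crossings z y k \<subset> crossings x y k"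
      using sub[of k] k(2) by blast+
    have fewer: "(\<Sum>i\<in>{1..n}. card (crossings u v i)) < (\<Sum>i\<in>{1..n}. card (crossings x y i))"
      if "\<And>i. crossings u v i \<subseteq> crossings x y i" "crossings u v k \<subset> crossings x y k" for u v
    proof (rule sum_strict_mono_ex1)
      show "\<forall>i\<in>{1..n}. card (crossings u v i) \<le> card (crossings x y i)"
        using card_mono[OF finite_crossings that(1)] by blast
      show "\<exists>i\<in>{1..n}. card (crossings u v i) < card (crossings x y i)"
        using psubset_card_mono[OF finite_crossings that(2)] k(1) by blast
    qed simp
    have "(\<Sum>i\<in>{1..n}. card (crossings x z i)) < (\<Sum>i\<in>{1..n}. card (crossings x y i))"
      by (rule fewer) (use sub psub in auto)
    from less.hyps[OF this less.prems(1) za less.prems(3) z0]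
    have 1: "string_length \<X>\<^bsub>n\<^esub> (pt \<sigma> x) (pt \<sigma> z) (rdist n x z)" .
    have "(\<Sum>i\<in>{1..n}. card (crossings z y i)) < (\<Sum>i\<in>{1..n}. card (crossings x y i))"
      by (rule fewer) (use sub psub in auto)
    from less.hyps[OF this za less.prems(2) z0 less.prems(4)]
    have 2: "string_length \<X>\<^bsub>n\<^esub> (pt \<sigma> z) (pt \<sigma> y) (rdist n z y)" .
    show ?thesis
      using string_length_trans[OF 2 1] rdist_segment[OF t, of n x y] by (simp add: z_def)
  qed
qed

lemma rectifiably_connected_houghton: "rectifiably_connected \<X>\<^bsub>n\<^esub>"
  unfolding rectifiably_connected_def
proof (intro ballI)
  fix p q assume "p \<in> points \<X>\<^bsub>n\<^esub>" "q \<in> points \<X>\<^bsub>n\<^esub>"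
  then obtain \<sigma> x \<tau> y where p: "p = (\<sigma>, x)" "config n \<sigma> x" and q: "q = (\<tau>, y)" "config n \<tau> y"
    by (auto simp: points_eq)
  obtain M where M: "\<And>y. (\<And>i. i \<in> {1..n} \<Longrightarrow> M \<le> y i) \<Longrightarrow> (\<And>i. i \<notin> {1..n} \<Longrightarrow> y i = 0) \<Longrightarrow>
        (\<forall>i. x i \<le> y i) \<and> truncate \<sigma> y = truncate (ident n) y"
    using eventually_ident[OF p(2)] by metis
  obtain N where N: "\<And>z. (\<And>i. i \<in> {1..n} \<Longrightarrow> N \<le> z i) \<Longrightarrow> (\<And>i. i \<notin> {1..n} \<Longrightarrow> z i = 0) \<Longrightarrow>
        (\<forall>i. y i \<le> z i) \<and> truncate \<tau> z = truncate (ident n) z"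
    using eventually_ident[OF q(2)] by metis
  let ?z = "diag n (max M N)"
  have z: "M \<le> ?z i" "N \<le> ?z i" if "i \<in> {1..n}" for i using that by (simp_all add: diag_def)
  have z0: "?z i = 0" if "i \<notin> {1..n}" for i using that by (auto simp: diag_def)
  have m: "\<forall>i. x i \<le> ?z i" "truncate \<sigma> ?z = truncate (ident n) ?z"
    "\<forall>i. y i \<le> ?z i" "truncate \<tau> ?z = truncate (ident n) ?z"
    using M[of ?z, OF z(1) z0] N[of ?z, OF z(2) z0] by blast+
  have "string_length \<X>\<^bsub>n\<^esub> (pt \<sigma> x) (pt \<sigma> ?z) (rdist n x ?z)"
    using config_outside[OF p(2)] m z0 by (intro string_length_orthant[OF p(2)]) blast+
  moreover have "string_length \<X>\<^bsub>n\<^esub> (pt \<tau> y) (pt \<tau> ?z) (rdist n y ?z)"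
    using config_outside[OF q(2)] m z0 by (intro string_length_orthant[OF q(2)]) blast+
  moreover have "pt \<tau> ?z = pt \<sigma> ?z" using m by (simp add: pt_def)
  ultimately show "\<exists>l. string_length \<X>\<^bsub>n\<^esub> p q l"
    using string_length_trans[OF string_length_sym] p q pt_self by metis
qed

text \<open>A path from \<open>x\<close> of length less than the gap reaches no integral hyperplane, above or below \<open>x\<close>,
other than those that contain \<open>x\<close>.\<close>

definition gap :: "(nat \<Rightarrow> real) \<Rightarrow> real" where
  "gap x = Min (insert 1 ((\<lambda>i. of_int \<lfloor>x i\<rfloor> + 1 - x i) ` {1..n} \<union> (\<lambda>i. x i - (of_int \<lceil>x i\<rceil> - 1)) ` {1..n}))"

lemma gap_pos: "0 < gap x"
proof -
  have "0 < x i - (of_int \<lceil>x i\<rceil> - 1)" "0 < of_int \<lfloor>x i\<rfloor> + 1 - x i" for i by linarith+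
  then show ?thesis unfolding gap_def by (subst Min_gr_iff) auto
qed

lemma gap_le:
  shows "gap x \<le> 1"
    and "i \<in> {1..n} \<Longrightarrow> gap x \<le> of_int \<lfloor>x i\<rfloor> + 1 - x i"
    and "i \<in> {1..n} \<Longrightarrow> gap x \<le> x i - (of_int \<lceil>x i\<rceil> - 1)"
  unfolding gap_def by (rule Min_le; simp)+

text \<open>Near a point nothing but additional terms can appear: a point at distance less than the gap has
sequences that extend those of the given point, and its own \<open>n\<close>-dimensional cube contains both.\<close>

lemma string_less_gap:
  assumes "config n \<sigma> x" "string_length \<X>\<^bsub>n\<^esub> (\<sigma>, x) (\<tau>, y) l" "l < gap x"
  shows "truncate \<tau> x = \<sigma>" and "x \<in> corner_box (floors y) {1..n}"
proof -
  have \<tau>: "config n \<tau> y" using string_length_points[OF assms(2)] by (simp add: points_eq)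
  have xy: "\<bar>x i - y i\<bar> \<le> l" if "i \<in> {1..n}" for i
    using abs_diff_le_rdist[OF that, of x y] rdist_le_string_length[OF assms(2)] by simp
  show "truncate \<tau> x = \<sigma>"
  proof (rule entry_eqI)
    fix i j
    show "entry (truncate \<tau> x) i j = entry \<sigma> i j"
    proof (cases "i \<in> {1..n} \<and> x i < of_int j")
      case True
      then have "\<lfloor>x i\<rfloor> + 1 \<le> j" by linarith
      then have "of_int \<lfloor>x i\<rfloor> + 1 \<le> (of_int j :: real)" by linarith
      then have "x i + l < of_int j" using gap_le(2)[of i x] assms(3) True by linarith
      then show ?thesis using entry_eq_of_string[OF assms(2), of i j] True by simp
    next
      case False
      then show ?thesis
        using config_entry_blank[OF assms(1), of i j] config_entry_blank[OF \<tau>, of i j]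
          config_outside[OF assms(1)] config_outside[OF \<tau>] by auto
    qed
  qed
  have "of_int \<lfloor>y i\<rfloor> \<le> x i \<and> x i \<le> of_int \<lfloor>y i\<rfloor> + 1" if i: "i \<in> {1..n}" for i
  proof -
    have "y i < of_int (\<lfloor>x i\<rfloor> + 1)" "of_int (\<lceil>x i\<rceil> - 1) < y i"
      using xy[OF i] gap_le(2,3)[OF i, of x] assms(3) by linarith+
    then have "\<lfloor>y i\<rfloor> \<le> \<lfloor>x i\<rfloor>" "\<lceil>x i\<rceil> - 1 \<le> \<lfloor>y i\<rfloor>" by linarith+
    then show ?thesis by linarith
  qed
  then show "x \<in> corner_box (floors y) {1..n}"
    using config_outside[OF assms(1)] config_outside[OF \<tau>] by (auto simp: corner_box_def floors_def)
qed

lemma Metric_space_houghton: "Metric_space (points \<X>\<^bsub>n\<^esub>) (length_dist \<X>\<^bsub>n\<^esub>)"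
proof (rule Metric_space_length_dist[OF rectifiably_connected_houghton])
  fix p q assume "p \<in> points \<X>\<^bsub>n\<^esub>" "q \<in> points \<X>\<^bsub>n\<^esub>" and ne: "p \<noteq> q"
  then obtain \<sigma> x \<tau> y where p: "p = (\<sigma>, x)" "config n \<sigma> x" and q: "q = (\<tau>, y)" "config n \<tau> y"
    by (auto simp: points_eq)
  show "\<exists>b>0. \<forall>l. string_length \<X>\<^bsub>n\<^esub> p q l \<longrightarrow> b \<le> l"
  proof (cases "x = y")
    case True
    have "gap x \<le> l" if "string_length \<X>\<^bsub>n\<^esub> p q l" for l
    proof (rule ccontr)
      assume "\<not> gap x \<le> l"
      then have "truncate \<tau> x = \<sigma>" using that string_less_gap(1)[OF p(2)] p q by simp
      then show False using ne True p(1) q truncate_self by simp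
    qed
    then show ?thesis using gap_pos by blast
  next
    case False
    then obtain i where "x i \<noteq> y i" by blast
    then have "i \<in> {1..n}" "0 < \<bar>x i - y i\<bar>"
      using config_outside[OF p(2)] config_outside[OF q(2)] by force+
    then have "0 < rdist n x y" using abs_diff_le_rdist[of i n x y] by linarith
    then show ?thesis using rdist_le_string_length p q by fastforce
  qed
qed

lemma length_dist_ge_rdist:
  assumes "p \<in> points \<X>\<^bsub>n\<^esub>" "q \<in> points \<X>\<^bsub>n\<^esub>"
  shows "rdist n (snd p) (snd q) \<le> length_dist \<X>\<^bsub>n\<^esub> p q"
  using assms by (intro le_length_dist[OF rectifiably_connected_houghton] rdist_le_string_length)

lemma length_dist_orthant:
  assumes "config n \<sigma> a" "\<And>i. a i \<le> x i" "\<And>i. a i \<le> y i"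
    "\<And>i. i \<notin> {1..n} \<Longrightarrow> x i = 0" "\<And>i. i \<notin> {1..n} \<Longrightarrow> y i = 0"
  shows "length_dist \<X>\<^bsub>n\<^esub> (pt \<sigma> x) (pt \<sigma> y) \<le> rdist n x y"
  using length_dist_le[OF string_length_orthant[OF assms]] .

end

section \<open>The weak topology and the metric topology\<close>

lemma subtopology_Euclidean_space_ucube:
  "subtopology (Euclidean_space k) (ucube k) = top_of_set (ucube k)"
proof -
  have "{x. \<forall>i\<ge>k. x i = 0} \<inter> ucube k = ucube k" by (auto simp: ucube_def)
  then show ?thesis
    by (simp add: Euclidean_space_def subtopology_subtopology euclidean_product_topology)
qed

lemma openin_ucube_ball:
  "openin (top_of_set (ucube k)) {w \<in> ucube k. L2_set (\<lambda>i. u i - w i) {..<k} < e}"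
proof -
  have "open {w :: nat \<Rightarrow> real. L2_set (\<lambda>i. u i - w i) {..<k} < e}"
    unfolding L2_set_def
    by (intro open_Collect_less continuous_intros continuous_on_product_coordinates)
  then have "openin (top_of_set (ucube k)) (ucube k \<inter> {w. L2_set (\<lambda>i. u i - w i) {..<k} < e})"
    by (rule openin_open_Int)
  then show ?thesis by (simp add: Int_def)
qed

text \<open>The topology of a cube is a product topology; a basic neighbourhood restricts finitely many
coordinates, and those beyond the dimension are constant on the cube.\<close>

lemma openin_ucube_imp_ball:
  assumes "openin (top_of_set (ucube k)) V" "u \<in> V"
  shows "\<exists>r>0. \<forall>w\<in>ucube k. L2_set (\<lambda>i. u i - w i) {..<k} < r \<longrightarrow> w \<in> V"
proof -
  obtain W where W: "open W" "V = ucube k \<inter> W" using assms(1) by (auto simp: openin_open)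
  have "openin (product_topology (\<lambda>_. euclidean) UNIV) W"
    using W(1) by (simp add: euclidean_product_topology)
  from product_topology_open_contains_basis[OF this, of u]
  obtain B where B: "\<And>i. u i \<in> B i" "\<And>i. open (B i)" "Pi\<^sub>E UNIV B \<subseteq> W"
    using assms(2) W(2) by (auto simp: PiE_iff)
  have "\<exists>r>0. ball (u i) r \<subseteq> B i" for i using B(1,2) open_contains_ball by blast
  then obtain r where r: "\<And>i. r i > 0" "\<And>i. ball (u i) (r i) \<subseteq> B i" by metis
  define e where "e = Min (insert 1 (r ` {..<k}))"
  have e: "e > 0" "\<And>i. i < k \<Longrightarrow> e \<le> r i"
    using r(1) by (auto simp: e_def)
  have "w \<in> V" if w: "w \<in> ucube k" "L2_set (\<lambda>i. u i - w i) {..<k} < e" for w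
  proof -
    have "w i \<in> B i" for i
    proof (cases "i < k")
      case True
      have "\<bar>u i - w i\<bar> \<le> L2_set (\<lambda>i. u i - w i) {..<k}"
        using member_le_L2_set[of "{..<k}" i "\<lambda>i. \<bar>u i - w i\<bar>"] True by (simp add: L2_set_def)
      then have "w i \<in> ball (u i) (r i)" using w(2) e(2)[OF True] by (simp add: dist_real_def)
      then show ?thesis using r(2) by blast
    next
      case False
      then have "w i = u i" using w(1) assms(2) W(2) by (auto simp: ucube_def)
      then show ?thesis using B(1) by simp
    qed
    then show ?thesis using B(3) W(2) w(1) by (auto simp: PiE_iff)
  qed
  with e(1) show ?thesis by blast
qed

lemma compactin_ucube: "compactin (top_of_set (ucube k)) (ucube k)"
proof -
  have "compactin (product_topology (\<lambda>_. euclidean) UNIV) (\<Pi>\<^sub>E i\<in>UNIV. if i < k then {0..1::real} else {0})"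
    by (subst compactin_PiE) auto
  moreover have "(\<Pi>\<^sub>E i\<in>UNIV. if i < k then {0..1::real} else {0}) = ucube k"
    by (auto simp: ucube_def PiE_iff split: if_splits)
  ultimately show ?thesis by (simp add: compactin_subtopology euclidean_product_topology)
qed

lemma continuous_char_map:
  assumes "Metric_space (points X) (length_dist X)" "c \<in> cells X"
  shows "continuous_map (top_of_set (ucube (cell_dim X c))) (metric_topology X) (char_map X c)"
proof -
  interpret Metric_space "points X" "length_dist X" by fact
  have in_points: "char_map X c u \<in> points X" if "u \<in> ucube (cell_dim X c)" for u
    using that assms(2) by (auto simp: points_def closed_cell_def)
  show ?thesis
    unfolding continuous_map_to_metric
  proof (intro ballI allI impI)
    fix u :: "nat \<Rightarrow> real" and e :: real
    assume u: "u \<in> topspace (top_of_set (ucube (cell_dim X c)))" and e: "e > 0"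
    let ?U = "{w \<in> ucube (cell_dim X c). L2_set (\<lambda>i. u i - w i) {..<cell_dim X c} < e}"
    have "char_map X c w \<in> mball (char_map X c u) e" if "w \<in> ?U" for w
      using length_dist_le[OF string_length_single[OF assms(2), of u w]] that u in_points by auto
    moreover have "u \<in> ?U" using u e by (simp add: L2_set_def)
    ultimately show "\<exists>U. openin (top_of_set (ucube (cell_dim X c))) U \<and> u \<in> U \<and>
        (\<forall>y\<in>U. char_map X c y \<in> mball (char_map X c u) e)"
      using openin_ucube_ball by blast
  qed
qed

lemma compactin_closed_cell:
  assumes "Metric_space (points X) (length_dist X)" "c \<in> cells X"
  shows "compactin (metric_topology X) (closed_cell X c)"
  unfolding closed_cell_def by (rule image_compactin[OF compactin_ucube continuous_char_map[OF assms]])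

text \<open>The cell \<open>c\<close> contains \<open>p\<close> and \<open>q\<close>, and no string between them is shorter than the segment in \<open>c\<close>.\<close>

definition realizes_dist :: "('c, 'p) cell_structure \<Rightarrow> 'c \<Rightarrow> 'p \<Rightarrow> 'p \<Rightarrow> bool" where
  "realizes_dist X c p q \<longleftrightarrow>
     (\<exists>u\<in>ucube (cell_dim X c). \<exists>w\<in>ucube (cell_dim X c). char_map X c u = p \<and> char_map X c w = q \<and>
        L2_set (\<lambda>i. u i - w i) {..<cell_dim X c} \<le> length_dist X p q)"

text \<open>Local finiteness in metric form: near \<open>p\<close> all distances from \<open>p\<close> are measured in finitely many
cells. A weakly open set contains a ball about \<open>p\<close> in each of these cells, and the least of the
finitely many radii serves for the whole space.\<close>

lemma weak_topology_eq_metric_topology: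
  assumes M: "Metric_space (points X) (length_dist X)"
    and star: "\<And>p. p \<in> points X \<Longrightarrow> \<exists>e>0. \<exists>C. finite C \<and> C \<subseteq> cells X \<and>
      (\<forall>q\<in>points X. length_dist X p q < e \<longrightarrow> (\<exists>c\<in>C. realizes_dist X c p q))"
    and inj: "\<And>c. c \<in> cells X \<Longrightarrow> inj_on (char_map X c) (ucube (cell_dim X c))"
  shows "weak_topology X = metric_topology X"
proof (rule topology_eq[THEN iffD2], intro allI iffI)
  interpret Metric_space "points X" "length_dist X" by (rule M)
  fix U
  {
    assume U: "openin (metric_topology X) U"
    show "openin (weak_topology X) U"
      unfolding openin_weak_topology subtopology_Euclidean_space_ucube
    proof (intro conjI ballI)
      show "U \<subseteq> points X" using openin_subset[OF U] by simp
      show "openin (top_of_set (ucube (cell_dim X c))) {u \<in> ucube (cell_dim X c). char_map X c u \<in> U}"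
        if "c \<in> cells X" for c
        using openin_continuous_map_preimage[OF continuous_char_map[OF M that] U] by simp
    qed
  next
    assume "openin (weak_topology X) U"
    then have U: "U \<subseteq> points X"
      and Uc: "\<And>c. c \<in> cells X \<Longrightarrow>
        openin (top_of_set (ucube (cell_dim X c))) {u \<in> ucube (cell_dim X c). char_map X c u \<in> U}"
      by (simp_all add: openin_weak_topology subtopology_Euclidean_space_ucube)
    show "openin (metric_topology X) U"
      unfolding openin_mtopology
    proof (intro conjI allI impI)
      fix p assume p: "p \<in> U"
      then have pX: "p \<in> points X" using U by blast
      from star[OF pX] obtain e C where e: "e > 0" and C: "finite C" "C \<subseteq> cells X"
        and near: "\<And>q. q \<in> points X \<Longrightarrow> length_dist X p q < e \<Longrightarrow> \<exists>c\<in>C. realizes_dist X c p q"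
        by blast
      define good where "good c r \<longleftrightarrow> (\<forall>u\<in>ucube (cell_dim X c). char_map X c u = p \<longrightarrow>
          (\<forall>w\<in>ucube (cell_dim X c).
             L2_set (\<lambda>i. u i - w i) {..<cell_dim X c} < r \<longrightarrow> char_map X c w \<in> U))" for c r
      have "\<exists>r>0. good c r" if "c \<in> C" for c
      proof (cases "\<exists>u\<in>ucube (cell_dim X c). char_map X c u = p")
        case True
        then obtain u where u: "u \<in> ucube (cell_dim X c)" "char_map X c u = p" by blast
        have c: "c \<in> cells X" using that C(2) by blast
        obtain r where r: "r > 0" "\<And>w. w \<in> ucube (cell_dim X c) \<Longrightarrow>
            L2_set (\<lambda>i. u i - w i) {..<cell_dim X c} < r \<Longrightarrow> char_map X c w \<in> U"
          using openin_ucube_imp_ball[OF Uc[OF c], of u] u p by auto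
        have "v = u" if "v \<in> ucube (cell_dim X c)" "char_map X c v = p" for v
          using inj_onD[OF inj[OF c]] that u by blast
        then have "good c r" using r(2) by (simp add: good_def)
        with r(1) show ?thesis by blast
      next
        case False
        then show ?thesis by (intro exI[of _ 1]) (auto simp: good_def)
      qed
      then obtain r where r: "\<And>c. c \<in> C \<Longrightarrow> r c > 0"
"\<And>c. c \<in> C \<Longrightarrow> good c (r c)"
        by metis
      define s where "s = Min (insert e (r ` C))"
      have s: "s > 0" "s \<le> e" "\<And>c. c \<in> C \<Longrightarrow> s \<le> r c"
        using C(1) r(1) e by (auto simp: s_def)
      have "mball p s \<subseteq> U"
      proof
        fix q assume "q \<in> mball p s"
        then have q: "q \<in> points X" "length_dist X p q < s" by auto
        then obtain c u w where "c \<in> C" "u \<in> ucube (cell_dim X c)" "w \<in> ucube (cell_dim X c)"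
          "char_map X c u = p" "char_map X c w = q"
          "L2_set (\<lambda>i. u i - w i) {..<cell_dim X c} \<le> length_dist X p q"
          using near[of q] s(2) by (auto simp: realizes_dist_def)
        with r(2)[of c] s(3)[of c] q(2) show "q \<in> U" by (auto simp: good_def)
      qed
      with s(1) show "\<exists>r>0. mball p r \<subseteq> U" by blast
    qed (rule U)
  }
qed

text \<open>A contraction of the space carries every loop through loops to the constant one, which is all
that a homotopy of loops without a base point asks for.\<close>

lemma contractible_imp_simply_connected_space:
  assumes "contractible_space T"
  shows "simply_connected_space T"
proof -
  obtain c where c: "homotopic_with (\<lambda>x. True) T T id (\<lambda>x. c)"
    using assms by (auto simp: contractible_space_def)
  have loop: "homotopic_with (\<lambda>r. r 1 = r 0) (top_of_set {0..1}) T p (\<lambda>_. c)"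
    if "pathin T p" "p 1 = p 0" for p :: "real \<Rightarrow> 'a"
  proof -
    have "homotopic_with (\<lambda>r. r 1 = r 0) (top_of_set {0..1}) T (id \<circ> p) ((\<lambda>_. c) \<circ> p)"
      using that by (intro homotopic_with_compose_continuous_map_right[OF c]) (auto simp: pathin_def)
    then show ?thesis by (simp add: o_def)
  qed
  show ?thesis
    unfolding simply_connected_space_def
  proof (intro allI impI, elim conjE)
    fix p q assume "pathin T p" "p 1 = p 0" "pathin T q" "q 1 = q 0"
    then show "homotopic_with (\<lambda>r. r 1 = r 0) (top_of_set {0..1}) T p q"
      by (intro homotopic_with_trans[OF loop homotopic_with_symD[OF loop]])
  qed
qed

text \<open>The two homotopies that contract the complex move each point at a bounded speed and increase no
distance between points at a fixed time.\<close>

lemma (in Metric_space) continuous_map_family: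
  assumes S: "S \<subseteq> M" and H: "\<And>s p. s \<in> I \<Longrightarrow> p \<in> S \<Longrightarrow> H (s, p) \<in> M"
    and bound: "\<And>s t p q. s \<in> I \<Longrightarrow> t \<in> I \<Longrightarrow> p \<in> S \<Longrightarrow> q \<in> S \<Longrightarrow>
                  d (H (s, p)) (H (t, q)) \<le> d p q + K p * \<bar>s - t :: real\<bar>"
    and K: "\<And>p. p \<in> S \<Longrightarrow> 0 \<le> K p"
  shows "continuous_map (prod_topology (top_of_set I) (subtopology mtopology S)) mtopology H"
  unfolding continuous_map_to_metric
proof (intro ballI allI impI)
  fix z and e :: real assume z: "z \<in> topspace (prod_topology (top_of_set I) (subtopology mtopology S))"
    and e: "e > 0"
  obtain s p where zsp: "z = (s, p)" "s \<in> I" "p \<in> S" using z by auto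
  define r where "r = e / (2 * (K p + 1))"
  have r: "r > 0" using K[OF zsp(3)] e by (simp add: r_def)
  have Kr: "K p * r \<le> e / 2" using K[OF zsp(3)] e by (simp add: r_def field_simps)
  let ?U = "(I \<inter> ball s r) \<times> (S \<inter> mball p (e / 2))"
  have "openin (prod_topology (top_of_set I) (subtopology mtopology S)) ?U"
    by (subst openin_prod_Times_iff) (auto simp: openin_open_Int openin_subtopology_Int2)
  moreover have "z \<in> ?U" using zsp S r e by auto
  moreover have "H y \<in> mball (H z) e" if y: "y \<in> ?U" for y
  proof -
    obtain t q where y: "y = (t, q)" "t \<in> I" "\<bar>s - t\<bar> < r" "q \<in> S" "d p q < e / 2"
      using y by (auto simp: dist_real_def)
    have "d (H z) (H y) \<le> d p q + K p * \<bar>s - t\<bar>" using bound y zsp by simp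
    moreover have "K p * \<bar>s - t\<bar> \<le> K p * r" using y K[OF zsp(3)] by (intro mult_left_mono) auto
    ultimately show ?thesis using H zsp y Kr by simp
  qed
  ultimately show "\<exists>U. openin (prod_topology (top_of_set I) (subtopology mtopology S)) U \<and> z \<in> U \<and>
      (\<forall>y\<in>U. H y \<in> mball (H z) e)" by blast
qed

lemma (in Metric_space) continuous_map_dist_from:
  assumes "c \<in> M"
  shows "continuous_map mtopology euclidean (d c)"
proof -
  have "continuous_map mtopology Met_TC.mtopology (d c)"
    unfolding metric_continuous_map[OF Met_TC.Metric_space_axioms]
  proof (intro conjI ballI allI impI)
    fix a and e :: real assume a: "a \<in> M" and e: "e > 0"
    have "dist (d c a) (d c x) < e" if "x \<in> M" "d a x < e" for x
      using triangle[OF assms a that(1)] triangle[OF assms that(1) a] commute[of a x] that(2)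
      by (simp add: dist_real_def)
    then show "\<exists>r>0. \<forall>x. x \<in> M \<and> d a x < r \<longrightarrow> dist (d c a) (d c x) < e" using e by blast
  qed simp
  then show ?thesis by simp
qed

section \<open>Missed values\<close>

definition missing :: "nat \<Rightarrow> (nat \<times> nat \<Rightarrow> nat \<times> nat) \<Rightarrow> (nat \<times> nat) set" where
  "missing n \<sigma> = rays n - {entry \<sigma> i j | i j. True}"

text \<open>Let all sequences be standard beyond \<open>N\<close>. The terms of index at most \<open>N\<close> fill all but the missed
places among the first \<open>N\<close> places of the rays, and there are \<open>N - a\<^sub>i\<close> such terms for ray \<open>i\<close>.\<close>

lemma card_missing:
  assumes "corner n \<sigma> a"
  shows "finite (missing n \<sigma>)" and "real (card (missing n \<sigma>)) = (\<Sum>i\<in>{1..n}. a i)"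
proof -
  have cfg: "config n \<sigma> a" using assms by (simp add: corner_def)
  obtain N :: nat where N: "\<And>i j. i \<in> {1..n} \<Longrightarrow> j > int N \<Longrightarrow> entry \<sigma> i j = (i, nat j)"
    using config_tail[OF cfg] by blast
  define k where "k i = \<lfloor>a i\<rfloor>" for i
  have ak: "a i = of_int (k i)" for i
    using assms floors_Ints[of a i] by (simp add: corner_def floors_def k_def)
  have in_rays: "entry \<sigma> i j \<in> rays n \<longleftrightarrow> i \<in> {1..n} \<and> k i < j" for i j
    using config_entry_iff[OF cfg, of i j] by (simp add: ak)
  have kN: "k i \<le> int N" if "i \<in> {1..n}" for i
    using in_rays[of i "int N + 1"] N[OF that, of "int N + 1"] that by (auto simp: rays_def)
  let ?A = "Sigma {1..n} (\<lambda>i. {k i + 1..int N})" and ?B = "{1..n} \<times> {1..N}"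
    and ?e = "\<lambda>(i, j). entry \<sigma> i j"
  have inj: "inj_on ?e ?A"
    using config_inj[OF cfg] in_rays by (fastforce intro!: inj_onI)
  have sub: "?e ` ?A \<subseteq> ?B"
  proof (rule image_subsetI)
    fix z assume z: "z \<in> ?A"
    obtain i j i' p where zij: "z = (i, j)" and e: "entry \<sigma> i j = (i', p)" by (metis surj_pair)
    have ij: "i \<in> {1..n}" "j \<in> {k i + 1..int N}" using z zij by auto
    have r: "entry \<sigma> i j \<in> rays n" using ij by (simp add: in_rays)
    then have ip: "i' \<in> {1..n}" "p \<ge> 1" using e by (simp_all add: rays_def)
    have "p \<le> N"
    proof (rule ccontr)
      assume "\<not> p \<le> N"
      then have "entry \<sigma> i' (int p) = (i', p)" using N[OF ip(1), of "int p"] by simp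
      then have "j = int p" using config_inj[OF cfg, of i j i' "int p"] r e by simp
      with ij \<open>\<not> p \<le> N\<close> show False by simp
    qed
    with ip e zij show "?e z \<in> ?B" by simp
  qed
  have eq: "missing n \<sigma> = ?B - ?e ` ?A"
  proof (intro Set.set_eqI iffI)
    fix q assume q: "q \<in> missing n \<sigma>"
    obtain i p where ip: "q = (i, p)" by (cases q)
    have i: "i \<in> {1..n}" "p \<ge> 1" using q by (auto simp: missing_def ip rays_def)
    have "p \<le> N"
    proof (rule ccontr)
      assume "\<not> p \<le> N"
      then have "entry \<sigma> i (int p) = q" using N[OF i(1), of "int p"] ip by simp
      with q show False by (auto simp: missing_def)
    qed
    with q i ip show "q \<in> ?B - ?e ` ?A" by (auto simp: missing_def)
  next
    fix q assume q: "q \<in> ?B - ?e ` ?A"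
    have "q \<in> rays n" using q by (auto simp: rays_def)
    moreover have "q \<noteq> entry \<sigma> i j" for i j
    proof
      assume e: "q = entry \<sigma> i j"
      then have ij: "i \<in> {1..n}" "k i < j" using \<open>q \<in> rays n\<close> in_rays by auto
      show False
      proof (cases "j \<le> int N")
        case True
        then have "(i, j) \<in> ?A" using ij by simp
        then show False using q e by force
      next
        case False
        then show False using N[OF ij(1), of j] q e by auto
      qed
    qed
    ultimately show "q \<in> missing n \<sigma>" by (auto simp: missing_def)
  qed
  show "finite (missing n \<sigma>)" unfolding eq by auto
  have fA: "finite ?A" by auto
  have "card (missing n \<sigma>) = card ?B - card ?A"
    unfolding eq using sub inj fA by (simp add: card_Diff_subset card_image)
  moreover have "card ?A \<le> card ?B" using card_mono[OF _ sub] inj by (simp add: card_image)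
  ultimately have "real (card (missing n \<sigma>)) = real (card ?B) - real (card ?A)"
    by (simp add: of_nat_diff)
  also have "real (card ?A) = (\<Sum>i\<in>{1..n}. of_int (int N - k i))"
    using kN by (simp add: card_SigmaI)
  also have "\<dots> = real n * real N - (\<Sum>i\<in>{1..n}. a i)"
    by (simp add: ak sum_subtractf)
  finally show "real (card (missing n \<sigma>)) = (\<Sum>i\<in>{1..n}. a i)" by simp
qed

lemma finite_missing: "config n \<sigma> x \<Longrightarrow> finite (missing n \<sigma>)"
  using card_missing(1)[OF corner_floors] .

text \<open>Local finiteness: a cube that contains the point \<open>(\<sigma>, x)\<close> adds at most one term to each sequence,
in the place just before the first one, and this term is a missed value of \<open>\<sigma>\<close>.\<close>

lemma finite_extensions:
  assumes "config n \<sigma> x"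
  shows "finite {\<tau>. \<exists>a. corner n \<tau> a \<and> x \<in> corner_box a {1..n} \<and> truncate \<tau> x = \<sigma>}" (is "finite ?E")
proof -
  let ?F = "\<Pi>\<^sub>E i\<in>{1..n}. insert (0, 0) (missing n \<sigma>)"
  let ?g = "\<lambda>f. of_entries (\<lambda>i j. if i \<in> {1..n} \<and> j = \<lfloor>x i\<rfloor> then f i else entry \<sigma> i j)"
  have "?E \<subseteq> ?g ` ?F"
  proof
    fix \<tau> assume "\<tau> \<in> ?E"
    then obtain a where a: "corner n \<tau> a" "x \<in> corner_box a {1..n}" "truncate \<tau> x = \<sigma>" by blast
    have cfg: "config n \<tau> a" using a(1) by (simp add: corner_def)
    have ent: "entry \<sigma> i j = (if x i < of_int j then entry \<tau> i j else (0, 0))" for i j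
      using entry_truncate[of \<tau> x i j] a(3) by simp
    let ?f = "\<lambda>i\<in>{1..n}. entry \<tau> i \<lfloor>x i\<rfloor>"
    have "entry \<tau> i \<lfloor>x i\<rfloor> \<in> insert (0, 0) (missing n \<sigma>)" for i
    proof (cases "entry \<tau> i \<lfloor>x i\<rfloor> \<in> rays n")
      case True
      have "entry \<tau> i \<lfloor>x i\<rfloor> \<noteq> entry \<sigma> i' j" for i' j
      proof
        assume e: "entry \<tau> i \<lfloor>x i\<rfloor> = entry \<sigma> i' j"
        then have x: "x i' < of_int j" "entry \<tau> i \<lfloor>x i\<rfloor> = entry \<tau> i' j"
          using ent[of i' j] True by (auto split: if_splits)
        then have "i = i'" "j = \<lfloor>x i\<rfloor>" using config_inj[OF cfg x(2) True] by auto
        then have "x i < of_int \<lfloor>x i\<rfloor>" using x(1) by simp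
        then show False by linarith
      qed
      with True show ?thesis by (auto simp: missing_def)
    next
      case False
      then show ?thesis
        using cfg config_entry_iff[OF cfg] config_entry_blank[OF cfg] by (metis insertI1)
    qed
    then have "?f \<in> ?F" by simp
    moreover have "\<tau> = ?g ?f"
    proof (rule entry_eqI)
      fix i j
      show "entry \<tau> i j = entry (?g ?f) i j"
      proof (cases "i \<in> {1..n} \<and> j < \<lfloor>x i\<rfloor>")
        case True
        then have "of_int (j + 1) \<le> x i" by linarith
        moreover have "x i \<le> a i + 1" using a(2) True by (simp add: corner_box_def)
        ultimately have "\<not> a i < of_int j" by simp
        then show ?thesis
          using True config_entry_blank[OF cfg, of i j] config_entry_blank[OF assms, of i j] ent[of i j]
          by (simp add: floor_le_iff not_less)
      next
        case False
        then have "i \<notin> {1..n} \<or> j = \<lfloor>x i\<rfloor> \<or> x i < of_int j" by linarith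
        then show ?thesis
          using ent[of i j] config_entry_blank[OF cfg, of i j] config_entry_blank[OF assms, of i j] by auto
      qed
    qed
    ultimately show "\<tau> \<in> ?g ` ?F" by blast
  qed
  moreover have "finite ?F" using finite_missing[OF assms] by (intro finite_PiE) auto
  ultimately show ?thesis by (meson finite_imageI finite_subset)
qed

section \<open>Local finiteness and contractibility\<close>

definition raise :: "nat \<Rightarrow> real \<Rightarrow> cell_point \<Rightarrow> cell_point" where
  "raise n s p = pt (fst p) (\<lambda>i. snd p i + diag n s i)"

definition stretch :: "nat \<Rightarrow> real \<Rightarrow> cell_point \<Rightarrow> cell_point" where
  "stretch n c p = pt (ident n) (\<lambda>i. c * snd p i)"

definition ident_orthant :: "nat \<Rightarrow> cell_point set" where
  "ident_orthant n = pt (ident n) ` {x. (\<forall>i. 0 \<le> x i) \<and> (\<forall>i. i \<notin> {1..n} \<longrightarrow> x i = 0)}"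

context
  fixes n :: nat
begin

lemma weak_topology_eq_metric_topology_houghton: "weak_topology \<X>\<^bsub>n\<^esub> = metric_topology \<X>\<^bsub>n\<^esub>"
proof (rule weak_topology_eq_metric_topology[OF Metric_space_houghton])
  show "inj_on (char_map \<X>\<^bsub>n\<^esub> c) (ucube (cell_dim \<X>\<^bsub>n\<^esub> c))" if "c \<in> cells \<X>\<^bsub>n\<^esub>" for c
    using cubical_complex_houghton that unfolding cubical_complex_def by blast
  fix p assume "p \<in> points \<X>\<^bsub>n\<^esub>"
  then obtain \<sigma> x where p: "p = (\<sigma>, x)" "config n \<sigma> x" by (auto simp: points_eq)
  let ?E = "{\<tau>. \<exists>a. corner n \<tau> a \<and> x \<in> corner_box a {1..n} \<and> truncate \<tau> x = \<sigma>}"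
  let ?C = "(\<lambda>\<tau>. (\<tau>, {1..n})) ` ?E"
  have near: "\<exists>c\<in>?C. realizes_dist \<X>\<^bsub>n\<^esub> c p q"
    if q: "q \<in> points \<X>\<^bsub>n\<^esub>" "length_dist \<X>\<^bsub>n\<^esub> p q < gap n x" for q
  proof -
    obtain \<tau> y where qt: "q = (\<tau>, y)" "config n \<tau> y" using q(1) by (auto simp: points_eq)
    obtain l where l: "string_length \<X>\<^bsub>n\<^esub> p q l" "l < gap n x"
      using length_dist_less_imp[OF rectifiably_connected_houghton \<open>p \<in> points \<X>\<^bsub>n\<^esub>\<close> q] by blast
    have s: "truncate \<tau> x = \<sigma>" "x \<in> corner_box (floors y) {1..n}"
      using string_less_gap[OF p(2), of \<tau> y l] l p qt by auto
    have cor: "corner n \<tau> (floors y)" using corner_floors[OF qt(2)] .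
    have yb: "y \<in> corner_box (floors y) {1..n}"
      using config_outside[OF qt(2)] by (rule mem_box_floors)
    obtain u where u: "u \<in> ucube n" "x = (\<lambda>i. floors y i + spread {1..n} u i)"
      using s(2) spread_ucube[of "{1..n}" "floors y"] by auto
    obtain w where w: "w \<in> ucube n" "y = (\<lambda>i. floors y i + spread {1..n} w i)"
      using yb spread_ucube[of "{1..n}" "floors y"] by auto
    have "char_map \<X>\<^bsub>n\<^esub> (\<tau>, {1..n}) u = p"
      unfolding char_map_eq base_eq[OF cor] u(2)[symmetric] using s(1) p(1) by (simp add: pt_def)
    moreover have "char_map \<X>\<^bsub>n\<^esub> (\<tau>, {1..n}) w = q"
      unfolding char_map_eq base_eq[OF cor] w(2)[symmetric] using pt_self[OF qt(2)] qt(1) by simp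
    moreover have "L2_set (\<lambda>i. u i - w i) {..<card {1..n}} = rdist n x y"
      using L2_spread[of "{1..n}" n u w "floors y"] u(2) w(2) by simp
    then have "L2_set (\<lambda>i. u i - w i) {..<cell_dim \<X>\<^bsub>n\<^esub> (\<tau>, {1..n})} \<le> length_dist \<X>\<^bsub>n\<^esub> p q"
      using length_dist_ge_rdist[OF \<open>p \<in> points \<X>\<^bsub>n\<^esub>\<close> q(1)] p(1) qt(1) by simp
    moreover have "(\<tau>, {1..n}) \<in> ?C" using s cor by blast
    ultimately show ?thesis
      unfolding realizes_dist_def using u(1) w(1)
      by (intro bexI[of _ "(\<tau>, {1..n})"] bexI[of _ u] bexI[of _ w]) auto
  qed
  show "\<exists>e>0. \<exists>C. finite C \<and> C \<subseteq> cells \<X>\<^bsub>n\<^esub> \<and>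
      (\<forall>q\<in>points \<X>\<^bsub>n\<^esub>. length_dist \<X>\<^bsub>n\<^esub> p q < e \<longrightarrow> (\<exists>c\<in>C. realizes_dist \<X>\<^bsub>n\<^esub> c p q))"
  proof (intro exI conjI)
    show "finite ?C" using finite_extensions[OF p(2)] by (rule finite_imageI)
    show "?C \<subseteq> cells \<X>\<^bsub>n\<^esub>" by (auto simp: in_cells_iff)
  qed (use gap_pos near in blast)+
qed

lemma snd_raise [simp]: "snd (raise n s p) = (\<lambda>i. snd p i + diag n s i)"
  by (simp add: raise_def pt_def)

lemma raise_pt:
  assumes "s \<ge> 0"
  shows "raise n s (pt \<sigma> x) = pt \<sigma> (\<lambda>i. x i + diag n s i)"
  using assms by (simp add: raise_def pt_def truncate_truncate diag_def)

lemma raise_points: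
  assumes "p \<in> points \<X>\<^bsub>n\<^esub>" "s \<ge> 0"
  shows "raise n s p \<in> points \<X>\<^bsub>n\<^esub>"
proof -
  have p: "config n (fst p) (snd p)" using assms(1) by (auto simp: points_eq)
  have "config n (truncate (fst p) (snd (raise n s p))) (snd (raise n s p))"
    using assms(2) config_outside[OF p] by (intro config_truncate[OF p]) (auto simp: diag_def)
  then show ?thesis by (simp add: raise_def pt_def points_eq)
qed

text \<open>Raising maps a segment in a cube to a parallel segment in the orthant above the bottom corner of
that cube, so it does not lengthen strings.\<close>

lemma length_dist_raise_le:
  assumes "s \<ge> 0" "p \<in> points \<X>\<^bsub>n\<^esub>" "q \<in> points \<X>\<^bsub>n\<^esub>"
  shows "length_dist \<X>\<^bsub>n\<^esub> (raise n s p) (raise n s q) \<le> length_dist \<X>\<^bsub>n\<^esub> p q"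
proof (rule length_dist_mono[OF rectifiably_connected_houghton assms(2,3)])
  fix l assume "string_length \<X>\<^bsub>n\<^esub> p q l"
  then show "string_length \<X>\<^bsub>n\<^esub> (raise n s p) (raise n s q) l"
  proof (induction rule: string_length_houghton_induct)
    case refl
    then show ?case by (intro string_length.refl raise_points assms)
  next
    case (step \<sigma> a x y l)
    have "config n \<sigma> a" using step.hyps(1) by (simp add: corner_def)
    have "a i \<le> z i + diag n s i" if "z \<in> corner_box a {1..n}" for z i
    proof -
      have "a i \<le> z i" using that by (cases "i \<in> {1..n}") (simp_all add: corner_box_def)
      moreover have "0 \<le> diag n s i" using assms(1) by (simp add: diag_def)
      ultimately show ?thesis by simp
    qed
    moreover have "z i + diag n s i = 0" if "z \<in> corner_box a {1..n}" "i \<notin> {1..n}" for z i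
      using that config_outside[OF \<open>config n \<sigma> a\<close>, of i] by (auto simp: corner_box_def diag_def)
    ultimately have "string_length \<X>\<^bsub>n\<^esub> (pt \<sigma> (\<lambda>i. x i + diag n s i)) (pt \<sigma> (\<lambda>i. y i + diag n s i)) (rdist n x y)"
      using string_length_orthant[OF \<open>config n \<sigma> a\<close>, of "\<lambda>i. x i + diag n s i" "\<lambda>i. y i + diag n s i"]
        step.hyps(2,3) by (simp add: rdist_translate)
    from string_length_trans[OF this] step.IH show ?case by (simp add: raise_pt assms(1))
  qed
qed

lemma length_dist_raise_raise:
  assumes "s \<ge> 0" "t \<ge> 0" "p \<in> points \<X>\<^bsub>n\<^esub>"
  shows "length_dist \<X>\<^bsub>n\<^esub> (raise n s p) (raise n t p) \<le> rdist n (diag n 1) (\<lambda>_. 0) * \<bar>s - t\<bar>"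
proof -
  have p: "config n (fst p) (snd p)" using assms(3) by (auto simp: points_eq)
  have "length_dist \<X>\<^bsub>n\<^esub> (raise n s p) (raise n t p)
      \<le> rdist n (\<lambda>i. snd p i + diag n s i) (\<lambda>i. snd p i + diag n t i)"
    unfolding raise_def using assms config_outside[OF p]
    by (intro length_dist_orthant[OF p]) (auto simp: diag_def)
  also have "\<dots> = \<bar>s - t\<bar> * rdist n (diag n 1) (\<lambda>_. 0)"
    by (rule rdist_scale) (auto simp: diag_def)
  finally show ?thesis by (simp add: mult.commute)
qed

lemma origin_points: "pt (ident n) (\<lambda>_. 0) \<in> points \<X>\<^bsub>n\<^esub>"
  using corner_ident[of n] pt_self[of n "ident n" "\<lambda>_. 0"] by (simp add: points_eq corner_def)

lemma ident_orthant_points: "ident_orthant n \<subseteq> points \<X>\<^bsub>n\<^esub>"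
  using corner_ident[of n] config_truncate[of n "ident n" "\<lambda>_. 0"]
  by (auto simp: ident_orthant_def points_eq pt_def corner_def)

text \<open>Let \<open>D\<close> be the distance from the origin. All terms of index greater than \<open>D\<close> agree with those of
the identity, and the coordinates are at least \<open>- D\<close>. Hence raising by \<open>2 * D\<close> deletes every term
that is not standard and makes the coordinates at least \<open>D\<close>.\<close>

lemma raise_into_ident_orthant:
  assumes p: "p \<in> points \<X>\<^bsub>n\<^esub>"
  defines "D \<equiv> length_dist \<X>\<^bsub>n\<^esub> (pt (ident n) (\<lambda>_. 0)) p"
  shows "raise n (2 * D) p \<in> ident_orthant n"
proof -
  let ?y = "\<lambda>i. snd p i + diag n (2 * D) i"
  have cfg: "config n (fst p) (snd p)" using p by (auto simp: points_eq)
  have cfg0: "config n (ident n) (\<lambda>_. 0)" using corner_ident[of n] by (simp add: corner_def)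
  have "rdist n (\<lambda>_. 0) (snd p) \<le> D"
    using length_dist_ge_rdist[OF origin_points p] by (simp add: D_def pt_def)
  then have abs: "\<bar>snd p i\<bar> \<le> D" if "i \<in> {1..n}" for i
    using abs_diff_le_rdist[OF that, of "\<lambda>_. 0" "snd p"] by simp
  have yD: "D \<le> ?y i" if "i \<in> {1..n}" for i using abs[OF that] that by (simp add: diag_def)
  have y0: "?y i = 0" if "i \<notin> {1..n}" for i
    using that config_outside[OF cfg that] by (auto simp: diag_def)
  have D0: "0 \<le> D"
    unfolding D_def by (rule Metric_space.nonneg[OF Metric_space_houghton])
  have "truncate (fst p) ?y = truncate (ident n) ?y"
  proof (rule entry_eqI)
    fix i j
    show "entry (truncate (fst p) ?y) i j = entry (truncate (ident n) ?y) i j"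
    proof (cases "i \<in> {1..n} \<and> ?y i < of_int j")
      case True
      then have "D < of_int j" using yD[of i] by linarith
      then obtain l where l: "string_length \<X>\<^bsub>n\<^esub> (pt (ident n) (\<lambda>_. 0)) p l" "l < of_int j"
        using length_dist_less_imp[OF rectifiably_connected_houghton origin_points p] unfolding D_def by metis
      have "entry (fst p) i j = entry (ident n) i j"
        using entry_eq_of_string[OF l(1), of i j] True l(2) pt_self[OF cfg0] by simp
      then show ?thesis by simp
    next
      case False
      then show ?thesis
        using config_entry_blank[OF cfg, of i j] config_entry_blank[OF cfg0, of i j] y0[of i] by auto
    qed
  qed
  then have "raise n (2 * D) p = pt (ident n) ?y" by (simp add: raise_def pt_def)
  moreover have "0 \<le> ?y i" for i using yD[of i] y0[of i] D0 by (cases "i \<in> {1..n}") auto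
  ultimately show ?thesis using y0 unfolding ident_orthant_def by blast
qed

lemma stretch_points:
  assumes "p \<in> ident_orthant n" "0 \<le> c"
  shows "stretch n c p \<in> points \<X>\<^bsub>n\<^esub>"
proof -
  have "stretch n c p \<in> ident_orthant n"
    using assms by (auto simp: ident_orthant_def stretch_def pt_def intro!: image_eqI)
  then show ?thesis using ident_orthant_points by blast
qed

lemma length_dist_stretch:
  assumes p: "p \<in> ident_orthant n" and q: "q \<in> ident_orthant n" and c: "0 \<le> c" "c \<le> 1" and e: "0 \<le> e" "e \<le> 1"
  shows "length_dist \<X>\<^bsub>n\<^esub> (stretch n c p) (stretch n e q) \<le> length_dist \<X>\<^bsub>n\<^esub> p q + rdist n (snd p) (\<lambda>_. 0) * \<bar>c - e\<bar>"
proof -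
  have cfg: "config n (ident n) (\<lambda>_. 0)" using corner_ident[of n] by (simp add: corner_def)
  have pq: "0 \<le> snd p i" "0 \<le> snd q i" "i \<notin> {1..n} \<Longrightarrow> snd p i = 0" "i \<notin> {1..n} \<Longrightarrow> snd q i = 0" for i
    using p q by (auto simp: ident_orthant_def pt_def)
  have "length_dist \<X>\<^bsub>n\<^esub> (stretch n c p) (stretch n e q) \<le> rdist n (\<lambda>i. c * snd p i) (\<lambda>i. e * snd q i)"
    unfolding stretch_def using pq c e by (intro length_dist_orthant[OF cfg]) auto
  also have "\<dots> \<le> rdist n (\<lambda>i. c * snd p i) (\<lambda>i. e * snd p i) + rdist n (\<lambda>i. e * snd p i) (\<lambda>i. e * snd q i)"
    by (rule rdist_triangle)
  also have "rdist n (\<lambda>i. c * snd p i) (\<lambda>i. e * snd p i) = \<bar>c - e\<bar> * rdist n (snd p) (\<lambda>_. 0)"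
    by (rule rdist_scale) (simp add: left_diff_distrib)
  also have "rdist n (\<lambda>i. e * snd p i) (\<lambda>i. e * snd q i) = \<bar>e\<bar> * rdist n (snd p) (snd q)"
    by (rule rdist_scale) (simp add: right_diff_distrib)
  also have "\<bar>e\<bar> * rdist n (snd p) (snd q) \<le> 1 * rdist n (snd p) (snd q)"
    using e by (intro mult_right_mono rdist_nonneg) auto
  also have "rdist n (snd p) (snd q) \<le> length_dist \<X>\<^bsub>n\<^esub> p q"
    using p q ident_orthant_points by (intro length_dist_ge_rdist) auto
  finally show ?thesis by (simp add: mult.commute)
qed

text \<open>Raise each point into the orthant of the identity, at a speed proportional to its distance from
the origin, and then shrink the orthant to its apex.\<close>

lemma contractible_houghton: "contractible_space (metric_topology \<X>\<^bsub>n\<^esub>)"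
proof -
  interpret Metric_space "points \<X>\<^bsub>n\<^esub>" "length_dist \<X>\<^bsub>n\<^esub>" by (rule Metric_space_houghton)
  let ?c0 = "pt (ident n) (\<lambda>_. 0)" and ?I = "top_of_set {0..1::real}"
  let ?D = "\<lambda>p. 2 * length_dist \<X>\<^bsub>n\<^esub> ?c0 p"
  let ?r = "\<lambda>p. raise n (?D p) p"
  have rise: "continuous_map (prod_topology (top_of_set {0..}) mtopology) mtopology (\<lambda>(s, p). raise n s p)"
  proof -
    have "continuous_map (prod_topology (top_of_set {0..}) (subtopology mtopology (points \<X>\<^bsub>n\<^esub>))) mtopology (\<lambda>(s, p). raise n s p)"
    proof (rule continuous_map_family)
      show "0 \<le> rdist n (diag n 1) (\<lambda>_. 0)" for p :: cell_point by (rule rdist_nonneg)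
      fix s t :: real and p q assume st: "s \<in> {0..}" "t \<in> {0..}" and pq: "p \<in> points \<X>\<^bsub>n\<^esub>" "q \<in> points \<X>\<^bsub>n\<^esub>"
      then have "length_dist \<X>\<^bsub>n\<^esub> (raise n s p) (raise n t q)
          \<le> length_dist \<X>\<^bsub>n\<^esub> (raise n s p) (raise n t p) + length_dist \<X>\<^bsub>n\<^esub> (raise n t p) (raise n t q)"
        by (intro triangle raise_points) auto
      also have "\<dots> \<le> rdist n (diag n 1) (\<lambda>_. 0) * \<bar>s - t\<bar> + length_dist \<X>\<^bsub>n\<^esub> p q"
        using st pq by (intro add_mono length_dist_raise_raise length_dist_raise_le) auto
      finally show "length_dist \<X>\<^bsub>n\<^esub> (case (s, p) of (s, p) \<Rightarrow> raise n s p) (case (t, q) of (s, p) \<Rightarrow> raise n s p)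
          \<le> length_dist \<X>\<^bsub>n\<^esub> p q + rdist n (diag n 1) (\<lambda>_. 0) * \<bar>s - t\<bar>" by simp
    qed (auto intro: raise_points)
    then show ?thesis using subtopology_topspace[of mtopology] by simp
  qed
  have D: "continuous_map mtopology euclidean ?D"
    by (intro continuous_map_real_mult_left continuous_map_dist_from origin_points)
  have h: "continuous_map (prod_topology ?I mtopology) mtopology (\<lambda>(t, p). raise n (t * ?D p) p)"
  proof -
    have "continuous_map (prod_topology ?I mtopology) euclidean (\<lambda>z. fst z * ?D (snd z))"
      by (intro continuous_map_real_mult continuous_map_compose[OF continuous_map_snd D, unfolded o_def]
          continuous_map_into_fulltopology[OF continuous_map_fst])
    moreover have "0 \<le> fst z * ?D (snd z)" if "z \<in> topspace (prod_topology ?I mtopology)" for z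
      using that nonneg by auto
    ultimately have "continuous_map (prod_topology ?I mtopology) (top_of_set {0..}) (\<lambda>z. fst z * ?D (snd z))"
      by (auto simp: continuous_map_in_subtopology)
    then have "continuous_map (prod_topology ?I mtopology) (prod_topology (top_of_set {0..}) mtopology)
        (\<lambda>z. (fst z * ?D (snd z), snd z))"
      by (intro continuous_map_pairedI continuous_map_snd)
    from continuous_map_compose[OF this rise] show ?thesis by (simp add: o_def case_prod_beta')
  qed
  have r: "continuous_map mtopology mtopology ?r"
  proof -
    have "continuous_map mtopology (prod_topology ?I mtopology) (\<lambda>p. (1, p))"
      by (intro continuous_map_pairedI) auto
    from continuous_map_compose[OF this h] show ?thesis by (simp add: o_def)
  qed
  have h1: "homotopic_with (\<lambda>_. True) mtopology mtopology id ?r"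
  proof (subst homotopic_with, simp, intro exI conjI)
    show "continuous_map (prod_topology ?I mtopology) mtopology (\<lambda>(t, p). raise n (t * ?D p) p)" by (rule h)
    have "raise n 0 p = p" if "p \<in> points \<X>\<^bsub>n\<^esub>" for p
      using that pt_self by (auto simp: raise_def diag_def points_eq)
    then show "\<forall>p\<in>topspace mtopology. (case (0, p) of (t, p) \<Rightarrow> raise n (t * ?D p) p) = id p" by simp
  qed auto
  have ro: "continuous_map mtopology (subtopology mtopology (ident_orthant n)) ?r"
    using r raise_into_ident_orthant by (auto simp: continuous_map_in_subtopology)
  have st: "continuous_map (prod_topology ?I (subtopology mtopology (ident_orthant n))) mtopology (\<lambda>(c, p). stretch n c p)"
  proof (rule continuous_map_family)
    show "length_dist \<X>\<^bsub>n\<^esub> (case (s, p) of (c, p) \<Rightarrow> stretch n c p) (case (t, q) of (c, p) \<Rightarrow> stretch n c p)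
          \<le> length_dist \<X>\<^bsub>n\<^esub> p q + rdist n (snd p) (\<lambda>_. 0) * \<bar>s - t\<bar>"
      if "s \<in> {0..1}" "t \<in> {0..1}" "p \<in> ident_orthant n" "q \<in> ident_orthant n" for s t p q
      using length_dist_stretch[of p q s t] that by simp
  qed (auto intro: stretch_points rdist_nonneg ident_orthant_points[THEN subsetD])
  have h2: "homotopic_with (\<lambda>_. True) mtopology mtopology ?r (\<lambda>_. ?c0)"
  proof (subst homotopic_with, simp, intro exI conjI)
    let ?h = "\<lambda>z. (\<lambda>(c, p). stretch n c p) (1 - fst z, ?r (snd z))"
    have "continuous_map (prod_topology ?I mtopology) euclidean (\<lambda>z. 1 - fst z)"
      by (intro continuous_map_diff continuous_map_into_fulltopology[OF continuous_map_fst]) auto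
    then have "continuous_map (prod_topology ?I mtopology) ?I (\<lambda>z. 1 - fst z)"
      by (auto simp: continuous_map_in_subtopology)
    then have "continuous_map (prod_topology ?I mtopology) (prod_topology ?I (subtopology mtopology (ident_orthant n)))
        (\<lambda>z. (1 - fst z, ?r (snd z)))"
      by (intro continuous_map_pairedI continuous_map_compose[OF continuous_map_snd ro, unfolded o_def])
    from continuous_map_compose[OF this st]
    show "continuous_map (prod_topology ?I mtopology) mtopology ?h" by (simp add: o_def)
    have "stretch n 1 p = p" if "p \<in> ident_orthant n" for p
      using that by (auto simp: stretch_def ident_orthant_def pt_def)
    then show "\<forall>p\<in>topspace mtopology. ?h (0, p) = ?r p" using raise_into_ident_orthant by simp
    show "\<forall>p\<in>topspace mtopology. ?h (1, p) = ?c0" by (simp add: stretch_def)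
  qed simp
  show ?thesis
    unfolding contractible_space_def using homotopic_with_trans[OF h1 h2] by blast
qed

end

section \<open>Links of vertices\<close>

context
  fixes n :: nat
begin

lemma closed_cell_subset_iff:
  assumes "corner n \<rho> r" "T \<subseteq> {1..n}" "corner n \<sigma> b" "S \<subseteq> {1..n}"
  shows "closed_cell \<X>\<^bsub>n\<^esub> (\<rho>, T) \<subseteq> closed_cell \<X>\<^bsub>n\<^esub> (\<sigma>, S) \<longleftrightarrow>
         corner_box r T \<subseteq> corner_box b S \<and> truncate \<sigma> r = \<rho>"
proof -
  have eqs: "closed_cell \<X>\<^bsub>n\<^esub> (\<rho>, T) = pt \<rho> ` corner_box r T" "closed_cell \<X>\<^bsub>n\<^esub> (\<sigma>, S) = pt \<sigma> ` corner_box b S"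
    using assms closed_cell_eq by blast+
  have r: "r \<in> corner_box r T" "pt \<rho> r = (\<rho>, r)"
    using assms(1) pt_self by (auto simp: corner_box_def corner_def)
  show ?thesis
  proof (intro iffI conjI)
    assume sub: "closed_cell \<X>\<^bsub>n\<^esub> (\<rho>, T) \<subseteq> closed_cell \<X>\<^bsub>n\<^esub> (\<sigma>, S)"
    show "corner_box r T \<subseteq> corner_box b S" using sub by (auto simp: eqs pt_def)
    show "truncate \<sigma> r = \<rho>" using sub r by (auto simp: eqs pt_def)
  next
    assume sub: "corner_box r T \<subseteq> corner_box b S \<and> truncate \<sigma> r = \<rho>"
    have "pt \<rho> x = pt \<sigma> x" if "x \<in> corner_box r T" for x
    proof -
      have "r i \<le> x i" for i using that by (cases "i \<in> T") (simp_all add: corner_box_def)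
      then show ?thesis using sub truncate_truncate[of r x \<sigma>] by (simp add: pt_def)
    qed
    then show "closed_cell \<X>\<^bsub>n\<^esub> (\<rho>, T) \<subseteq> closed_cell \<X>\<^bsub>n\<^esub> (\<sigma>, S)" using sub by (auto simp: eqs)
  qed
qed

lemma cubes_at_iff:
  assumes "corner n \<tau> a"
  shows "(\<sigma>, S) \<in> cubes_at \<X>\<^bsub>n\<^esub> (\<tau>, a) \<longleftrightarrow> S \<subseteq> {1..n} \<and> S \<noteq> {} \<and> corner n \<sigma> (base n \<sigma>) \<and>
     a \<in> corner_box (base n \<sigma>) S \<and> truncate \<sigma> a = \<tau>"
proof -
  have card: "card S \<ge> 1 \<longleftrightarrow> S \<noteq> {}" if "S \<subseteq> {1..n}"
    using finite_subset[OF that] by (simp add: Suc_le_eq card_gt_0_iff)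
  have cell: "(\<sigma>, S) \<in> cells \<X>\<^bsub>n\<^esub> \<longleftrightarrow> S \<subseteq> {1..n} \<and> corner n \<sigma> (base n \<sigma>)"
    using base_eq by (auto simp: in_cells_iff)
  have "(\<tau>, a) \<in> closed_cell \<X>\<^bsub>n\<^esub> (\<sigma>, S) \<longleftrightarrow> a \<in> corner_box (base n \<sigma>) S \<and> truncate \<sigma> a = \<tau>"
    if "S \<subseteq> {1..n}" "corner n \<sigma> (base n \<sigma>)"
    using closed_cell_eq[OF that(2,1)] by (auto simp: pt_def)
  then show ?thesis using card cell by (auto simp: cubes_at_def)
qed

text \<open>A cube at \<open>a\<close> has one edge at \<open>a\<close> in each of its directions \<open>s\<close>. It runs between the two possible
values of the coordinate \<open>s\<close>, so its bottom corner is \<open>a\<close> with the coordinate \<open>s\<close> replaced by that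
of the bottom corner of the cube.\<close>

lemma link_simplex_eq:
  assumes v: "corner n \<tau> a" and c: "(\<sigma>, S) \<in> cubes_at \<X>\<^bsub>n\<^esub> (\<tau>, a)"
  shows "link_simplex \<X>\<^bsub>n\<^esub> (\<tau>, a) (\<sigma>, S) = (\<lambda>s. (truncate \<sigma> (a(s := base n \<sigma> s)), {s})) ` S"
proof -
  define b where "b = base n \<sigma>"
  have \<sigma>: "S \<subseteq> {1..n}" "corner n \<sigma> b" "a \<in> corner_box b S" "truncate \<sigma> a = \<tau>"
    using c cubes_at_iff[OF v] by (auto simp: b_def)
  have ba: "b i \<le> a i" "i \<notin> S \<Longrightarrow> a i = b i" "a i \<le> b i + 1" for i
    using \<sigma>(3) by (cases "i \<in> S"; simp add: corner_box_def)+
  have edge: "corner n (truncate \<sigma> (a(s := b s))) (a(s := b s))" if "s \<in> S" for s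
    unfolding corner_def
  proof (intro conjI allI config_truncate)
    show "config n \<sigma> b" using \<sigma>(2) by (simp add: corner_def)
    show "b i \<le> (a(s := b s)) i" for i using ba by simp
    show "(a(s := b s)) i = 0" if "i \<notin> {1..n}" for i
      using that \<open>s \<in> S\<close> \<sigma>(1) v config_outside[of n \<tau> a i] by (auto simp: corner_def)
    show "(a(s := b s)) i \<in> \<int>" for i using v \<sigma>(2) by (simp add: corner_def)
  qed
  show ?thesis
  proof (intro Set.set_eqI iffI)
    fix e assume "e \<in> link_simplex \<X>\<^bsub>n\<^esub> (\<tau>, a) (\<sigma>, S)"
    then have e: "e \<in> cubes_at \<X>\<^bsub>n\<^esub> (\<tau>, a)" "cell_dim \<X>\<^bsub>n\<^esub> e = 1" "closed_cell \<X>\<^bsub>n\<^esub> e \<subseteq> closed_cell \<X>\<^bsub>n\<^esub> (\<sigma>, S)"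
      by (simp_all add: link_simplex_def)
    obtain \<rho> T where eT: "e = (\<rho>, T)" by (cases e)
    then obtain s where T: "T = {s}" using e(2) by (auto simp: card_1_singleton_iff)
    define r where "r = base n \<rho>"
    have \<rho>: "{s} \<subseteq> {1..n}" "corner n \<rho> r" "a \<in> corner_box r {s}"
      using e(1) cubes_at_iff[OF v] by (auto simp: r_def eT T)
    have sub: "corner_box r {s} \<subseteq> corner_box b S" "truncate \<sigma> r = \<rho>"
      using e(3) closed_cell_subset_iff[OF \<rho>(2,1) \<sigma>(2,1)] by (simp_all add: eT T)
    have "r \<in> corner_box r {s}" "r(s := r s + 1) \<in> corner_box r {s}" by (auto simp: corner_box_def)
    then have in_b: "r \<in> corner_box b S" "r(s := r s + 1) \<in> corner_box b S" using sub(1) by blast+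
    then have s: "s \<in> S" by (auto simp: corner_box_def dest!: spec[of _ s] split: if_splits)
    have "b s \<le> r s" "r s + 1 \<le> b s + 1"
      using corner_box_in[OF in_b(1) s] corner_box_in[OF in_b(2) s] by simp_all
    moreover have "a i = r i" if "i \<noteq> s" for i using \<rho>(3) that by (simp add: corner_box_def)
    ultimately have "r = a(s := b s)" by (auto simp: fun_eq_iff)
    then show "e \<in> (\<lambda>s. (truncate \<sigma> (a(s := base n \<sigma> s)), {s})) ` S"
      using sub(2) s by (auto simp: eT T b_def)
  next
    fix e assume "e \<in> (\<lambda>s. (truncate \<sigma> (a(s := base n \<sigma> s)), {s})) ` S"
    then obtain s where s: "s \<in> S" and e: "e = (truncate \<sigma> (a(s := b s)), {s})" by (auto simp: b_def)
    have le: "(a(s := b s)) i \<le> a i" for i using ba by simp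
    have "e \<in> cubes_at \<X>\<^bsub>n\<^esub> (\<tau>, a)"
      unfolding e cubes_at_iff[OF v] base_eq[OF edge[OF s]]
      using s \<sigma>(1,4) edge[OF s] ba le by (auto simp: truncate_truncate corner_box_def)
    moreover have "closed_cell \<X>\<^bsub>n\<^esub> e \<subseteq> closed_cell \<X>\<^bsub>n\<^esub> (\<sigma>, S)"
      unfolding e
    proof (subst closed_cell_subset_iff[OF edge[OF s] _ \<sigma>(2,1)])
      show "{s} \<subseteq> {1..n}" using s \<sigma>(1) by blast
      show "corner_box (a(s := b s)) {s} \<subseteq> corner_box b S \<and> truncate \<sigma> (a(s := b s)) = truncate \<sigma> (a(s := b s))"
      proof
        show "corner_box (a(s := b s)) {s} \<subseteq> corner_box b S"
        proof
          fix x assume x: "x \<in> corner_box (a(s := b s)) {s}"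
          have "if i \<in> S then b i \<le> x i \<and> x i \<le> b i + 1 else x i = b i" for i
          proof (cases "i = s")
            case True
            then show ?thesis using corner_box_in[OF x, of s] s by simp
          next
            case False
            then have "x i = a i" using corner_box_out[OF x, of i] by simp
            then show ?thesis using ba[of i] by simp
          qed
          then show "x \<in> corner_box b S" by (simp add: corner_box_def)
        qed
      qed simp
    qed
    ultimately show "e \<in> link_simplex \<X>\<^bsub>n\<^esub> (\<tau>, a) (\<sigma>, S)" by (simp add: link_simplex_def e)
  qed
qed

text \<open>The edges at a vertex show the directions of a cube and the terms that its sequences have in
addition to those of the vertex.\<close>

lemma inj_on_link_simplex:
  assumes v: "corner n \<tau> a"
  shows "inj_on (link_simplex \<X>\<^bsub>n\<^esub> (\<tau>, a)) (cubes_at \<X>\<^bsub>n\<^esub> (\<tau>, a))"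
proof (rule inj_onI, clarify)
  fix \<sigma> S \<sigma>' S'
  assume c: "(\<sigma>, S) \<in> cubes_at \<X>\<^bsub>n\<^esub> (\<tau>, a)" and c': "(\<sigma>', S') \<in> cubes_at \<X>\<^bsub>n\<^esub> (\<tau>, a)"
    and eq: "link_simplex \<X>\<^bsub>n\<^esub> (\<tau>, a) (\<sigma>, S) = link_simplex \<X>\<^bsub>n\<^esub> (\<tau>, a) (\<sigma>', S')"
  let ?f = "\<lambda>\<sigma> s. (truncate \<sigma> (a(s := base n \<sigma> s)), {s})"
  have im: "?f \<sigma> ` S = ?f \<sigma>' ` S'" using eq link_simplex_eq[OF v] c c' by simp
  have "\<Union> (snd ` ?f \<sigma> ` S) = \<Union> (snd ` ?f \<sigma>' ` S')" using im by simp
  then have S: "S' = S" by (simp add: image_image)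
  have tr: "truncate \<sigma> (a(s := base n \<sigma> s)) = truncate \<sigma>' (a(s := base n \<sigma>' s))" if "s \<in> S" for s
  proof -
    have "?f \<sigma> s \<in> ?f \<sigma>' ` S" using im that S by blast
    then show ?thesis by auto
  qed
  have \<sigma>: "corner n \<sigma> (base n \<sigma>)" "a \<in> corner_box (base n \<sigma>) S" "truncate \<sigma> a = \<tau>" "S \<subseteq> {1..n}"
    and \<sigma>': "corner n \<sigma>' (base n \<sigma>')" "a \<in> corner_box (base n \<sigma>') S" "truncate \<sigma>' a = \<tau>"
    using c c' cubes_at_iff[OF v] S by auto
  have out: "base n \<sigma> i = a i" "base n \<sigma>' i = a i" if "i \<notin> S" for i
    using corner_box_out[OF \<sigma>(2) that] corner_box_out[OF \<sigma>'(2) that] by simp_all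
  have ent: "entry \<sigma> i j = entry \<sigma>' i j" if "base n \<sigma> i < of_int j" "base n \<sigma>' i < of_int j" for i j
  proof (cases "i \<in> S")
    case True
    have "entry (truncate \<sigma> (a(i := base n \<sigma> i))) i j = entry (truncate \<sigma>' (a(i := base n \<sigma>' i))) i j"
      using tr[OF True] by simp
    then show ?thesis using that by simp
  next
    case False
    have "entry (truncate \<sigma> a) i j = entry (truncate \<sigma>' a) i j" using \<sigma>(3) \<sigma>'(3) by simp
    then show ?thesis using that out[OF False] by simp
  qed
  have cfg: "config n \<sigma> (base n \<sigma>)" "config n \<sigma>' (base n \<sigma>')" using \<sigma> \<sigma>' by (simp_all add: corner_def)
  have "base n \<sigma> s < of_int j \<longleftrightarrow> base n \<sigma>' s < of_int j" if "s \<in> S" for s j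
  proof -
    have s: "s \<in> {1..n}" using that \<sigma>(4) by blast
    have "entry (truncate \<sigma> (a(s := base n \<sigma> s))) s j \<in> rays n \<longleftrightarrow> base n \<sigma> s < of_int j"
      using s config_entry_iff[OF cfg(1), of s j] by auto
    moreover have "entry (truncate \<sigma>' (a(s := base n \<sigma>' s))) s j \<in> rays n \<longleftrightarrow> base n \<sigma>' s < of_int j"
      using s config_entry_iff[OF cfg(2), of s j] by auto
    ultimately show ?thesis using tr[OF that] by simp
  qed
  then have less: "base n \<sigma> i < of_int j \<longleftrightarrow> base n \<sigma>' i < of_int j" for i j
    using out by (cases "i \<in> S") auto
  have "\<sigma> = \<sigma>'"
  proof (rule entry_eqI)
    fix i j
    show "entry \<sigma> i j = entry \<sigma>' i j"
      using ent[of i j] less[of i j] config_entry_blank[OF cfg(1), of i j] config_entry_blank[OF cfg(2), of i j]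
      by fastforce
  qed
  with S show "\<sigma> = \<sigma>' \<and> S = S'" by simp
qed

text \<open>Edges that pairwise span squares have different directions and fit together to sequences \<open>\<sigma>\<close>: in
direction \<open>i\<close> take the sequence of the edge in that direction, if there is one, and that of the
vertex otherwise. Terms of \<open>\<sigma>\<close> in two places come from at most two of the edges, hence both occur
in a single edge or square, and therefore they are different. So \<open>\<sigma>\<close> is the bottom corner of a cube.\<close>

lemma flag_complex_link:
  assumes v: "corner n \<tau> a"
  shows "flag_complex (link \<X>\<^bsub>n\<^esub> (\<tau>, a))"
  unfolding flag_complex_def
proof (intro allI impI, elim conjE)
  fix E assume E: "finite E" "E \<noteq> {}" "E \<subseteq> \<Union> (link \<X>\<^bsub>n\<^esub> (\<tau>, a))"
    and adj: "\<forall>e\<in>E. \<forall>e'\<in>E. e \<noteq> e' \<longrightarrow> {e, e'} \<in> link \<X>\<^bsub>n\<^esub> (\<tau>, a)"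
  let ?r = "\<lambda>e. base n (fst e)"
  have edge: "\<exists>s. snd e = {s} \<and> s \<in> {1..n} \<and> corner n (fst e) (?r e) \<and>
      a \<in> corner_box (?r e) {s} \<and> truncate (fst e) a = \<tau>" if eE: "e \<in> E" for e
  proof -
    have "e \<in> cubes_at \<X>\<^bsub>n\<^esub> (\<tau>, a)" "cell_dim \<X>\<^bsub>n\<^esub> e = 1"
      using eE E(3) by (auto simp: link_def link_simplex_def)
    moreover obtain \<rho> T where eT: "e = (\<rho>, T)" by (cases e)
    moreover obtain s where "T = {s}" using calculation by (auto simp: card_1_singleton_iff)
    ultimately show ?thesis using cubes_at_iff[OF v, of \<rho> T] by auto
  qed
  then obtain d where d: "\<And>e. e \<in> E \<Longrightarrow> snd e = {d e}" "\<And>e. e \<in> E \<Longrightarrow> d e \<in> {1..n}"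
    "\<And>e. e \<in> E \<Longrightarrow> corner n (fst e) (?r e)" "\<And>e. e \<in> E \<Longrightarrow> a \<in> corner_box (?r e) {d e}"
    "\<And>e. e \<in> E \<Longrightarrow> truncate (fst e) a = \<tau>" by metis
  have cfg: "config n (fst e) (?r e)" if "e \<in> E" for e using d(3)[OF that] by (simp add: corner_def)
  have cfgv: "config n \<tau> a" using v by (simp add: corner_def)
  have rout: "?r e i = a i" if "e \<in> E" "i \<noteq> d e" for e i
    using d(4)[OF that(1)] that(2) by (simp add: corner_box_def)
  have rd: "?r e (d e) \<le> a (d e)" "a (d e) \<le> ?r e (d e) + 1" if "e \<in> E" for e
    using d(4)[OF that] by (simp_all add: corner_box_def)
  have ra: "?r e i \<le> a i" if "e \<in> E" for e i
    using rd[OF that] rout[OF that, of i] by (cases "i = d e") auto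
  have ent_v: "entry \<tau> i j = entry (fst e) i j" if "e \<in> E" "a i < of_int j" for e i j
    using entry_truncate[of "fst e" a i j] d(5)[OF that(1)] that(2) by simp
  \<comment> \<open>A common extension of two edges: the bottom corner of the square that they span, or the edge itself if they are equal.\<close>
  have pair: "\<exists>\<sigma> b. config n \<sigma> b \<and> (\<forall>i j. entry (fst e) i j \<in> rays n \<longrightarrow> entry (fst e) i j = entry \<sigma> i j) \<and>
      (\<forall>i j. entry (fst e') i j \<in> rays n \<longrightarrow> entry (fst e') i j = entry \<sigma> i j) \<and> (d e = d e' \<longrightarrow> e = e')"
    if ee': "e \<in> E" "e' \<in> E" for e e'
  proof (cases "e = e'")
    case True
    then show ?thesis using cfg[OF ee'(1)] by blast
  next
    case False
    then have "{e, e'} \<in> link \<X>\<^bsub>n\<^esub> (\<tau>, a)" using adj ee' by blast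
    then obtain \<sigma> S where c: "(\<sigma>, S) \<in> cubes_at \<X>\<^bsub>n\<^esub> (\<tau>, a)" "link_simplex \<X>\<^bsub>n\<^esub> (\<tau>, a) (\<sigma>, S) = {e, e'}"
      by (auto simp: link_def)
    let ?f = "\<lambda>s. (truncate \<sigma> (a(s := base n \<sigma> s)), {s})"
    have im: "?f ` S = {e, e'}" using c(2) unfolding link_simplex_eq[OF v c(1)] .
    have f: "z = ?f (d z)" if "z \<in> {e, e'}" for z
    proof -
      have "z \<in> ?f ` S" using that unfolding im .
      then obtain s where "z = ?f s" by (rule imageE)
      then show ?thesis using d(1)[of z] that ee' by auto
    qed
    have "corner n \<sigma> (base n \<sigma>)" using c(1) cubes_at_iff[OF v] by blast
    then have cfg\<sigma>: "config n \<sigma> (base n \<sigma>)" by (simp add: corner_def)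
    have ext: "entry (fst z) i j = entry \<sigma> i j" if "z \<in> {e, e'}" "entry (fst z) i j \<in> rays n" for z i j
    proof -
      have "fst z = truncate \<sigma> (a(d z := base n \<sigma> (d z)))" using f[OF that(1)] by (metis fst_conv)
      then show ?thesis using that(2) by (auto split: if_splits)
    qed
    have "e = e'" if "d e = d e'" using f[of e] f[of e'] that by simp
    then show ?thesis using cfg\<sigma> ext[of e] ext[of e'] by (intro exI[of _ \<sigma>] exI[of _ "base n \<sigma>"]) auto
  qed
  have inj_d: "e = e'" if "e \<in> E" "e' \<in> E" "d e = d e'" for e e'
    using pair[OF that(1,2)] that(3) by blast
  define S where "S = d ` E"
  define ed where "ed s = (THE e. e \<in> E \<and> d e = s)" for s
  have ed_d: "ed (d e) = e" if "e \<in> E" for e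
    unfolding ed_def using that inj_d by blast
  then have ed: "ed s \<in> E" "d (ed s) = s" if "s \<in> S" for s using that by (auto simp: S_def)
  define b where "b i = (if i \<in> S then ?r (ed i) i else a i)" for i
  define \<sigma> where "\<sigma> = of_entries (\<lambda>i j. if i \<in> S then entry (fst (ed i)) i j else entry \<tau> i j)"
  have Sn: "S \<subseteq> {1..n}" using d(2) by (auto simp: S_def)
  have ba: "b i \<le> a i" for i using ra[OF ed(1)] by (simp add: b_def)
  have from_edge: "\<exists>e\<in>E. entry \<sigma> i j = entry (fst e) i j" if "entry \<sigma> i j \<in> rays n" for i j
  proof (cases "i \<in> S")
    case True
    then show ?thesis using ed(1) by (auto simp: \<sigma>_def)
  next
    case False
    then have "entry \<sigma> i j = entry \<tau> i j" by (simp add: \<sigma>_def)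
    moreover have "a i < of_int j" using that calculation config_entry_iff[OF cfgv, of i j] by simp
    moreover obtain e where "e \<in> E" using E(2) by blast
    ultimately show ?thesis using ent_v by auto
  qed
  have cor: "corner n \<sigma> b"
  proof -
    have "entry \<sigma> i j \<in> rays n \<longleftrightarrow> i \<in> {1..n} \<and> b i < of_int j" for i j
      using config_entry_iff[OF cfg[OF ed(1)], of i i j] config_entry_iff[OF cfgv, of i j]
      by (simp add: \<sigma>_def b_def)
    moreover have "entry \<sigma> i j = (0, 0)" if "entry \<sigma> i j \<notin> rays n" for i j
    proof (cases "i \<in> S")
      case True
      then show ?thesis
        using that config_entry_iff[OF cfg[OF ed(1)], of i i j] config_entry_blank[OF cfg[OF ed(1)], of i i j]
        by (simp add: \<sigma>_def)
    next
      case False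
      then show ?thesis
        using that config_entry_iff[OF cfgv, of i j] config_entry_blank[OF cfgv, of i j] by (simp add: \<sigma>_def)
    qed
    moreover have "i = i' \<and> j = j'" if eq: "entry \<sigma> i j = entry \<sigma> i' j'" and r: "entry \<sigma> i j \<in> rays n" for i j i' j'
    proof -
      obtain e where e: "e \<in> E" "entry \<sigma> i j = entry (fst e) i j" using from_edge[OF r] by blast
      obtain e' where e': "e' \<in> E" "entry \<sigma> i' j' = entry (fst e') i' j'" using from_edge[of i' j'] r eq by auto
      obtain \<sigma>' b' where c: "config n \<sigma>' b'"
        "\<And>i j. entry (fst e) i j \<in> rays n \<Longrightarrow> entry (fst e) i j = entry \<sigma>' i j"
        "\<And>i j. entry (fst e') i j \<in> rays n \<Longrightarrow> entry (fst e') i j = entry \<sigma>' i j"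
        using pair[OF e(1) e'(1)] by blast
      have "entry \<sigma>' i j = entry \<sigma>' i' j'" "entry \<sigma>' i j \<in> rays n"
        using c(2)[of i j] c(3)[of i' j'] e e' eq r by simp_all
      then show ?thesis using config_inj[OF c(1)] by blast
    qed
    moreover obtain N :: nat where N: "\<And>i j. i \<in> {1..n} \<Longrightarrow> j > int N \<Longrightarrow> entry \<tau> i j = (i, nat j)"
      using config_tail[OF cfgv] by blast
    have "entry \<sigma> i j = (i, nat j)" if "i \<in> {1..n}" "j > int N" for i j
    proof -
      have "entry \<tau> i j \<in> rays n" using N[OF that] that by (simp add: rays_def)
      then have "a i < of_int j" using config_entry_iff[OF cfgv, of i j] by simp
      then show ?thesis using N[OF that] ent_v[OF ed(1), of i i j] by (simp add: \<sigma>_def)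
    qed
    moreover have "b i = 0" if "i \<notin> {1..n}" for i
      using that Sn config_outside[OF cfgv that] by (auto simp: b_def)
    ultimately have "config n \<sigma> b" unfolding config_def by blast
    moreover have "b i \<in> \<int>" for i
      using v d(3)[OF ed(1)] by (simp add: b_def corner_def)
    ultimately show ?thesis by (simp add: corner_def)
  qed
  have cfgs: "config n \<sigma> b" using cor by (simp add: corner_def)
  have tr: "truncate \<sigma> a = \<tau>"
  proof (rule entry_eqI)
    fix i j
    show "entry (truncate \<sigma> a) i j = entry \<tau> i j"
      using ent_v[OF ed(1), of i i j] config_entry_blank[OF cfgv, of i j] by (auto simp: \<sigma>_def)
  qed
  have "a \<in> corner_box b S"
    using rd[OF ed(1)] ed(2) by (auto simp: corner_box_def b_def)
  moreover have "S \<noteq> {}" using E(2) by (simp add: S_def)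
  ultimately have cube: "(\<sigma>, S) \<in> cubes_at \<X>\<^bsub>n\<^esub> (\<tau>, a)"
    using cubes_at_iff[OF v] Sn cor tr base_eq[OF cor] by auto
  have "truncate \<sigma> (a(s := b s)) = fst (ed s)" if s: "s \<in> S" for s
  proof (rule entry_eqI)
    fix i j
    have bs: "b s = ?r (ed s) s" using s by (simp add: b_def)
    show "entry (truncate \<sigma> (a(s := b s))) i j = entry (fst (ed s)) i j"
    proof (cases "i = s")
      case True
      then show ?thesis
        using s bs config_entry_blank[OF cfg[OF ed(1)[OF s]], of s j] by (simp add: \<sigma>_def)
    next
      case False
      then have ri: "?r (ed s) i = a i" using rout[OF ed(1)[OF s]] ed(2)[OF s] by simp
      have "entry (truncate \<sigma> a) i j = entry (truncate (fst (ed s)) a) i j"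
        using tr d(5)[OF ed(1)[OF s]] by simp
      then show ?thesis
        using False ri config_entry_blank[OF cfg[OF ed(1)[OF s]], of i j] by (auto split: if_splits)
    qed
  qed
  moreover have "snd (ed s) = {s}" if "s \<in> S" for s using d(1)[OF ed(1)[OF that]] ed(2)[OF that] by simp
  ultimately have "(truncate \<sigma> (a(s := base n \<sigma> s)), {s}) = ed s" if "s \<in> S" for s
    using that by (simp add: base_eq[OF cor] prod_eq_iff)
  then have "link_simplex \<X>\<^bsub>n\<^esub> (\<tau>, a) (\<sigma>, S) = ed ` S"
    unfolding link_simplex_eq[OF v cube] by (intro image_cong) auto
  also have "ed ` S = E" using ed_d by (force simp: S_def image_image)
  finally show "E \<in> link \<X>\<^bsub>n\<^esub> (\<tau>, a)" using cube by (auto simp: link_def)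
qed

lemma nonpositively_curved_houghton: "nonpositively_curved \<X>\<^bsub>n\<^esub>"
  unfolding nonpositively_curved_def vertices_eq using inj_on_link_simplex flag_complex_link by blast

lemma cubing_houghton: "cubing \<X>\<^bsub>n\<^esub>"
proof -
  have "contractible_space (weak_topology \<X>\<^bsub>n\<^esub>)" using contractible_houghton weak_topology_eq_metric_topology_houghton by simp
  then have "connected_space (weak_topology \<X>\<^bsub>n\<^esub>)" "simply_connected_space (weak_topology \<X>\<^bsub>n\<^esub>)"
    by (simp_all add: contractible_imp_connected_space contractible_imp_simply_connected_space)
  then show ?thesis
    using cubical_complex_houghton nonpositively_curved_houghton Metric_space_houghton by (simp add: cubing_def)
qed

lemma has_dimension_houghton: "has_dimension \<X>\<^bsub>n\<^esub> n"
proof -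
  have "card S \<le> n" if "S \<subseteq> {1..n}" for S using card_mono[OF _ that] by simp
  moreover have "(ident n, {1..n}) \<in> cells \<X>\<^bsub>n\<^esub>" using corner_ident by (auto simp: in_cells_iff)
  ultimately show ?thesis
    unfolding has_dimension_def
    by (intro conjI ballI bexI[of _ "(ident n, {1..n})"]) (auto simp: in_cells_iff)
qed

end

section \<open>The action of the group\<close>

definition eventually_shifts :: "(nat \<times> nat \<Rightarrow> nat \<times> nat) \<Rightarrow> nat \<Rightarrow> int \<Rightarrow> bool" where
  "eventually_shifts g i m \<longleftrightarrow> (\<exists>N. \<forall>p>N. fst (g (i, p)) = i \<and> int (snd (g (i, p))) = int p + m)"

definition shift :: "nat \<Rightarrow> (nat \<times> nat \<Rightarrow> nat \<times> nat) \<Rightarrow> nat \<Rightarrow> int" where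
  "shift n g i = (if i \<in> {1..n} then THE m. eventually_shifts g i m else 0)"

text \<open>Postcomposition with \<open>g\<close>. Because \<open>(i, j)\<close> goes to \<open>(i, j + m)\<close> for large \<open>j\<close>, where \<open>m\<close> is the
shift of \<open>g\<close> on ray \<open>i\<close>, the indices have to be shifted too for the new sequence to be standard
far out; the coordinates change accordingly.\<close>

definition move :: "nat \<Rightarrow> (nat \<times> nat \<Rightarrow> nat \<times> nat) \<Rightarrow> (nat \<times> nat \<Rightarrow> nat \<times> nat) \<Rightarrow> nat \<times> nat \<Rightarrow> nat \<times> nat" where
  "move n g \<sigma> = of_entries (\<lambda>i j. g (entry \<sigma> i (j - shift n g i)))"

definition act :: "nat \<Rightarrow> cell_point \<Rightarrow> (nat \<times> nat \<Rightarrow> nat \<times> nat) \<Rightarrow> cell_point" where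
  "act n p g = (move n g (fst p), \<lambda>i. snd p i + of_int (shift n g i))"

lemma eventually_shifts_unique:
  assumes "eventually_shifts g i m" "eventually_shifts g i m'"
  shows "m = m'"
proof -
  obtain N where N: "\<And>p. p > N \<Longrightarrow> int (snd (g (i, p))) = int p + m"
    using assms(1) unfolding eventually_shifts_def by blast
  obtain N' where N': "\<And>p. p > N' \<Longrightarrow> int (snd (g (i, p))) = int p + m'"
    using assms(2) unfolding eventually_shifts_def by blast
  show ?thesis using N[of "N + N' + 1"] N'[of "N + N' + 1"] by simp
qed

lemma shift_eq: "i \<in> {1..n} \<Longrightarrow> eventually_shifts g i m \<Longrightarrow> shift n g i = m"
  unfolding shift_def using eventually_shifts_unique by (auto intro!: the_equality)

lemma shift_outside [simp]: "i \<notin> {1..n} \<Longrightarrow> shift n g i = 0"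
  unfolding shift_def by (simp only: if_False)

lemma eventual_translation_tail:
  assumes "eventual_translation n g"
  obtains N :: nat where "\<And>i p. i \<in> {1..n} \<Longrightarrow> p > N \<Longrightarrow>
     fst (g (i, p)) = i \<and> int (snd (g (i, p))) = int p + shift n g i"
proof -
  from assms obtain m :: "nat \<Rightarrow> int" and K where K: "finite K"
    and gm: "\<And>k p. (k, p) \<in> rays n - K \<Longrightarrow> fst (g (k, p)) = k \<and> int (snd (g (k, p))) = int p + m k"
    unfolding eventual_translation_def by blast
  obtain N where N: "\<And>q. q \<in> K \<Longrightarrow> snd q \<le> N"
    using finite_nat_set_iff_bounded_le[of "snd ` K"] K by auto
  have gN: "fst (g (i, p)) = i \<and> int (snd (g (i, p))) = int p + m i" if "i \<in> {1..n}" "p > N" for i p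
    using gm[of i p] N[of "(i, p)"] that by (fastforce simp: rays_def)
  then have "shift n g i = m i" if "i \<in> {1..n}" for i
    using that by (intro shift_eq) (auto simp: eventually_shifts_def)
  with gN show ?thesis using that by auto
qed

lemma eventual_translation_rays:
  assumes "eventual_translation n g"
  shows "g q \<in> rays n \<longleftrightarrow> q \<in> rays n" and "g (0, 0) = (0, 0)" and "inj g"
  using assms permutes_in_image[of g "rays n"] permutes_not_in[of g "rays n" "(0, 0)"] permutes_inj[of g "rays n"]
  by (auto simp: eventual_translation_def)

lemma config_move:
  assumes g: "eventual_translation n g" and \<sigma>: "config n \<sigma> x"
  shows "config n (move n g \<sigma>) (\<lambda>i. x i + of_int (shift n g i))"
proof -
  note gr = eventual_translation_rays[OF g]
  have ent: "entry (move n g \<sigma>) i j = g (entry \<sigma> i (j - shift n g i))" for i j by (simp add: move_def)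
  obtain N :: nat where N: "\<And>i j. i \<in> {1..n} \<Longrightarrow> j > int N \<Longrightarrow> entry \<sigma> i j = (i, nat j)"
    using config_tail[OF \<sigma>] by blast
  obtain L :: nat where L: "\<And>i p. i \<in> {1..n} \<Longrightarrow> p > L \<Longrightarrow>
     fst (g (i, p)) = i \<and> int (snd (g (i, p))) = int p + shift n g i"
    using eventual_translation_tail[OF g] by blast
  obtain B :: nat where B: "\<And>i. i \<in> {1..n} \<Longrightarrow> \<bar>shift n g i\<bar> \<le> int B"
    using bounded_on_indices[of n "shift n g"] by blast
  have "entry (move n g \<sigma>) i j = (i, nat j)" if "i \<in> {1..n}" "j > int (N + L + B)" for i j
  proof -
    have j: "j - shift n g i > int N" "j - shift n g i > int L" using B[OF that(1)] that(2) by linarith+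
    then have "nat (j - shift n g i) > L" by linarith
    from L[OF that(1) this] N[OF that(1) j(1)] j
    have "fst (entry (move n g \<sigma>) i j) = i" "int (snd (entry (move n g \<sigma>) i j)) = j"
      by (simp_all add: ent)
    then show ?thesis by (simp add: prod_eq_iff) 
  qed
  moreover have "entry (move n g \<sigma>) i j \<in> rays n \<longleftrightarrow> i \<in> {1..n} \<and> x i + of_int (shift n g i) < of_int j" for i j
    using config_entry_iff[OF \<sigma>, of i "j - shift n g i"] by (simp add: ent gr less_diff_eq)
  moreover have "entry (move n g \<sigma>) i j = (0, 0)" if "entry (move n g \<sigma>) i j \<notin> rays n" for i j
    using that config_entry_iff[OF \<sigma>] config_entry_blank[OF \<sigma>, of i "j - shift n g i"] by (simp add: ent gr)
  moreover have "i = i' \<and> j = j'"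
    if "entry (move n g \<sigma>) i j = entry (move n g \<sigma>) i' j'" "entry (move n g \<sigma>) i j \<in> rays n" for i j i' j'
    using that config_inj[OF \<sigma>, of i "j - shift n g i" i' "j' - shift n g i'"]
    by (auto simp: ent gr(1) inj_eq[OF gr(3)])
  moreover have "x i + of_int (shift n g i) = 0" if "i \<notin> {1..n}" for i
    using config_outside[OF \<sigma> that] shift_outside[OF that] by simp
  ultimately show ?thesis unfolding config_def by blast
qed

lemma corner_move:
  "eventual_translation n g \<Longrightarrow> corner n \<sigma> a \<Longrightarrow>
     corner n (move n g \<sigma>) (\<lambda>i. a i + of_int (shift n g i))"
  using config_move by (simp add: corner_def)

lemma act_pt:
  assumes "eventual_translation n g"
  shows "act n (pt \<sigma> x) g = pt (move n g \<sigma>) (\<lambda>i. x i + of_int (shift n g i))"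
proof -
  have "move n g (truncate \<sigma> x) = truncate (move n g \<sigma>) (\<lambda>i. x i + of_int (shift n g i))"
    by (rule entry_eqI) (simp add: move_def less_diff_eq eventual_translation_rays[OF assms])
  then show ?thesis by (simp add: act_def pt_def)
qed

lemma shift_id: "shift n id i = 0"
proof (cases "i \<in> {1..n}")
  case True
  then show ?thesis by (rule shift_eq) (auto simp: eventually_shifts_def)
qed simp

lemma shift_comp:
  assumes g: "eventual_translation n g" and h: "eventual_translation n h"
  shows "shift n (h \<circ> g) i = shift n g i + shift n h i"
proof (cases "i \<in> {1..n}")
  case True
  obtain N where N: "\<And>p. p > N \<Longrightarrow> fst (g (i, p)) = i \<and> int (snd (g (i, p))) = int p + shift n g i"
    using eventual_translation_tail[OF g] True by metis
  obtain L where L: "\<And>p. p > L \<Longrightarrow> fst (h (i, p)) = i \<and> int (snd (h (i, p))) = int p + shift n h i"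
    using eventual_translation_tail[OF h] True by metis
  have "eventually_shifts (h \<circ> g) i (shift n g i + shift n h i)"
    unfolding eventually_shifts_def
  proof (intro exI allI impI)
    fix p assume p: "p > N + L + nat \<bar>shift n g i\<bar>"
    let ?q = "snd (g (i, p))"
    have gp: "g (i, p) = (i, ?q)" "int ?q = int p + shift n g i" using N[of p] p by (auto simp: prod_eq_iff)
    then have "?q > L" using p by linarith
    from L[OF this] gp show "fst ((h \<circ> g) (i, p)) = i \<and>
        int (snd ((h \<circ> g) (i, p))) = int p + (shift n g i + shift n h i)" by (metis add.assoc comp_apply)
  qed
  then show ?thesis using True shift_eq by blast
qed simp

lemma act_id: "act n p id = p"
  by (simp add: act_def move_def shift_id prod_eq_iff) (rule entry_eqI, simp)

lemma act_comp:
  assumes "eventual_translation n g" "eventual_translation n h"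
  shows "act n p (h \<circ> g) = act n (act n p g) h"
proof -
  have "move n (h \<circ> g) \<sigma> = move n h (move n g \<sigma>)" for \<sigma>
    by (rule entry_eqI) (simp add: move_def shift_comp[OF assms] algebra_simps)
  then show ?thesis by (simp add: act_def shift_comp[OF assms] algebra_simps)
qed

text \<open>The identity vertex has height 0, as it misses nothing; neither does its image under a bijection,
whose coordinates are the shifts.\<close>

lemma sum_shift:
  assumes "eventual_translation n g"
  shows "(\<Sum>i\<in>{1..n}. real_of_int (shift n g i)) = 0"
proof -
  have 0: "corner n (move n g (ident n)) (\<lambda>i. 0 + of_int (shift n g i))"
    using corner_move[OF assms corner_ident] .
  have "missing n (move n g (ident n)) = {}"
  proof -
    have "q \<in> {entry (move n g (ident n)) i j |i j. True}" if "q \<in> rays n" for q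
    proof -
      obtain r where r: "q = g r" "r \<in> rays n"
      proof -
        have "surj g" using assms permutes_surj by (auto simp: eventual_translation_def)
        then obtain r where "q = g r" by (rule surjE)
        then show thesis using that eventual_translation_rays(1)[OF assms] \<open>q \<in> rays n\<close> by simp
      qed
      obtain i p where ip: "r = (i, p)" by (cases r)
      have "entry (ident n) i (int p) = r" using r(2) by (auto simp: ip entry_ident rays_def)
      then have "entry (move n g (ident n)) i (int p + shift n g i) = q" by (simp add: move_def r(1))
      then show ?thesis by blast
    qed
    then show ?thesis by (auto simp: missing_def)
  qed
  then show ?thesis using card_missing(2)[OF 0] by simp
qed

text \<open>Send the terms of \<open>\<sigma>\<close> to the corresponding terms of \<open>\<tau>\<close> and match the missed values, which are
equally many, by any bijection. This is an eventual translation since both vertices are standard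
far out.\<close>

lemma transitive_on_corners:
  assumes \<sigma>: "corner n \<sigma> a" and \<tau>: "corner n \<tau> b" and sum: "(\<Sum>i\<in>{1..n}. a i) = (\<Sum>i\<in>{1..n}. b i)"
  shows "\<exists>g. eventual_translation n g \<and> move n g \<sigma> = \<tau> \<and> (\<forall>i. b i = a i + of_int (shift n g i))"
proof -
  have cfg: "config n \<sigma> a" "config n \<tau> b" using \<sigma> \<tau> by (simp_all add: corner_def)
  define m where "m i = \<lfloor>b i - a i\<rfloor>" for i
  have m: "b i = a i + of_int (m i)" for i
  proof -
    have "b i - a i \<in> \<int>" using \<sigma> \<tau> by (simp add: corner_def)
    then show ?thesis by (auto simp: m_def elim!: Ints_cases)
  qed
  have "real (card (missing n \<sigma>)) = real (card (missing n \<tau>))"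
    using card_missing(2)[OF \<sigma>] card_missing(2)[OF \<tau>] sum by simp
  then obtain \<beta> where \<beta>: "bij_betw \<beta> (missing n \<sigma>) (missing n \<tau>)"
    using finite_same_card_bij[OF card_missing(1)[OF \<sigma>] card_missing(1)[OF \<tau>]] by auto
  define D where "D x = {(i, j). i \<in> {1..n} \<and> x i < of_int j}" for x :: "nat \<Rightarrow> real"
  let ?e = "\<lambda>\<sigma> (i, j). entry \<sigma> i j"
  have bij: "bij_betw (?e \<rho>) (D x) (rays n - missing n \<rho>)" if "config n \<rho> x" for \<rho> x
  proof (rule bij_betwI')
    fix y z assume "y \<in> D x" "z \<in> D x"
    then show "(?e \<rho> y = ?e \<rho> z) = (y = z)"
      using config_entry_iff[OF that] config_inj[OF that] by (cases y, cases z) (auto simp: D_def)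
  next
    fix y assume "y \<in> D x"
    then show "?e \<rho> y \<in> rays n - missing n \<rho>"
      using config_entry_iff[OF that] by (cases y) (auto simp: D_def missing_def)
  next
    fix q assume "q \<in> rays n - missing n \<rho>"
    then obtain i j where "q = entry \<rho> i j" "entry \<rho> i j \<in> rays n" by (auto simp: missing_def)
    then show "\<exists>y\<in>D x. q = ?e \<rho> y"
      using config_entry_iff[OF that, of i j] by (intro bexI[of _ "(i, j)"]) (auto simp: D_def)
  qed
  have shiftD: "bij_betw (\<lambda>(i, j). (i, j + m i)) (D a) (D b)"
    by (rule bij_betw_byWitness[where f' = "\<lambda>(i, j). (i, j - m i)"]) (auto simp: D_def m)
  define \<gamma> where "\<gamma> = ?e \<tau> \<circ> (\<lambda>(i, j). (i, j + m i)) \<circ> inv_into (D a) (?e \<sigma>)"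
  have \<gamma>: "bij_betw \<gamma> (rays n - missing n \<sigma>) (rays n - missing n \<tau>)"
    unfolding \<gamma>_def
    by (intro bij_betw_trans[OF _ bij_betw_trans[OF shiftD bij[OF cfg(2)]], unfolded comp_assoc[symmetric]]
        bij_betw_inv_into bij[OF cfg(1)])
  define g where "g q = (if q \<in> missing n \<sigma> then \<beta> q else if q \<in> rays n then \<gamma> q else q)" for q
  have sub: "missing n \<rho> \<subseteq> rays n" for \<rho> by (auto simp: missing_def)
  have g_entry: "g (entry \<sigma> i j) = entry \<tau> i (j + m i)" if "(i, j) \<in> D a" for i j
  proof -
    have "entry \<sigma> i j \<in> rays n - missing n \<sigma>" using bij_betwE[OF bij[OF cfg(1)]] that by fastforce
    moreover have "inv_into (D a) (?e \<sigma>) (entry \<sigma> i j) = (i, j)"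
      using inv_into_f_f[OF bij_betw_imp_inj_on[OF bij[OF cfg(1)]] that] by simp
    ultimately show ?thesis by (simp add: g_def \<gamma>_def)
  qed
  have perm: "g permutes rays n"
  proof (rule bij_imp_permutes)
    have "bij_betw g (missing n \<sigma>) (missing n \<tau>)"
      using \<beta> by (rule bij_betw_cong[THEN iffD1, rotated]) (simp add: g_def)
    moreover have "bij_betw g (rays n - missing n \<sigma>) (rays n - missing n \<tau>)"
      using \<gamma> by (rule bij_betw_cong[THEN iffD1, rotated]) (simp add: g_def)
    ultimately have "bij_betw g (missing n \<sigma> \<union> (rays n - missing n \<sigma>)) (missing n \<tau> \<union> (rays n - missing n \<tau>))"
      by (rule bij_betw_combine) blast
    then show "bij_betw g (rays n) (rays n)" using sub by (simp add: Un_absorb1)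
    show "g q = q" if "q \<notin> rays n" for q using that sub by (auto simp: g_def)
  qed
  obtain N :: nat where N: "\<And>i j. i \<in> {1..n} \<Longrightarrow> j > int N \<Longrightarrow> entry \<sigma> i j = (i, nat j)"
    using config_tail[OF cfg(1)] by blast
  obtain L :: nat where L: "\<And>i j. i \<in> {1..n} \<Longrightarrow> j > int L \<Longrightarrow> entry \<tau> i j = (i, nat j)"
    using config_tail[OF cfg(2)] by blast
  obtain B :: nat where B: "\<And>i. i \<in> {1..n} \<Longrightarrow> \<bar>m i\<bar> \<le> int B"
    using bounded_on_indices[of n "m"] by blast
  have tail: "fst (g (k, p)) = k \<and> int (snd (g (k, p))) = int p + m k"
    if k: "k \<in> {1..n}" and p: "p > N + L + B" for k p
  proof -
    have p': "int p > int N" "int p + m k > int L" "int p + m k > 0" using p B[OF k] by linarith+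
    have e: "entry \<sigma> k (int p) = (k, p)" using N[OF k p'(1)] by simp
    moreover have "(k, p) \<in> rays n" using k p by (simp add: rays_def)
    ultimately have "(k, int p) \<in> D a" using config_entry_iff[OF cfg(1), of k "int p"] by (simp add: D_def)
    from g_entry[OF this] have "g (k, p) = (k, nat (int p + m k))" using L[OF k p'(2)] e by simp
    then show ?thesis using p'(3) by simp
  qed
  have ev: "eventual_translation n g"
    unfolding eventual_translation_def
  proof (intro conjI exI)
    show "g permutes rays n" by (rule perm)
    show "finite ({1..n} \<times> {1..N + L + B})" by simp
    show "{1..n} \<times> {1..N + L + B} \<subseteq> rays n" by (auto simp: rays_def)
    show "\<forall>(k, p)\<in>rays n - {1..n} \<times> {1..N + L + B}. fst (g (k, p)) = k \<and> int (snd (g (k, p))) = int p + m k"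
    proof
      fix q assume q: "q \<in> rays n - {1..n} \<times> {1..N + L + B}"
      obtain k p where kp: "q = (k, p)" by (cases q)
      have k: "k \<in> {1..n}" using q by (simp add: kp rays_def)
      moreover have "p > N + L + B" using q k by (auto simp: kp rays_def)
      ultimately show "case q of (k, p) \<Rightarrow> fst (g (k, p)) = k \<and> int (snd (g (k, p))) = int p + m k"
        using tail by (simp add: kp)
    qed
  qed
  have sh: "shift n g i = m i" for i
  proof (cases "i \<in> {1..n}")
    case True
    then show ?thesis using tail by (intro shift_eq) (auto simp: eventually_shifts_def)
  next
    case False
    then have "m i = 0" using config_outside[OF cfg(1) False] config_outside[OF cfg(2) False] by (simp add: m_def)
    then show ?thesis using shift_outside[OF False] by simp
  qed
  have "move n g \<sigma> = \<tau>"
  proof (rule entry_eqI)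
    fix i j
    have ent: "entry (move n g \<sigma>) i j = g (entry \<sigma> i (j - m i))" by (simp add: move_def sh)
    show "entry (move n g \<sigma>) i j = entry \<tau> i j"
    proof (cases "(i, j - m i) \<in> D a")
      case True
      then show ?thesis using g_entry[OF True] by (simp add: ent)
    next
      case False
      then have "\<not> (i \<in> {1..n} \<and> a i < of_int (j - m i))" "\<not> (i \<in> {1..n} \<and> b i < of_int j)"
        by (auto simp: D_def m)
      then show ?thesis
        using config_entry_blank[OF cfg(1)] config_entry_blank[OF cfg(2)] eventual_translation_rays(2)[OF ev]
        by (simp add: ent)
    qed
  qed
  with ev sh m show ?thesis by auto
qed

context
  fixes n :: nat
begin

lemma act_points:
  assumes "eventual_translation n g" "p \<in> points \<X>\<^bsub>n\<^esub>"
  shows "act n p g \<in> points \<X>\<^bsub>n\<^esub>"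
  using assms config_move by (auto simp: points_eq act_def)

lemma right_action_act: "right_action (houghton n) (points \<X>\<^bsub>n\<^esub>) (act n)"
  by (simp add: right_action_def houghton_def act_points act_comp act_id[unfolded id_def] act_id)

lemma string_length_act:
  assumes g: "eventual_translation n g" and "string_length \<X>\<^bsub>n\<^esub> p q l"
  shows "string_length \<X>\<^bsub>n\<^esub> (act n p g) (act n q g) l"
  using assms(2)
proof (induction rule: string_length_houghton_induct)
  case refl
  then show ?case by (intro string_length.refl act_points[OF g])
next
  case (step \<sigma> a x y l)
  let ?t = "\<lambda>x i. x i + of_int (shift n g i)"
  have "?t z \<in> corner_box (?t a) {1..n}" if "z \<in> corner_box a {1..n}" for z
    using that by (simp add: corner_box_translate)
  then have "string_length \<X>\<^bsub>n\<^esub> (pt (move n g \<sigma>) (?t x)) (pt (move n g \<sigma>) (?t y)) (rdist n (?t x) (?t y))"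
    using step.hyps by (intro string_length_box[OF corner_move[OF g step.hyps(1)]]) auto
  from string_length_trans[OF this] step.IH show ?case by (simp add: act_pt[OF g] rdist_translate)
qed

lemma act_inverse:
  assumes "eventual_translation n g"
  shows "act n (act n p g) (inv_into UNIV g) = p" and "act n (act n p (inv_into UNIV g)) g = p"
proof -
  have "inv_into UNIV g \<circ> g = id" "g \<circ> inv_into UNIV g = id"
    using assms permutes_inv_o unfolding eventual_translation_def by blast+
  then show "act n (act n p g) (inv_into UNIV g) = p" "act n (act n p (inv_into UNIV g)) g = p"
    using act_comp assms eventual_translation_inv[OF assms] act_id by metis+
qed

text \<open>A cube goes to a cube by a translation of its coordinates, so strings go to strings of the same length; the
inverse element gives the other inequality.\<close>

lemma length_dist_act:
  assumes g: "eventual_translation n g" and pq: "p \<in> points \<X>\<^bsub>n\<^esub>" "q \<in> points \<X>\<^bsub>n\<^esub>"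
  shows "length_dist \<X>\<^bsub>n\<^esub> (act n p g) (act n q g) = length_dist \<X>\<^bsub>n\<^esub> p q"
proof (rule antisym)
  show "length_dist \<X>\<^bsub>n\<^esub> (act n p g) (act n q g) \<le> length_dist \<X>\<^bsub>n\<^esub> p q"
    using pq by (intro length_dist_mono[OF rectifiably_connected_houghton] string_length_act g)
  have "length_dist \<X>\<^bsub>n\<^esub> (act n (act n p g) (inv_into UNIV g)) (act n (act n q g) (inv_into UNIV g))
      \<le> length_dist \<X>\<^bsub>n\<^esub> (act n p g) (act n q g)"
    by (rule length_dist_mono[OF rectifiably_connected_houghton act_points[OF g pq(1)] act_points[OF g pq(2)]
          string_length_act[OF eventual_translation_inv[OF g]]])
  then show "length_dist \<X>\<^bsub>n\<^esub> p q \<le> length_dist \<X>\<^bsub>n\<^esub> (act n p g) (act n q g)" by (simp add: act_inverse[OF g])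
qed

lemma isometry_act:
  assumes g: "eventual_translation n g"
  shows "isometry_of (points \<X>\<^bsub>n\<^esub>) (length_dist \<X>\<^bsub>n\<^esub>) (\<lambda>p. act n p g)"
proof -
  have "bij_betw (\<lambda>p. act n p g) (points \<X>\<^bsub>n\<^esub>) (points \<X>\<^bsub>n\<^esub>)"
  proof (rule bij_betw_byWitness[where f' = "\<lambda>p. act n p (inv_into UNIV g)"])
    show "(\<lambda>p. act n p g) ` points \<X>\<^bsub>n\<^esub> \<subseteq> points \<X>\<^bsub>n\<^esub>" using act_points[OF g] by blast
    show "(\<lambda>p. act n p (inv_into UNIV g)) ` points \<X>\<^bsub>n\<^esub> \<subseteq> points \<X>\<^bsub>n\<^esub>"
      using act_points[OF eventual_translation_inv[OF g]] by blast
  qed (simp_all add: act_inverse[OF g])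
  then show ?thesis by (simp add: isometry_of_def length_dist_act[OF g])
qed

lemma height_act:
  assumes "eventual_translation n g"
  shows "height n (act n p g) = height n p"
  using sum_shift[OF assms] by (simp add: height_def act_def sum.distrib)

lemma height_nonneg:
  assumes "p \<in> points \<X>\<^bsub>n\<^esub>"
  shows "0 \<le> height n p"
proof -
  have "config n (fst p) (snd p)" using assms by (auto simp: points_eq)
  then have "(\<Sum>i\<in>{1..n}. floors (snd p) i) = real (card (missing n (fst p)))"
    using card_missing(2)[OF corner_floors] by metis
  moreover have "(\<Sum>i\<in>{1..n}. floors (snd p) i) \<le> height n p"
    unfolding height_def by (intro sum_mono floors_le)
  ultimately show ?thesis by simp
qed

text \<open>The displacement is at least the Euclidean length of the vector of shifts, and this value is
attained in the orthant of the identity as soon as all terms present there are moved by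
translation.\<close>

lemma semi_simple_act:
  assumes g: "eventual_translation n g"
  shows "semi_simple (points \<X>\<^bsub>n\<^esub>) (length_dist \<X>\<^bsub>n\<^esub>) (\<lambda>p. act n p g)"
proof -
  let ?t = "\<lambda>x i. x i + of_int (shift n g i)"
  let ?d = "rdist n (\<lambda>_. 0) (\<lambda>i. of_int (shift n g i))"
  have disp: "rdist n x (?t x) = ?d" for x by (simp add: rdist_def)
  have lower: "?d \<le> length_dist \<X>\<^bsub>n\<^esub> p (act n p g)" if "p \<in> points \<X>\<^bsub>n\<^esub>" for p
    using length_dist_ge_rdist[OF that act_points[OF g that]] disp by (simp add: act_def)
  obtain N :: nat where N: "\<And>i p. i \<in> {1..n} \<Longrightarrow> p > N \<Longrightarrow>
     fst (g (i, p)) = i \<and> int (snd (g (i, p))) = int p + shift n g i"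
    using eventual_translation_tail[OF g] by blast
  obtain B :: nat where B: "\<And>i. i \<in> {1..n} \<Longrightarrow> \<bar>shift n g i\<bar> \<le> int B"
    using bounded_on_indices[of n "shift n g"] by blast
  \<comment> \<open>Beyond N the element g is a translation; adding B keeps the shifted coordinates nonnegative.\<close>
  let ?x = "diag n (real (N + B))"
  have x0: "0 \<le> ?x i" "i \<notin> {1..n} \<Longrightarrow> ?x i = 0" for i by (auto simp: diag_def)
  have tx0: "0 \<le> ?t ?x i" "i \<notin> {1..n} \<Longrightarrow> ?t ?x i = 0" for i
    using B[of i] shift_outside[of i n g] by (auto simp: diag_def simp del: shift_outside)
  have cfg: "config n (ident n) (\<lambda>_. 0)" using corner_ident[of n] by (simp add: corner_def)
  have "truncate (move n g (ident n)) (?t ?x) = truncate (ident n) (?t ?x)"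
  proof (rule entry_eqI)
    fix i j
    show "entry (truncate (move n g (ident n)) (?t ?x)) i j = entry (truncate (ident n) (?t ?x)) i j"
    proof (cases "i \<in> {1..n} \<and> ?t ?x i < of_int j")
      case True
      then have "real (N + B) < of_int (j - shift n g i)" by (auto simp: diag_def)
      then have j: "j - shift n g i > int (N + B)" by linarith
      then have "nat (j - shift n g i) > N" "j > 0" using B[of i] True by linarith+
      from N[OF _ this(1)] True j this(2)
      have "fst (g (i, nat (j - shift n g i))) = i" "int (snd (g (i, nat (j - shift n g i)))) = j" by auto
      then have "g (i, nat (j - shift n g i)) = (i, nat j)" by (auto simp: prod_eq_iff)
      then show ?thesis using True j \<open>j > 0\<close> by (simp add: move_def entry_ident)
    next
      case False
      then show ?thesis
        using eventual_translation_rays(2)[OF g] by (auto simp: move_def entry_ident)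
    qed
  qed
  then have "act n (pt (ident n) ?x) g = pt (ident n) (?t ?x)"
    unfolding act_pt[OF g] by (simp add: pt_def)
  then have "length_dist \<X>\<^bsub>n\<^esub> (pt (ident n) ?x) (act n (pt (ident n) ?x) g) \<le> ?d"
    using length_dist_orthant[OF cfg, of ?x "?t ?x"] x0 tx0 disp[of ?x] by simp
  moreover have "pt (ident n) ?x \<in> points \<X>\<^bsub>n\<^esub>"
    using ident_orthant_points[of n] x0 by (auto simp: ident_orthant_def)
  ultimately show ?thesis
    unfolding semi_simple_def using lower by (meson order_trans)
qed

text \<open>An element that moves a point by less than the gap has shift 0 and preserves its sequences, so it
only permutes the finitely many missed values.\<close>

lemma proper_act: "proper_action (houghton n) (points \<X>\<^bsub>n\<^esub>) (length_dist \<X>\<^bsub>n\<^esub>) (act n)"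
  unfolding proper_action_def
proof
  interpret Metric_space "points \<X>\<^bsub>n\<^esub>" "length_dist \<X>\<^bsub>n\<^esub>" by (rule Metric_space_houghton)
  fix p assume p: "p \<in> points \<X>\<^bsub>n\<^esub>"
  then obtain \<sigma> x where px: "p = (\<sigma>, x)" "config n \<sigma> x" by (auto simp: points_eq)
  let ?B = "mball p (gap n x / 2)"
  have "{g \<in> carrier (houghton n). (\<lambda>y. act n y g) ` ?B \<inter> ?B \<noteq> {}} \<subseteq> {g. g permutes missing n \<sigma>}"
  proof
    fix g assume "g \<in> {g \<in> carrier (houghton n). (\<lambda>y. act n y g) ` ?B \<inter> ?B \<noteq> {}}"
    then obtain q where g: "g \<in> carrier (houghton n)" and q: "q \<in> ?B" and qg: "act n q g \<in> ?B"
      by blast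
    have ev: "eventual_translation n g" using g by (simp add: houghton_def)
    have pg: "act n p g \<in> points \<X>\<^bsub>n\<^esub>" using act_points[OF ev p] .
    have "length_dist \<X>\<^bsub>n\<^esub> p (act n p g) \<le> length_dist \<X>\<^bsub>n\<^esub> p (act n q g) + length_dist \<X>\<^bsub>n\<^esub> (act n q g) (act n p g)"
      using qg p pg by (intro triangle) auto
    also have "length_dist \<X>\<^bsub>n\<^esub> (act n q g) (act n p g) = length_dist \<X>\<^bsub>n\<^esub> p q"
      using q p length_dist_act[OF ev, of q p] commute by auto
    finally have "length_dist \<X>\<^bsub>n\<^esub> p (act n p g) < gap n x" using q qg by auto
    then obtain l where l: "string_length \<X>\<^bsub>n\<^esub> p (act n p g) l" "l < gap n x"
      using length_dist_less_imp[OF rectifiably_connected_houghton p pg] by blast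
    have sh: "shift n g i = 0" for i
    proof (cases "i \<in> {1..n}")
      case True
      have "\<bar>x i - snd (act n p g) i\<bar> \<le> l"
        using rdist_le_string_length[OF l(1)] abs_diff_le_rdist[OF True, of x "snd (act n p g)"] px(1) by simp
      then have "\<bar>real_of_int (shift n g i)\<bar> < 1" using l(2) gap_le(1)[of n x] by (simp add: act_def px(1))
      then show ?thesis by linarith
    qed simp
    have cfg: "config n (move n g \<sigma>) x" using config_move[OF ev px(2)] by (simp add: sh)
    have "truncate (move n g \<sigma>) x = \<sigma>"
      using string_less_gap(1)[OF px(2), of "move n g \<sigma>" x l] l by (simp add: act_def px(1) sh)
    then have "move n g \<sigma> = \<sigma>" using truncate_self[OF cfg] by simp
    then have fix_entry: "g (entry \<sigma> i j) = entry \<sigma> i j" for i j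
      using entry_of_entries[of "\<lambda>i j. g (entry \<sigma> i (j - shift n g i))" i j] by (simp add: move_def sh)
    have "g permutes rays n" using ev by (simp add: eventual_translation_def)
    then have "g permutes missing n \<sigma>"
      by (rule permutes_superset) (use fix_entry in \<open>auto simp: missing_def\<close>)
    then show "g \<in> {g. g permutes missing n \<sigma>}" by simp
  qed
  then have "finite {g \<in> carrier (houghton n). (\<lambda>y. act n y g) ` ?B \<inter> ?B \<noteq> {}}"
    using finite_permutations[OF finite_missing[OF px(2)]] finite_subset by blast
  then show "\<exists>r>0. finite {g \<in> carrier (houghton n). (\<lambda>y. act n y g) ` mball p r \<inter> mball p r \<noteq> {}}"
    using gap_pos[of n x] by (intro exI[of _ "gap n x / 2"]) auto
qed

lemma continuous_map_height: "continuous_map (metric_topology \<X>\<^bsub>n\<^esub>) euclideanreal (height n)"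
proof -
  interpret Metric_space "points \<X>\<^bsub>n\<^esub>" "length_dist \<X>\<^bsub>n\<^esub>" by (rule Metric_space_houghton)
  have lip: "\<bar>height n p - height n q\<bar> \<le> real n * length_dist \<X>\<^bsub>n\<^esub> p q" if "p \<in> points \<X>\<^bsub>n\<^esub>" "q \<in> points \<X>\<^bsub>n\<^esub>" for p q
  proof -
    have "\<bar>height n p - height n q\<bar> \<le> (\<Sum>i\<in>{1..n}. \<bar>snd p i - snd q i\<bar>)"
      unfolding height_def by (simp flip: sum_subtractf)
    also have "\<dots> \<le> (\<Sum>i\<in>{1..n}. length_dist \<X>\<^bsub>n\<^esub> p q)"
      using abs_diff_le_rdist[of _ n "snd p" "snd q"] length_dist_ge_rdist[OF that]
      by (intro sum_mono) (meson order_trans)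
    finally show ?thesis by simp
  qed
  have "continuous_map mtopology Met_TC.mtopology (height n)"
    unfolding metric_continuous_map[OF Met_TC.Metric_space_axioms]
  proof (intro conjI ballI allI impI)
    fix p and e :: real assume p: "p \<in> points \<X>\<^bsub>n\<^esub>" and e: "e > 0"
    have "dist (height n p) (height n q) < e" if "q \<in> points \<X>\<^bsub>n\<^esub>" "length_dist \<X>\<^bsub>n\<^esub> p q < e / (real n + 1)" for q
    proof -
      have "real n * length_dist \<X>\<^bsub>n\<^esub> p q \<le> (real n + 1) * length_dist \<X>\<^bsub>n\<^esub> p q"
        by (intro mult_right_mono) auto
      also have "\<dots> < e" using that(2) by (simp add: field_simps)
      finally show ?thesis using lip[OF p that(1)] by (simp add: dist_real_def)
    qed
    then show "\<exists>r>0. \<forall>q. q \<in> points \<X>\<^bsub>n\<^esub> \<and> length_dist \<X>\<^bsub>n\<^esub> p q < r \<longrightarrow> dist (height n p) (height n q) < e"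
      using e by (intro exI[of _ "e / (real n + 1)"]) auto
  qed simp
  then show ?thesis by simp
qed

text \<open>The height is invariant, bounded on compact sets and unbounded on the diagonal of the orthant of
the identity.\<close>

lemma not_cocompact_act:
  assumes "n \<ge> 1"
  shows "\<not> cocompact_action (houghton n) (metric_topology \<X>\<^bsub>n\<^esub>) (points \<X>\<^bsub>n\<^esub>) (act n)"
proof
  assume "cocompact_action (houghton n) (metric_topology \<X>\<^bsub>n\<^esub>) (points \<X>\<^bsub>n\<^esub>) (act n)"
  then obtain K where K: "compactin (metric_topology \<X>\<^bsub>n\<^esub>) K"
    "points \<X>\<^bsub>n\<^esub> = (\<Union>g\<in>carrier (houghton n). (\<lambda>p. act n p g) ` K)"
    unfolding cocompact_action_def by blast
  have "compact (height n ` K)" using image_compactin[OF K(1) continuous_map_height] by simp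
  then obtain B where "\<forall>y\<in>height n ` K. norm y \<le> B"
    using compact_imp_bounded bounded_iff by blast
  then have B: "\<bar>height n p\<bar> \<le> B" if "p \<in> K" for p using that by simp
  let ?p = "pt (ident n) (diag n (\<bar>B\<bar> + 1))"
  have "?p \<in> points \<X>\<^bsub>n\<^esub>"
    using ident_orthant_points[of n] by (auto simp: ident_orthant_def diag_def)
  then obtain g k where g: "eventual_translation n g" "k \<in> K" "?p = act n k g"
    using K(2) by (auto simp: houghton_def)
  have "height n ?p = real n * (\<bar>B\<bar> + 1)" by (simp add: height_def pt_def diag_def)
  moreover have "1 * (\<bar>B\<bar> + 1) \<le> real n * (\<bar>B\<bar> + 1)" using assms by (intro mult_right_mono) auto
  ultimately have "\<bar>B\<bar> + 1 \<le> height n ?p" by simp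
  also have "height n ?p = height n k" unfolding g(3) by (rule height_act[OF g(1)])
  finally show False using B[OF g(2)] by linarith
qed

text \<open>A point of height \<open>r\<close> lies in an \<open>n\<close>-dimensional cube whose bottom corner has an integral height
\<open>k\<close> with \<open>0 \<le> k \<le> r\<close>. By transitivity the bottom corner can be taken to be a chosen vertex of
height \<open>k\<close>; here it is the one with coordinates \<open>(k, 0, \<dots>, 0)\<close> above the identity.\<close>

lemma cocompact_level_set:
  assumes n: "n \<ge> 1"
  shows "cocompact_action (houghton n) (metric_topology \<X>\<^bsub>n\<^esub>) {p \<in> points \<X>\<^bsub>n\<^esub>. height n p = r} (act n)"
proof -
  define a where "a k = (\<lambda>i::nat. if i = 1 then real k else 0)" for k
  define \<sigma> where "\<sigma> k = truncate (ident n) (a k)" for k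
  have cor: "corner n (\<sigma> k) (a k)" for k
    unfolding corner_def \<sigma>_def
  proof (intro conjI allI config_truncate)
    show "config n (ident n) (\<lambda>_. 0)" using corner_ident[of n] by (simp add: corner_def)
  qed (use n in \<open>auto simp: a_def\<close>)
  have sum_a: "(\<Sum>i\<in>{1..n}. a k i) = real k" for k
    using n sum.delta[of "{1..n}" 1 "\<lambda>_. real k"] by (simp add: a_def)
  let ?L = "{p \<in> points \<X>\<^bsub>n\<^esub>. height n p = r}"
  let ?K = "(\<Union>k\<in>{..nat \<lfloor>r\<rfloor>}. closed_cell \<X>\<^bsub>n\<^esub> (\<sigma> k, {1..n})) \<inter> ?L"
  have cell: "(\<sigma> k, {1..n}) \<in> cells \<X>\<^bsub>n\<^esub>" for k using cor by (auto simp: in_cells_iff)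
  have "compactin (metric_topology \<X>\<^bsub>n\<^esub>) (\<Union>k\<in>{..nat \<lfloor>r\<rfloor>}. closed_cell \<X>\<^bsub>n\<^esub> (\<sigma> k, {1..n}))"
    using compactin_closed_cell[OF Metric_space_houghton cell] by (intro compactin_Union) auto
  moreover have "closedin (metric_topology \<X>\<^bsub>n\<^esub>) ?L"
    using closedin_continuous_map_preimage[OF continuous_map_height, of "{r}"]
      Metric_space.topspace_mtopology[OF Metric_space_houghton] by simp
  ultimately have comp: "compactin (metric_topology \<X>\<^bsub>n\<^esub>) ?K"
    by (rule compact_Int_closedin)
  have "?L = (\<Union>g\<in>carrier (houghton n). (\<lambda>p. act n p g) ` ?K)"
  proof
    show "(\<Union>g\<in>carrier (houghton n). (\<lambda>p. act n p g) ` ?K) \<subseteq> ?L"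
      by (auto simp: houghton_def height_act act_points)
    show "?L \<subseteq> (\<Union>g\<in>carrier (houghton n). (\<lambda>p. act n p g) ` ?K)"
    proof clarify
      fix \<tau> x assume p: "(\<tau>, x) \<in> points \<X>\<^bsub>n\<^esub>" and r: "r = height n (\<tau>, x)"
      have cfg: "config n \<tau> x" using p by (simp add: points_eq)
      define b where "b = floors x"
      have corb: "corner n \<tau> b" using corner_floors[OF cfg] by (simp add: b_def)
      define k where "k = card (missing n \<tau>)"
      have k: "(\<Sum>i\<in>{1..n}. b i) = real k" using card_missing(2)[OF corb] by (simp add: k_def)
      have "real k \<le> height n (\<tau>, x)"
        unfolding height_def k[symmetric] b_def by (simp add: sum_mono floors_le)
      then have kr: "k \<le> nat \<lfloor>r\<rfloor>" using r by (simp add: le_nat_floor)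
      have "(\<Sum>i\<in>{1..n}. a k i) = (\<Sum>i\<in>{1..n}. b i)" by (simp only: sum_a k)
      from transitive_on_corners[OF cor corb this] obtain g where g: "eventual_translation n g"
        "move n g (\<sigma> k) = \<tau>" "\<And>i. b i = a k i + of_int (shift n g i)" by blast
      let ?y = "\<lambda>i. x i - of_int (shift n g i)"
      have "x \<in> corner_box b {1..n}"
        unfolding b_def using config_outside[OF cfg] by (rule mem_box_floors)
      moreover have "b = (\<lambda>i. a k i + of_int (shift n g i))" using g(3) by blast
      ultimately have "(\<lambda>i. ?y i + of_int (shift n g i)) \<in> corner_box (\<lambda>i. a k i + of_int (shift n g i)) {1..n}"
        by simp
      then have y: "?y \<in> corner_box (a k) {1..n}" unfolding corner_box_translate .
      have act: "act n (pt (\<sigma> k) ?y) g = (\<tau>, x)"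
        using pt_self[OF cfg] by (simp add: act_pt[OF g(1)] g(2))
      have in_cell: "pt (\<sigma> k) ?y \<in> closed_cell \<X>\<^bsub>n\<^esub> (\<sigma> k, {1..n})"
        using closed_cell_eq[OF cor order_refl] y by auto
      then have "pt (\<sigma> k) ?y \<in> points \<X>\<^bsub>n\<^esub>" using cell by (auto simp: points_def)
      moreover have "height n (pt (\<sigma> k) ?y) = r"
        using height_act[OF g(1), of "pt (\<sigma> k) ?y"] act r by simp
      ultimately have "pt (\<sigma> k) ?y \<in> ?K" using in_cell kr by auto
      moreover have "g \<in> carrier (houghton n)" using g(1) by (simp add: houghton_def)
      ultimately have "(\<tau>, x) \<in> (\<Union>g\<in>carrier (houghton n). (\<lambda>p. act n p g) ` ?K)"
        using act by (metis (no_types, lifting) UN_iff imageI)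
      then show "(\<tau>, x) \<in> (\<Union>g\<in>carrier (houghton n). (\<lambda>p. act n p g) `
          ((\<Union>k\<in>{..nat \<lfloor>height n (\<tau>, x)\<rfloor>}. closed_cell \<X>\<^bsub>n\<^esub> (\<sigma> k, {1..n})) \<inter> {p \<in> points \<X>\<^bsub>n\<^esub>. height n p = height n (\<tau>, x)}))"
        unfolding r .
    qed
  qed
  with comp show ?thesis unfolding cocompact_action_def by blast
qed

end

theorem theorem1:
  fixes n :: nat
  assumes "n \<ge> 1"
  shows "\<exists>(X :: (cell_index, cell_point) cell_structure) h act.
    cubing X \<and> has_dimension X n \<and>
    morse_function X h \<and> (\<forall>x \<in> points X. h x \<ge> 0) \<and>
    right_action (houghton n) (points X) act \<and>
    (\<forall>g \<in> carrier (houghton n).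
       isometry_of (points X) (length_dist X) (\<lambda>x. act x g) \<and>
       semi_simple (points X) (length_dist X) (\<lambda>x. act x g) \<and>
       (\<forall>x \<in> points X. h (act x g) = h x)) \<and>
    proper_action (houghton n) (points X) (length_dist X) act \<and>
    \<not> cocompact_action (houghton n) (metric_topology X) (points X) act \<and>
    (\<forall>r \<ge> 0. cocompact_action (houghton n) (metric_topology X) {x \<in> points X. h x = r} act)"
proof (intro exI conjI ballI allI impI)
  show "cubing (houghton_complex n)" by (rule cubing_houghton)
  show "has_dimension (houghton_complex n) n" by (rule has_dimension_houghton)
  show "morse_function (houghton_complex n) (height n)" by (rule morse_function_height)
  show "right_action (houghton n) (points (houghton_complex n)) (act n)" by (rule right_action_act)
  show "proper_action (houghton n) (points (houghton_complex n)) (length_dist (houghton_complex n)) (act n)"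
    by (rule proper_act)
  show "\<not> cocompact_action (houghton n) (metric_topology (houghton_complex n)) (points (houghton_complex n)) (act n)"
    by (rule not_cocompact_act[OF assms])
  show "cocompact_action (houghton n) (metric_topology (houghton_complex n))
      {x \<in> points (houghton_complex n). height n x = r} (act n)" for r
    by (rule cocompact_level_set[OF assms])
qed (simp_all add: height_nonneg isometry_act semi_simple_act height_act houghton_def)

end
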